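(* Let $B=\frac{\sqrt6}{\pi}$. For every $v\in\mathbb R$, $$\lim_{n\to\infty}\mathbf P_n\left(\frac{\mathrm{PK}-B\sqrt n\log(2B\sqrt n)}{B\sqrt n}\le v\right)=e^{-\frac12e^{-v}},$$ and the expectation of $\mathrm{PK}$ under $\mathbf P_n$ satisfies, as $n\to\infty$, $$\mathbf E_n(\mathrm{PK})=B\sqrt n\log(2B\sqrt n)+B\sqrt n\,(\gamma-\log 2)(1+o(1)),$$ where $\gamma$ is the Euler–Mascheroni constant.
   Context: An odd unimodal sequence of size $n$ is a sequence of odd positive integers $a_1\le\dots\le a_r\le\bar c\ge b_1\ge\dots\ge b_s$ ($r,s\ge0$) with a distinguished peak $\bar c$ and $n=\bar c+\sum_{j=1}^r a_j+\sum_{j=1}^s b_j$. $\mathcal{OU}(n)$ is the set of odd unimodal sequences of size $n$, $\mathbf P_n$ is the uniform probability measure on $\mathcal{OU}(n)$, and $\mathbf E_n$ is expectation under $\mathbf P_n$. For $\lambda\in\mathcal{OU}(n)$, $\mathrm{PK}(\lambda)=\bar c$ is the peak of $\lambda$. *)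

theory Defs
  imports "HOL-Probability.Probability" "HOL-Library.Landau_Symbols"
begin

text \<open>A triple \<open>(a, c, b)\<close> stands for the sequence
  \<open>a\<^sub>1 \<le> \<dots> \<le> a\<^sub>r \<le> c \<ge> b\<^sub>1 \<ge> \<dots> \<ge> b\<^sub>s\<close>.  Keeping the three components separate records which
  entry is the distinguished peak, so the same underlying sequence is counted once for each
  admissible position of its peak.\<close>

type_synonym peaked_seq = "nat list \<times> nat \<times> nat list"

definition odd_unimodal :: "peaked_seq \<Rightarrow> bool" where
  "odd_unimodal = (\<lambda>(a, c, b).
     (\<forall>x \<in> set (a @ c # b). odd x) \<and> sorted_wrt (\<le>) (a @ [c]) \<and> sorted_wrt (\<ge>) (c # b))"

definition seq_size :: "peaked_seq \<Rightarrow> nat" where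
  "seq_size = (\<lambda>(a, c, b). c + sum_list a + sum_list b)"

definition PK :: "peaked_seq \<Rightarrow> nat" where
  "PK = (\<lambda>(a, c, b). c)"

definition OU :: "nat \<Rightarrow> peaked_seq set" where
  "OU n = {l. odd_unimodal l \<and> seq_size l = n}"

lemma finite_OU: "finite (OU n)"
proof (rule finite_subset)
  let ?L = "{xs :: nat list. set xs \<subseteq> {..n} \<and> length xs \<le> n}"
  have len: "length xs \<le> sum_list xs" if "\<forall>x \<in> set xs. odd x" for xs :: "nat list"
    using that
  proof (induction xs)
    case (Cons x xs)
    then have "x \<ge> 1" by (auto elim: oddE)
    with Cons show ?case by simp
  qed simp
  show "OU n \<subseteq> ?L \<times> {..n} \<times> ?L"
  proof
    fix l assume l: "l \<in> OU n"
    obtain a c b where abc: "l = (a, c, b)" by (cases l)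
    from l abc have odds: "\<forall>x \<in> set a. odd x" "\<forall>x \<in> set b. odd x"
      and eq: "c + sum_list a + sum_list b = n"
      by (auto simp: OU_def odd_unimodal_def seq_size_def)
    have "x \<le> n" if "x \<in> set a" for x using member_le_sum_list[OF that] eq by simp
    moreover have "x \<le> n" if "x \<in> set b" for x using member_le_sum_list[OF that] eq by simp
    ultimately show "l \<in> ?L \<times> {..n} \<times> ?L"
      using len[OF odds(1)] len[OF odds(2)] eq abc by auto
  qed
  show "finite (?L \<times> {..n} \<times> ?L)"
    by (intro finite_cartesian_product finite_lists_length_le) auto
qed

lemma OU_nonempty: "n > 0 \<Longrightarrow> OU n \<noteq> {}"
proof -
  assume "n > 0"
  then have "([], 1, replicate (n - 1) 1) \<in> OU n"
    by (auto simp: OU_def odd_unimodal_def seq_size_def sum_list_replicate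
             intro: sorted_wrt_iff_nth_less[THEN iffD2])
  then show ?thesis by blast
qed

text \<open>The uniform distribution on \<open>OU n\<close>.  It is meaningful for \<open>n > 0\<close> only: \<open>OU 0\<close> is empty,
  and \<open>pmf_of_set {}\<close> is unspecified.\<close>

definition OU_pmf :: "nat \<Rightarrow> peaked_seq pmf" where
  "OU_pmf n = pmf_of_set (OU n)"

end

(* Idea. Let t = pi / sqrt (6 n), which is the saddle point of exp (n t) * prod_{k odd} (1 - exp (- k t))^-2,
   and q = exp (- t).  The number of sequences with peak c is the coefficient of q^(n - c) in the product of
   (1 - q^k)^-2 over odd k \<le> c, so by Fourier inversion it is an explicit constant times q^c, times the product of
   (1 - q^k)^2 over odd k > c, times the integral of a characteristic function.  On the scale
   c = (ln (2 / t) + u) / t a local limit theorem makes the integral asymptotically independent of u, while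
   q^c = t / 2 * exp (- u) and the product tends to exp (- exp (- u) / 2).  This is the Gumbel density, and
   dominated convergence gives both the distribution function and the mean; the latter comes from Gamma'(1). *)
theory Submission
  imports Defs "HOL-Real_Asymp.Real_Asymp"
begin

section \<open>Counting by Fourier inversion\<close>

text \<open>Why this t: for q = exp (- t) the two flanks have mean total size equal to the sum over
  odd k of 2 k / (exp (k t) - 1). This is t^-2 times a Riemann sum of mesh 2 t for the integral of x
  / (exp x - 1), which is pi^2 / 6, so the mean is n when n t^2 = pi^2 / 6. The error O(1/t) and the
  typical peak O(log (1/t) / t) are both small against the standard deviation, of order t^(-3/2), so
  one t serves all relevant peaks. Why 1/2 in the limit: odd numbers have spacing 2, so the sum of
  q^k over odd k > c tends to exp (- u) / 4, and there are two flanks. Two obstacles shape the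
  estimates. The characteristic function must be small on all of [-pi, pi], also near pi, where the
  odd multiples of x realign. And dominated convergence needs a bound for every peak, including
  small ones whose flanks have too few part sizes for a local limit theorem. The total number of
  sequences is handled as the same weighted sum with test function 1, so all factors depending on n
  alone cancel in a quotient. Only powers of t matter; numerical constants are generous.\<close>

definition flank_pairs :: "nat \<Rightarrow> nat \<Rightarrow> int \<Rightarrow> (nat list \<times> nat list) set" where
  "flank_pairs i j m = {(a, b). sorted_wrt (\<le>) a \<and> sorted_wrt (\<ge>) b \<and>
     (\<forall>x\<in>set a. odd x \<and> x < 2 * i) \<and> (\<forall>x\<in>set b. odd x \<and> x < 2 * j) \<and>
     int (sum_list a + sum_list b) = m}"

text \<open>Inserting a peak above every part embeds the pairs into a finite set
  \<open>OU\<close>.\<close>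

lemma finite_flank_pairs: "finite (flank_pairs i j m)"
proof -
  let ?c = "2 * max i j + 1"
  have "inj_on (\<lambda>(a, b). (a, ?c, b)) (flank_pairs i j m)"
    by (auto simp: inj_on_def)
  moreover have "(\<lambda>(a, b). (a, ?c, b)) ` flank_pairs i j m \<subseteq> OU (nat m + ?c)"
    by (force simp: flank_pairs_def OU_def odd_unimodal_def seq_size_def sorted_wrt_append)
  ultimately show ?thesis
    using finite_OU finite_subset finite_imageD by metis
qed

text \<open>Swapping and reversing the flanks. This lets the recursion on the left bound serve the
  right bound as well.\<close>

lemma card_flank_pairs_commute: "card (flank_pairs i j m) = card (flank_pairs j i m)"
proof (rule bij_betw_same_card)
  show "bij_betw (\<lambda>(a, b). (rev b, rev a)) (flank_pairs i j m) (flank_pairs j i m)"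
  proof (rule bij_betw_byWitness[where f' = "\<lambda>(a, b). (rev b, rev a)"])
    have "(rev b, rev a) \<in> flank_pairs j i m" if "(a, b) \<in> flank_pairs i j m" for a b i j
      using that unfolding flank_pairs_def by (simp add: sorted_wrt_rev add.commute[of "int (sum_list b)"])
    then show "(\<lambda>(a, b). (rev b, rev a)) ` flank_pairs i j m \<subseteq> flank_pairs j i m"
      "(\<lambda>(a, b). (rev b, rev a)) ` flank_pairs j i m \<subseteq> flank_pairs i j m"
      by auto
  qed auto
qed

text \<open>If the largest admissible part \<open>2 * i + 1\<close> occurs on the left, it stands
  last and one copy can be removed. Separate bounds \<open>i\<close> and \<open>j\<close> let one
  flank grow by one part size at a time, and an integer size keeps the recursion free of side
  conditions.\<close>

lemma flank_pairs_Suc: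
  "flank_pairs (Suc i) j m =
     flank_pairs i j m \<union> (\<lambda>(a, b). (a @ [2 * i + 1], b)) ` flank_pairs (Suc i) j (m - (2 * int i + 1))"
  (is "?L = ?R \<union> ?f ` ?S")
proof (intro equalityI subsetI)
  fix ab assume "ab \<in> ?L"
  then obtain a b where ab: "ab = (a, b)" and *: "(a, b) \<in> ?L" by (cases ab) auto
  show "ab \<in> ?R \<union> ?f ` ?S"
  proof (cases "2 * i + 1 \<in> set a")
    case False
    have "x < 2 * i" if "x \<in> set a" for x
    proof -
      have "odd x" "x < 2 * Suc i" "x \<noteq> 2 * i + 1"
        using * that False by (auto simp: flank_pairs_def)
      then show ?thesis by presburger
    qed
    then show ?thesis using * by (auto simp: ab flank_pairs_def)
  next
    case True
    then obtain a' x where a: "a = a' @ [x]" by (cases a rule: rev_cases) auto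
    have "x < 2 * Suc i" "odd x" "\<forall>y\<in>set a'. y \<le> x"
      using * by (auto simp: flank_pairs_def a sorted_wrt_append)
    moreover have "2 * i + 1 \<le> x" using True calculation(3) by (auto simp: a)
    ultimately have x: "x = 2 * i + 1" by presburger
    have "(a', b) \<in> ?S" using * by (auto simp: flank_pairs_def a x sorted_wrt_append)
    then have "ab \<in> ?f ` ?S" by (force simp: ab a x)
    then show ?thesis ..
  qed
next
  fix ab assume "ab \<in> ?R \<union> ?f ` ?S"
  then show "ab \<in> ?L"
  proof
    assume "ab \<in> ?R" then show ?thesis by (force simp: flank_pairs_def)
  next
    assume "ab \<in> ?f ` ?S"
    then obtain a b where ab: "ab = (a @ [2 * i + 1], b)" and *: "(a, b) \<in> ?S" by auto
    have "y \<le> Suc (2 * i)" if "y \<in> set a" for y using * that by (force simp: flank_pairs_def)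
    then show ?thesis using * by (auto simp: ab flank_pairs_def sorted_wrt_append)
  qed
qed

text \<open>Coefficient form of multiplying the generating function by 1 / (1 - q^(2 i +
  1)).\<close>

lemma card_flank_pairs_Suc:
  "card (flank_pairs (Suc i) j m) =
     card (flank_pairs i j m) + card (flank_pairs (Suc i) j (m - (2 * int i + 1)))"
proof -
  let ?f = "\<lambda>(a, b). (a @ [2 * i + 1], b :: nat list)"
  have "inj_on ?f A" for A by (auto simp: inj_on_def)
  moreover have "flank_pairs i j m \<inter> ?f ` flank_pairs (Suc i) j (m - (2 * int i + 1)) = {}"
    by (auto simp: flank_pairs_def)
  ultimately show ?thesis
    by (subst flank_pairs_Suc, subst card_Un_disjoint) (auto simp: finite_flank_pairs card_image)
qed

lemma flank_pairs_neg: "m < 0 \<Longrightarrow> flank_pairs i j m = {}"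
  by (auto simp: flank_pairs_def)

lemma flank_pairs_0: "flank_pairs 0 0 m = (if m = 0 then {([], [])} else {})"
proof -
  have "a = []" if "\<forall>x\<in>set a. odd x \<and> x < 2 * (0::nat)" for a using that by (cases a) auto
  then show ?thesis by (auto simp: flank_pairs_def)
qed

lemma card_PK_fibre:
  "card {l \<in> OU n. PK l = 2 * s + 1} = card (flank_pairs (Suc s) (Suc s) (int n - (2 * int s + 1)))"
proof (rule bij_betw_same_card)
  \<comment> \<open>The odd numbers below 2 s + 2 are those up to the peak itself; flanks may repeat
    the peak value, hence the bound \<open>Suc s\<close>.\<close>
  have lt: "odd x \<and> x < Suc (Suc (2 * s)) \<longleftrightarrow> odd x \<and> x \<le> Suc (2 * s)" for x by presburger
  have "(a, 2 * s + 1, b) \<in> OU n \<longleftrightarrow> (a, b) \<in> flank_pairs (Suc s) (Suc s) (int n - (2 * int s + 1))" for a b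
  proof -
    have "2 * s + 1 + sum_list a + sum_list b = n \<longleftrightarrow> int (sum_list a + sum_list b) = int n - (2 * int s + 1)"
      by linarith
    then show ?thesis
      unfolding OU_def odd_unimodal_def seq_size_def flank_pairs_def
      by (simp add: sorted_wrt_append lt) blast
  qed
  then show "bij_betw (\<lambda>(a, c, b). (a, b)) {l \<in> OU n. PK l = 2 * s + 1}
          (flank_pairs (Suc s) (Suc s) (int n - (2 * int s + 1)))"
    by (intro bij_betw_byWitness[where f' = "\<lambda>(a, b). (a, 2 * s + 1, b)"])
       (auto simp: PK_def)
qed

lemma PK_OU: assumes "l \<in> OU n" obtains s where "PK l = 2 * s + 1" "s < n"
proof -
  have "odd (PK l)" "PK l \<le> n"
    using assms by (auto simp: OU_def PK_def odd_unimodal_def seq_size_def)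
  then show ?thesis using that by (elim oddE) auto
qed

section \<open>Geometric laws and their Fourier coefficients\<close>

definition geom_cf :: "real \<Rightarrow> real \<Rightarrow> complex" where
  "geom_cf r x = of_real (1 - r) / (1 - of_real r * cis x)"

lemma geom_cf_denom_ne: "0 \<le> r \<Longrightarrow> r < 1 \<Longrightarrow> 1 - of_real r * cis x \<noteq> 0"
proof
  assume r: "0 \<le> r" "r < 1" "1 - complex_of_real r * cis x = 0"
  then have "norm (complex_of_real r * cis x) = 1" by (metis norm_one right_minus_eq)
  then show False using r(1,2) by (simp add: norm_mult)
qed

lemma continuous_geom_cf: "0 \<le> r \<Longrightarrow> r < 1 \<Longrightarrow> continuous_on A (\<lambda>x. geom_cf r (k * x))"
  unfolding geom_cf_def
  by (intro continuous_on_divide ballI continuous_intros geom_cf_denom_ne) auto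

definition fourier_coeff :: "(real \<Rightarrow> complex) \<Rightarrow> int \<Rightarrow> complex" where
  "fourier_coeff f m = (LINT x:{-pi..pi}|lborel. f x * cis (- (of_int m * x)))"

lemma set_integrable_fourier:
  "continuous_on {-pi..pi} f \<Longrightarrow>
     set_integrable lborel {-pi..pi} (\<lambda>x. f x * cis (- (of_int m * x)))"
  by (intro borel_integrable_atLeastAtMost' continuous_intros)

lemma fourier_coeff_one: "fourier_coeff (\<lambda>_. 1) m = (if m = 0 then of_real (2 * pi) else 0)"
proof (cases "m = 0")
  case True
  have "fourier_coeff (\<lambda>_. 1) m = (LINT x:{-pi..pi}|lborel. (1::complex))"
    by (simp add: fourier_coeff_def True)
  also have "\<dots> = of_real (2 * pi)"
    by (simp add: set_lebesgue_integral_def scaleR_conv_of_real)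
  finally show ?thesis using True by simp
next
  case False
  let ?F = "\<lambda>x. \<i> * cis (- (of_int m * x)) / of_int m"
  have "((\<lambda>z. \<i> * exp (\<i> * (- (of_int m * z))) / of_int m) has_field_derivative
      exp (\<i> * (- (of_int m * z)))) (at z)" for z
    using False by (auto intro!: derivative_eq_intros)
  from has_vector_derivative_real_field[OF this]
  have "(?F has_vector_derivative cis (- (of_int m * x))) (at x within A)" for x A
    by (simp add: cis_conv_exp)
  then have "(\<integral>x. indicator {-pi..pi} x *\<^sub>R cis (- (of_int m * x)) \<partial>lborel) = ?F pi - ?F (-pi)"
    by (intro integral_FTC_atLeastAtMost)
       (auto intro!: continuous_intros)
  also have "cis (- (of_int m * pi)) = cis (- (of_int m * (-pi)))"
    by (simp add: complex_eq_iff sin_times_pi_eq_0)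
  finally show ?thesis using False by (simp add: fourier_coeff_def set_lebesgue_integral_def)
qed

lemma norm_fourier_coeff_le:
  assumes "continuous_on {-pi..pi} f"
  obtains C where "\<And>m. norm (fourier_coeff f m) \<le> C"
proof -
  have "norm (fourier_coeff f m) \<le> (LINT x:{-pi..pi}|lborel. norm (f x * cis (- (of_int m * x))))" for m
    unfolding fourier_coeff_def by (rule set_integral_norm_bound set_integrable_fourier assms)+
  then show ?thesis by (intro that) (simp add: norm_mult)
qed

text \<open>The defect \<open>D\<close> of the claimed identity is bounded on negative indices and satisfies
  \<open>D m = r * D (m - k)\<close>, hence vanishes.\<close>

lemma fourier_coeff_geom_step:
  assumes r: "0 \<le> r" "r < 1" and k: "k > 0" and f: "continuous_on {-pi..pi} f"
    and N: "\<And>m. fourier_coeff f m = N m"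
    and N': "\<And>m. N' m = of_real (1 - r) * N m + of_real r * N' (m - k)"
    and neg: "\<And>m. m < 0 \<Longrightarrow> N' m = 0"
  shows "fourier_coeff (\<lambda>x. f x * geom_cf r (of_int k * x)) m = N' m"
proof -
  define g where "g = (\<lambda>x. f x * geom_cf r (of_int k * x))"
  have g: "continuous_on {-pi..pi} g"
    unfolding g_def by (intro continuous_intros f continuous_geom_cf r)
  obtain C where C: "\<And>m. norm (fourier_coeff g m) \<le> C" using norm_fourier_coeff_le[OF g] by metis
  \<comment> \<open>The factor \<open>1 - r * cis (k * x)\<close> cancels the denominator of
    \<open>geom_cf\<close>, and multiplying by \<open>cis (k * x)\<close> shifts the coefficient
    index by \<open>k\<close>.\<close>
  have step: "fourier_coeff g m - of_real r * fourier_coeff g (m - k) = of_real (1 - r) * N m" for m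
  proof -
    have eq: "g x * cis (- (of_int m * x)) - of_real r * (g x * cis (- (of_int (m - k) * x)))
        = of_real (1 - r) * (f x * cis (- (of_int m * x)))" for x
    proof -
      have "cis (- (of_int (m - k) * x)) = cis (of_int k * x) * cis (- (of_int m * x))"
        by (simp add: cis_mult algebra_simps)
      then have "g x * cis (- (of_int m * x)) - of_real r * (g x * cis (- (of_int (m - k) * x)))
        = g x * (1 - of_real r * cis (of_int k * x)) * cis (- (of_int m * x))"
        by (simp add: algebra_simps)
      also have "g x * (1 - of_real r * cis (of_int k * x)) = of_real (1 - r) * f x"
        using geom_cf_denom_ne[OF r, of "of_int k * x"] by (simp add: g_def geom_cf_def)
      finally show ?thesis by simp
    qed
    have "fourier_coeff g m - of_real r * fourier_coeff g (m - k) =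
      (LINT x:{-pi..pi}|lborel. g x * cis (- (of_int m * x)) - of_real r * (g x * cis (- (of_int (m - k) * x))))"
      unfolding fourier_coeff_def
      by (subst set_integral_diff) (auto intro!: set_integrable_fourier g simp del: of_int_diff)
    also have "\<dots> = of_real (1 - r) * fourier_coeff f m"
      unfolding eq fourier_coeff_def by (rule set_integral_mult_right)
    finally show ?thesis using N by simp
  qed
  define D where "D m = fourier_coeff g m - N' m" for m
  have D: "D m = of_real r * D (m - k)" for m
    unfolding D_def right_diff_distrib N'[of m] step[of m, symmetric] by simp
  have Dj: "D m = of_real r ^ j * D (m - int j * k)" for j
  proof (induction j)
    case (Suc j)
    then show ?case using D[of "m - int j * k"] by (simp add: algebra_simps)
  qed simp
  have "(\<lambda>j. r ^ j * C) \<longlonglongrightarrow> 0"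
    using r by (auto intro!: tendsto_mult_left_zero LIMSEQ_power_zero)
  moreover have "eventually (\<lambda>j. norm (D m) \<le> r ^ j * C) sequentially"
    using eventually_gt_at_top[of "nat \<bar>m\<bar>"]
  proof eventually_elim
    case (elim j)
    have "int j \<le> int j * k" using k by (simp add: mult_le_cancel_left1)
    then have "m - int j * k < 0" using elim by linarith
    then have "norm (D (m - int j * k)) \<le> C" using C neg by (simp add: D_def)
    then show ?case using r by (subst Dj[of j]) (auto simp: norm_mult norm_power intro!: mult_left_mono)
  qed
  ultimately have "norm (D m) \<le> 0"
    by (rule tendsto_lowerbound) simp
  then show ?thesis by (simp add: D_def g_def)
qed

text \<open>Characteristic function of the size of one random flank: each odd k < 2 s occurs with an
  independent geometric multiplicity of ratio exp (- k t).\<close>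

definition parts_cf :: "real \<Rightarrow> nat \<Rightarrow> real \<Rightarrow> complex" where
  "parts_cf t s x = (\<Prod>j<s. geom_cf (exp (- ((2 * real j + 1) * t))) ((2 * real j + 1) * x))"

text \<open>The reciprocal of the generating function of one flank at q = exp (- t), that is, the
  normalising constant of the random flank.\<close>

definition parts_gf :: "real \<Rightarrow> nat \<Rightarrow> real" where
  "parts_gf t s = (\<Prod>j<s. 1 - exp (- ((2 * real j + 1) * t)))"

lemma continuous_parts_cf: "t > 0 \<Longrightarrow> continuous_on A (parts_cf t s)"
  unfolding parts_cf_def by (intro continuous_intros continuous_geom_cf) auto

text \<open>Exponential tilting: two independent random flanks form any given pair of total size m
  with probability exp (- m t) times the two products. The factor \<open>2 * pi\<close> stems from
  the unnormalised \<open>fourier_coeff\<close>. The induction adds part sizes on the left, then on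
  the right by symmetry.\<close>

lemma fourier_coeff_parts_cf:
  assumes t: "t > 0"
  shows "fourier_coeff (\<lambda>x. parts_cf t i x * parts_cf t j x) m =
    of_real (2 * pi * real (card (flank_pairs i j m)) * exp (- (of_int m * t)) * parts_gf t i * parts_gf t j)"
    (is "_ = of_real (?N i j m)")
proof -
  have step: "fourier_coeff (\<lambda>x. f x * geom_cf (exp (- ((2 * real i + 1) * t))) ((2 * real i + 1) * x)) m
      = of_real (?N (Suc i) j m)"
    if f: "continuous_on {-pi..pi} f" "\<And>m. fourier_coeff f m = of_real (?N i j m)" for f i j m
  proof -
    define r where "r = exp (- ((2 * real i + 1) * t))"
    have r: "0 \<le> r" "r < 1" using t by (auto simp: r_def)
    have "?N (Suc i) j m = (1 - r) * ?N i j m + r * ?N (Suc i) j (m - (2 * int i + 1))" for m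
    proof -
      have "exp (- (of_int m * t)) = r * exp (- (of_int (m - (2 * int i + 1)) * t))"
        unfolding r_def exp_add[symmetric] by (simp add: algebra_simps)
      moreover have "parts_gf t (Suc i) = (1 - r) * parts_gf t i"
        by (simp add: parts_gf_def r_def)
      ultimately show ?thesis
        unfolding card_flank_pairs_Suc[of i j m] of_nat_add by algebra
    qed
    then have rec: "complex_of_real (?N (Suc i) j m) = of_real (1 - r) * of_real (?N i j m) +
        of_real r * of_real (?N (Suc i) j (m - (2 * int i + 1)))" for m
      unfolding of_real_mult[symmetric] of_real_add[symmetric] by (rule arg_cong)
    have "fourier_coeff (\<lambda>x. f x * geom_cf r (of_int (2 * int i + 1) * x)) m = of_real (?N (Suc i) j m)"
      by (rule fourier_coeff_geom_step[where f = f and N = "\<lambda>m. of_real (?N i j m)"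
            and N' = "\<lambda>m. of_real (?N (Suc i) j m)", OF r _ f(1) f(2) rec])
        (simp_all add: flank_pairs_neg)
    then show ?thesis by (simp add: r_def)
  qed
  have base: "fourier_coeff (\<lambda>x. parts_cf t 0 x * parts_cf t 0 x) m = of_real (?N 0 0 m)" for m
    by (simp add: parts_cf_def parts_gf_def flank_pairs_0 fourier_coeff_one)
  have row: "fourier_coeff (\<lambda>x. parts_cf t i x * parts_cf t 0 x) m = of_real (?N i 0 m)" for i m
  proof (induction i arbitrary: m)
    case (Suc i)
    have "(\<lambda>x. parts_cf t (Suc i) x * parts_cf t 0 x) = (\<lambda>x. (parts_cf t i x * parts_cf t 0 x) *
        geom_cf (exp (- ((2 * real i + 1) * t))) ((2 * real i + 1) * x))"
      by (simp add: parts_cf_def)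
    then show ?case
      by (simp only:) (intro step Suc continuous_intros continuous_parts_cf t)
  qed (rule base)
  show ?thesis
  proof (induction j arbitrary: m)
    case (Suc j)
    have eq: "(\<lambda>x. parts_cf t i x * parts_cf t (Suc j) x) = (\<lambda>x. (parts_cf t i x * parts_cf t j x) *
        geom_cf (exp (- ((2 * real j + 1) * t))) ((2 * real j + 1) * x))"
      by (simp add: parts_cf_def mult.assoc)
    have comm: "?N i j m = ?N j i m" for i j m by (simp add: card_flank_pairs_commute[of i j])
    show ?case
      by (subst eq, subst comm, rule step)
         (auto intro!: continuous_intros continuous_parts_cf t simp only: Suc comm)
  qed (rule row)
qed

section \<open>Bounds for characteristic functions\<close>

lemma norm_geom_cf_sq:
  assumes "0 \<le> r" "r < 1"
  shows "(norm (geom_cf r x))\<^sup>2 = 1 / (1 + 2 * r * (1 - cos x) / (1 - r)\<^sup>2)"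
proof -
  have "(norm (1 - of_real r * cis x))\<^sup>2 = (1 - r * cos x)\<^sup>2 + (r * sin x)\<^sup>2"
    by (simp add: cmod_power2)
  also have "\<dots> = (1 - r)\<^sup>2 + 2 * r * (1 - cos x)"
    using sin_cos_squared_add[of x] by algebra
  finally have "(norm (geom_cf r x))\<^sup>2 = (1 - r)\<^sup>2 / ((1 - r)\<^sup>2 + 2 * r * (1 - cos x))"
    unfolding geom_cf_def norm_divide norm_of_real power_divide by simp
  then show ?thesis using assms by (simp add: divide_simps)
qed

lemma norm_geom_cf_le_1: "0 \<le> r \<Longrightarrow> r < 1 \<Longrightarrow> norm (geom_cf r x) \<le> 1"
proof -
  assume r: "0 \<le> r" "r < 1"
  have "(norm (geom_cf r x))\<^sup>2 \<le> 1"
    using r by (subst norm_geom_cf_sq) (auto simp: divide_le_eq_1)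
  then show ?thesis by (simp add: power_le_one_iff abs_square_le_1)
qed

text \<open>The left side is the derivative of log (\<open>geom_cf r s\<close>) after removal of the
  mean r / (1 - r) and of the Gaussian factor with variance r / (1 - r)^2. What remains is of second
  order in \<open>s\<close>.\<close>

lemma geom_cf_drift_bound:
  assumes r: "0 \<le> r" "r < 1"
  shows "norm (\<i> * (of_real r * cis s / (1 - of_real r * cis s) - of_real (r / (1 - r)))
            + of_real (r / (1 - r)\<^sup>2 * s)) \<le> r / (1 - r) ^ 3 * s\<^sup>2"
proof -
  define e where "e = cis s"
  define d where "d = 1 - of_real r * e"
  define D where "D = 1 - r"
  have D: "D > 0" using r by (simp add: D_def)
  have d0: "d \<noteq> 0" using geom_cf_denom_ne[OF r] by (simp add: d_def e_def)
  have nd: "D \<le> norm d"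
    using norm_triangle_ineq2[of 1 "of_real r * e"] r by (simp add: d_def D_def e_def norm_mult)
  have e1: "norm (e - 1) \<le> \<bar>s\<bar>" using iexp_approx1[of s 0] by (simp add: e_def cis_conv_exp)
  have e2: "norm (e - 1 - \<i> * of_real s) \<le> s\<^sup>2 / 2"
    using iexp_approx1[of s 1] by (simp add: e_def cis_conv_exp algebra_simps numeral_2_eq_2)
  have cD: "complex_of_real D \<noteq> 0" using D by simp
  have rD: "of_real r = 1 - complex_of_real D" by (simp add: D_def)
  have dd: "d = 1 - (1 - complex_of_real D) * e" by (simp add: d_def rD)
  \<comment> \<open>Rearranged so that only the Taylor remainders \<open>e - 1 - \<i> * s\<close>
    and \<open>1 - e\<close> appear, of orders s^2 and s.\<close>
  have "\<i> * (of_real r * e / d - of_real (r / D)) + of_real (r / D\<^sup>2 * s)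
      = of_real (r / D) * (\<i> * (e - 1 - \<i> * of_real s) / d + of_real s * of_real r * (1 - e) / (d * of_real D))"
  proof -
    have "\<i> * (of_real r * e / d - of_real (r / D)) + of_real (r / D\<^sup>2 * s) =
       of_real r * (\<i> * (e * of_real D - d) * of_real D + of_real s * d) / (d * (of_real D)\<^sup>2)"
      using d0 cD by (simp add: field_simps power2_eq_square)
    moreover have "of_real (r / D) * (\<i> * (e - 1 - \<i> * of_real s) / d + of_real s * of_real r * (1 - e) / (d * of_real D))
       = of_real r * (\<i> * (e - 1 - \<i> * of_real s) * of_real D + of_real s * of_real r * (1 - e)) / (d * (of_real D)\<^sup>2)"
      using d0 cD by (simp add: field_simps power2_eq_square)
    moreover have "\<i> * (e * of_real D - d) * of_real D + of_real s * d =
        \<i> * (e - 1 - \<i> * of_real s) * of_real D + of_real s * of_real r * (1 - e)"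
      unfolding dd rD by (simp add: algebra_simps)
    ultimately show ?thesis by simp
  qed
  also have "norm \<dots> \<le> (r / D) * (s\<^sup>2 / 2 / D + \<bar>s\<bar> * r * \<bar>s\<bar> / (D * D))"
  proof -
    have "norm (\<i> * (e - 1 - \<i> * of_real s) / d) \<le> s\<^sup>2 / 2 / D"
      unfolding norm_divide norm_mult using e2 nd D by (intro frac_le) auto
    moreover have "norm (of_real s * of_real r * (1 - e) / (d * of_real D)) \<le> \<bar>s\<bar> * r * \<bar>s\<bar> / (D * D)"
      unfolding norm_divide norm_mult using e1 nd D r
      by (intro frac_le mult_mono) (auto simp: norm_minus_commute)
    ultimately show ?thesis
      unfolding norm_mult using r D by (intro mult_mono norm_triangle_mono) (auto simp: norm_divide)
  qed
  also have "\<dots> = r / D ^ 3 * s\<^sup>2 * (D / 2 + r)"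
    using D by (simp add: field_simps power2_eq_square power3_eq_cube abs_mult_self_eq flip: abs_mult)
  also have "\<dots> \<le> r / D ^ 3 * s\<^sup>2 * 1"
  proof (rule mult_left_mono)
    show "D / 2 + r \<le> 1" unfolding D_def using r by (simp add: field_simps)
  qed (use r D in auto)
  finally show ?thesis by (simp add: e_def d_def D_def)
qed

text \<open>The quotient \<open>G\<close> of the centred characteristic function by the Gaussian one satisfies
  \<open>G' = E * G\<close> with the quadratically small \<open>E\<close> of the preceding lemma.\<close>

lemma geom_cf_gaussian:
  assumes r: "0 \<le> r" "r < 1"
  shows "norm (geom_cf r x * cis (- (r / (1 - r) * x)) - of_real (exp (- (r / (1 - r)\<^sup>2 * x\<^sup>2 / 2))))
         \<le> r / (1 - r) ^ 3 * \<bar>x\<bar> ^ 3"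
proof -
  define a where "a = r / (1 - r)"
  define v where "v = r / (1 - r)\<^sup>2"
  have v: "v \<ge> 0" using r by (simp add: v_def)
  define G where "G z = of_real (1 - r) / (1 - of_real r * exp (\<i> * z)) * exp (- (\<i> * of_real a * z))
      * exp (of_real v * z\<^sup>2 / 2)" for z
  define E where "E z = \<i> * (of_real r * exp (\<i> * z) / (1 - of_real r * exp (\<i> * z)) - of_real a) + of_real v * z" for z
  have G_real: "G (of_real s) = geom_cf r s * cis (- (a * s)) * of_real (exp (v * s\<^sup>2 / 2))" for s
    by (simp add: G_def geom_cf_def cis_conv_exp exp_of_real[symmetric] mult.assoc)
  have E_real: "norm (E (of_real s)) \<le> r / (1 - r) ^ 3 * s\<^sup>2" for s
    using geom_cf_drift_bound[OF r, of s] by (simp add: E_def a_def v_def cis_conv_exp)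
  have nz: "1 - of_real r * exp (\<i> * of_real s) \<noteq> 0" for s
    using geom_cf_denom_ne[OF r, of s] by (simp add: cis_conv_exp)
  let ?S = "closed_segment 0 (complex_of_real x)"
  have S: "\<exists>s. z = of_real s \<and> \<bar>s\<bar> \<le> \<bar>x\<bar>" if "z \<in> ?S" for z
  proof -
    obtain u where "z = of_real (u * x)" "0 \<le> u" "u \<le> 1"
      using \<open>z \<in> ?S\<close> by (auto simp: in_segment scaleR_conv_of_real)
    then show ?thesis
      by (intro exI[of _ "u * x"]) (simp add: abs_mult mult_left_le_one_le)
  qed
  \<comment> \<open>Mean value inequality on the real segment, for which \<open>G\<close> is taken
    as a function of a complex variable. Since \<open>geom_cf\<close> has norm at most 1,
    \<open>G\<close> is at most \<open>exp (v * x\<^sup>2 / 2)\<close>, and this factor cancels when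
    returning from \<open>G\<close> to the characteristic function.\<close>
  have "norm (G (of_real x) - G 0) \<le> (exp (v * x\<^sup>2 / 2) * (r / (1 - r) ^ 3 * x\<^sup>2)) * norm (of_real x - (0::complex))"
  proof (rule field_differentiable_bound[where S = ?S and f' = "\<lambda>z. G z * E z"])
    fix z assume "z \<in> ?S"
    then obtain s where s: "z = of_real s" "\<bar>s\<bar> \<le> \<bar>x\<bar>" using S by blast
    have s2: "s\<^sup>2 \<le> x\<^sup>2" using s(2) by (simp add: abs_le_square_iff)
    define P where "P z = of_real (1 - r) / (1 - of_real r * exp (\<i> * z))" for z
    have dP: "(P has_field_derivative P z * (\<i> * (of_real r * exp (\<i> * z) / (1 - of_real r * exp (\<i> * z))))) (at z)"
      unfolding P_def using nz[of s]
      by (auto intro!: derivative_eq_intros simp: s)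
    have dQ: "((\<lambda>z. exp (- (\<i> * of_real a * z))) has_field_derivative
        exp (- (\<i> * of_real a * z)) * (- (\<i> * of_real a))) (at z)"
      by (auto intro!: derivative_eq_intros)
    have dR: "((\<lambda>z. exp (of_real v * z\<^sup>2 / 2)) has_field_derivative
        exp (of_real v * z\<^sup>2 / 2) * (of_real v * z)) (at z)"
      by (auto intro!: derivative_eq_intros)
    define X where "X = of_real r * exp (\<i> * z) / (1 - of_real r * exp (\<i> * z))"
    have G_eq: "G = (\<lambda>z. P z * exp (- (\<i> * of_real a * z)) * exp (of_real v * z\<^sup>2 / 2))"
      unfolding G_def P_def ..
    have E_eq: "E z = \<i> * (X - of_real a) + of_real v * z" by (simp add: E_def X_def)
    have "(G has_field_derivative G z * E z) (at z)"
      unfolding G_eq E_eq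
      by (rule DERIV_cong[OF DERIV_mult[OF DERIV_mult[OF dP[folded X_def] dQ] dR]]) (simp add: algebra_simps)
    then show "(G has_field_derivative G z * E z) (at z within ?S)"
      by (rule has_field_derivative_at_within)
    have "norm (geom_cf r s) * exp (v * s\<^sup>2 / 2) \<le> 1 * exp (v * x\<^sup>2 / 2)"
      using norm_geom_cf_le_1[OF r] s2 v by (intro mult_mono) (auto intro!: mult_left_mono)
    moreover have "norm (E z) \<le> r / (1 - r) ^ 3 * x\<^sup>2"
      unfolding s using s2 r by (intro order_trans[OF E_real mult_left_mono]) auto
    ultimately show "norm (G z * E z) \<le> exp (v * x\<^sup>2 / 2) * (r / (1 - r) ^ 3 * x\<^sup>2)"
      unfolding s norm_mult G_real by (intro mult_mono) (auto simp: norm_mult)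
  qed auto
  moreover have "G 0 = 1" using r by (simp add: G_def)
  moreover have "G (of_real x) - 1 = of_real (exp (v * x\<^sup>2 / 2)) *
      (geom_cf r x * cis (- (a * x)) - of_real (exp (- (v * x\<^sup>2 / 2))))"
    by (simp add: G_real algebra_simps flip: of_real_mult exp_add)
  ultimately have "exp (v * x\<^sup>2 / 2) * norm (geom_cf r x * cis (- (a * x)) - of_real (exp (- (v * x\<^sup>2 / 2))))
      \<le> exp (v * x\<^sup>2 / 2) * (r / (1 - r) ^ 3 * x\<^sup>2 * \<bar>x\<bar>)"
    by (simp add: norm_mult mult.assoc)
  then have "norm (geom_cf r x * cis (- (a * x)) - of_real (exp (- (v * x\<^sup>2 / 2))))
      \<le> r / (1 - r) ^ 3 * x\<^sup>2 * \<bar>x\<bar>"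
    by (simp only: mult_le_cancel_left_pos exp_gt_zero)
  also have "r / (1 - r) ^ 3 * x\<^sup>2 * \<bar>x\<bar> = r / (1 - r) ^ 3 * \<bar>x\<bar> ^ 3"
    by (simp add: power3_eq_cube power2_eq_square)
  finally show ?thesis by (simp only: a_def v_def)
qed

section \<open>Decay of the characteristic function: major and minor arcs\<close>

lemma cos_le_quadratic: "\<bar>y\<bar> \<le> pi \<Longrightarrow> y\<^sup>2 / 12 \<le> 1 - cos y"
proof -
  assume y: "\<bar>y\<bar> \<le> pi"
  then have "\<bar>y\<bar> \<le> 3.15" using pi_approx by simp
  then have "\<bar>y\<bar>\<^sup>2 \<le> 3.15\<^sup>2" by (intro power_mono) auto
  then have y2: "y\<^sup>2 \<le> 10" by (simp add: power2_eq_square)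
  have "norm (iexp y - (\<Sum>k\<le>3. (\<i> * y) ^ k / fact k)) \<le> \<bar>y\<bar> ^ 4 / 24"
    using iexp_approx1[of y 3] by (simp add: eval_nat_numeral)
  moreover have "Re (iexp y - (\<Sum>k\<le>3. (\<i> * y) ^ k / fact k)) = cos y - (1 - y\<^sup>2 / 2)"
    by (simp add: eval_nat_numeral Re_exp)
  ultimately have "cos y - (1 - y\<^sup>2 / 2) \<le> \<bar>y\<bar> ^ 4 / 24"
    using complex_Re_le_cmod[of "iexp y - (\<Sum>k\<le>3. (\<i> * y) ^ k / fact k)"] by linarith
  also have "\<bar>y\<bar> ^ 4 = y\<^sup>2 * y\<^sup>2" by (simp add: power4_eq_xxxx power2_eq_square)
  \<comment> \<open>The constant in the claim is 1/2 - 10/24 = 1/12.\<close>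
  also have "y\<^sup>2 * y\<^sup>2 \<le> 10 * y\<^sup>2" using y2 by (intro mult_right_mono) auto
  finally show ?thesis by simp
qed

lemma sin_ge_half: "0 \<le> y \<Longrightarrow> y \<le> pi / 2 \<Longrightarrow> y / 2 \<le> sin y"
proof -
  assume y: "0 \<le> y" "y \<le> pi / 2"
  then have "y \<le> 1.6" using pi_approx by simp
  then have "y\<^sup>2 \<le> 1.6\<^sup>2" using y by (intro power_mono) auto
  then have y2: "y\<^sup>2 \<le> 3" by (simp add: power2_eq_square)
  have "norm (iexp y - (\<Sum>k\<le>2. (\<i> * y) ^ k / fact k)) \<le> \<bar>y\<bar> ^ 3 / 6"
    using iexp_approx1[of y 2] by (simp add: eval_nat_numeral)
  moreover have "Im (iexp y - (\<Sum>k\<le>2. (\<i> * y) ^ k / fact k)) = sin y - y"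
    by (simp add: eval_nat_numeral Im_exp)
  ultimately have "\<bar>sin y - y\<bar> \<le> \<bar>y\<bar> ^ 3 / 6"
    using abs_Im_le_cmod[of "iexp y - (\<Sum>k\<le>2. (\<i> * y) ^ k / fact k)"] by linarith
  also have "\<bar>y\<bar> ^ 3 = y\<^sup>2 * y" using y by (simp add: power3_eq_cube power2_eq_square)
  also have "y\<^sup>2 * y \<le> 3 * y" using y y2 by (intro mult_right_mono) auto
  finally show ?thesis by linarith
qed

lemma sum_cos_odd: "2 * sin x * (\<Sum>j<M. cos ((2 * real j + 1) * x)) = sin (2 * real M * x)"
proof (induction M)
  case (Suc M)
  have "2 * sin x * cos ((2 * real M + 1) * x) = sin (2 * real (Suc M) * x) - sin (2 * real M * x)"
  proof -
    define A where "A = (2 * real M + 1) * x"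
    have "2 * real (Suc M) * x = A + x" "2 * real M * x = A - x" by (simp_all add: A_def algebra_simps)
    then show ?thesis by (simp add: A_def[symmetric] sin_add sin_diff)
  qed
  then show ?case using Suc by (simp add: algebra_simps)
qed simp

text \<open>The sum equals sin (2 M x) / (2 sin x), and sin x >= x / 2 >= 3 / (4 M) on the first
  half of the range. Beyond pi / 2 the reflection x -> pi - |x| reverses the sign, because all
  multiples are odd. Close to pi there is no cancellation, but the sum is then nonpositive, which is
  the favourable sign.\<close>

lemma sum_cos_odd_le:
  assumes M: "M > 0" and x: "pi / (2 * real M) \<le> \<bar>x\<bar>" "\<bar>x\<bar> \<le> pi"
  shows "(\<Sum>j<M. cos ((2 * real j + 1) * x)) \<le> 2 / 3 * real M"
proof -
  define S where "S y = (\<Sum>j<M. cos ((2 * real j + 1) * y))" for y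
  have S: "2 * sin y * S y = sin (2 * real M * y)" for y using sum_cos_odd by (simp add: S_def)
  have bound: "\<bar>S y\<bar> \<le> 2 / 3 * real M" if y: "pi / (2 * real M) \<le> y" "y \<le> pi / 2" for y
  proof -
    have "3 / (4 * real M) \<le> pi / (4 * real M)"
      using pi_approx M by (intro divide_right_mono) auto
    also have "pi / (4 * real M) \<le> y / 2" using y by simp
    also have "y / 2 \<le> sin y" using y M by (intro sin_ge_half) (auto intro: order_trans[rotated])
    finally have sn: "3 / (4 * real M) \<le> sin y" .
    have "2 * (3 / (4 * real M)) * \<bar>S y\<bar> \<le> 2 * sin y * \<bar>S y\<bar>"
      using sn by (intro mult_right_mono) auto
    also have "\<dots> = \<bar>2 * sin y * S y\<bar>"
      using order_trans[OF _ sn, of 0] by (simp add: abs_mult)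
    also have "\<dots> \<le> 1" unfolding S by (simp add: abs_sin_le_one)
    finally show ?thesis using M by (simp add: field_simps)
  qed
  have even: "S \<bar>x\<bar> = S x" by (cases "x \<ge> 0") (auto simp: S_def)
  show ?thesis
  proof (cases "\<bar>x\<bar> \<le> pi / 2")
    case True
    then show ?thesis using bound[of "\<bar>x\<bar>"] x even by (simp add: S_def)
  next
    case False
    define y where "y = pi - \<bar>x\<bar>"
    have y: "0 \<le> y" "y \<le> pi / 2" using False x by (auto simp: y_def)
    have Sx: "S x = - S y"
    proof -
      have "cos ((2 * real j + 1) * \<bar>x\<bar>) = - cos ((2 * real j + 1) * y)" for j
      proof -
        have "(2 * real j + 1) * \<bar>x\<bar> = real (2 * j + 1) * pi - (2 * real j + 1) * y"
          by (simp add: y_def algebra_simps)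
        then show ?thesis by (simp only: cos_diff cos_npi sin_npi) simp
      qed
      then have "S \<bar>x\<bar> = - S y" by (simp add: S_def sum_negf)
      then show ?thesis by (simp add: even)
    qed
    show ?thesis
    proof (cases "pi / (2 * real M) \<le> y")
      case True
      then show ?thesis using bound[OF True y(2)] Sx by (simp add: S_def)
    next
      case False
      have "S y \<ge> 0"
      proof (cases "y = 0")
        case False
        then have "sin y > 0" using y by (intro sin_gt_zero) auto
        moreover have "2 * real M * y \<le> pi" using \<open>\<not> pi / (2 * real M) \<le> y\<close> M by (simp add: field_simps)
        then have "sin (2 * real M * y) \<ge> 0" using y by (intro sin_ge_zero) auto
        ultimately show ?thesis using S[of y] by (metis mult_pos_pos not_le mult_pos_neg zero_less_numeral)
      qed (simp add: S_def)
      then show ?thesis using Sx by (simp add: S_def)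
    qed
  qed
qed

lemma norm_parts_cf_le: assumes "t > 0" "M \<le> s" shows "norm (parts_cf t s x) \<le> norm (parts_cf t M x)"
proof -
  let ?f = "\<lambda>j. norm (geom_cf (exp (- ((2 * real j + 1) * t))) ((2 * real j + 1) * x))"
  have "(\<Prod>j<s. ?f j) = (\<Prod>j<M. ?f j) * (\<Prod>j\<in>{..<s} - {..<M}. ?f j)"
    using assms by (subst prod.subset_diff[of "{..<M}"]) auto
  moreover have "(\<Prod>j\<in>{..<s} - {..<M}. ?f j) \<le> 1"
    using assms by (intro prod_le_1) (auto intro!: norm_geom_cf_le_1)
  ultimately show ?thesis
    by (simp add: parts_cf_def prod_norm[symmetric] mult_left_le prod_nonneg)
qed

text \<open>For k t <= 1 the ratio r = exp (- k t) satisfies r >= 1/e >= 1/3 and 1 - r <= k t, so 2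
  r / (1 - r)^2 is at least (2/3) / (k t)^2.\<close>

lemma norm_parts_cf_sq_le_prod:
  assumes t: "t > 0" and M: "2 * real M * t \<le> 1"
  shows "(norm (parts_cf t M x))\<^sup>2 \<le>
     (\<Prod>j<M. 1 / (1 + 2 / 3 * (1 - cos ((2 * real j + 1) * x)) / ((2 * real j + 1) * t)\<^sup>2))"
proof -
  have "(norm (parts_cf t M x))\<^sup>2 =
    (\<Prod>j<M. (norm (geom_cf (exp (- ((2 * real j + 1) * t))) ((2 * real j + 1) * x)))\<^sup>2)"
    by (simp add: parts_cf_def prod_norm[symmetric] prod_power_distrib)
  also have "\<dots> \<le> (\<Prod>j<M. 1 / (1 + 2 / 3 * (1 - cos ((2 * real j + 1) * x)) / ((2 * real j + 1) * t)\<^sup>2))"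
  proof (intro prod_mono conjI)
    fix j assume j: "j \<in> {..<M}"
    define k where "k = (2 * real j + 1) * t"
    define r where "r = exp (- k)"
    have k: "0 < k" using t by (simp add: k_def)
    have "k \<le> 1"
    proof -
      have "2 * real j + 1 \<le> 2 * real M" using j by auto
      then show ?thesis using M t unfolding k_def
        by (meson less_imp_le mult_right_mono order_trans)
    qed
    then have "exp (-1) \<le> r" by (simp add: r_def)
    moreover have "exp (-1) \<ge> (1/3::real)"
      using exp_le by (simp add: exp_minus field_simps)
    ultimately have r3: "1 / 3 \<le> r" by simp
    have r1: "r < 1" using k by (simp add: r_def)
    have rk: "1 - r \<le> k" using exp_ge_add_one_self[of "-k"] by (simp add: r_def)
    have c: "0 \<le> 1 - cos ((2 * real j + 1) * x)" by simp
    have "2 / 3 * (1 - cos ((2 * real j + 1) * x)) / k\<^sup>2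
        \<le> 2 * r * (1 - cos ((2 * real j + 1) * x)) / (1 - r)\<^sup>2"
      using r3 r1 rk c k by (intro frac_le mult_right_mono power_mono) (auto intro: mult_nonneg_nonneg)
    moreover have "0 \<le> 2 / 3 * (1 - cos ((2 * real j + 1) * x)) / k\<^sup>2" using c by auto
    ultimately show "(norm (geom_cf (exp (- ((2 * real j + 1) * t))) ((2 * real j + 1) * x)))\<^sup>2
       \<le> 1 / (1 + 2 / 3 * (1 - cos ((2 * real j + 1) * x)) / ((2 * real j + 1) * t)\<^sup>2)"
      unfolding k_def[symmetric] r_def[symmetric] using r1 r3
      by (subst norm_geom_cf_sq) (auto intro!: frac_le add_pos_nonneg divide_nonneg_nonneg)
  qed auto
  finally show ?thesis .
qed

text \<open>Here |k x| <= pi for every k < 2 M, so the quadratic lower bound for 1 - cos makes all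
  factors at most 1 / (1 + b) with the same b = (2/3)(1/12)(x / t)^2. Bernoulli's inequality and M
  >= 1 / (4 t) give 72 = 18 * 4.\<close>

lemma norm_parts_cf_sq_le_major:
  assumes t: "t > 0" and M: "2 * real M * t \<le> 1" "1 \<le> 4 * real M * t" and x: "\<bar>x\<bar> \<le> pi / (2 * real M)"
  shows "(norm (parts_cf t M x))\<^sup>2 \<le> 1 / (1 + x\<^sup>2 / (72 * t ^ 3))"
proof -
  have M0: "M > 0" using M(2) by (cases M) auto
  define b where "b = (x / t)\<^sup>2 / 18"
  have b: "b \<ge> 0" by (simp add: b_def)
  have "(norm (parts_cf t M x))\<^sup>2 \<le>
     (\<Prod>j<M. 1 / (1 + 2 / 3 * (1 - cos ((2 * real j + 1) * x)) / ((2 * real j + 1) * t)\<^sup>2))"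
    by (rule norm_parts_cf_sq_le_prod[OF t M(1)])
  also have "\<dots> \<le> (\<Prod>j<M. 1 / (1 + b))"
  proof (intro prod_mono conjI)
    fix j assume j: "j \<in> {..<M}"
    define k where "k = 2 * real j + 1"
    have k: "k > 0" "k \<le> 2 * real M" using j by (auto simp: k_def)
    have "\<bar>k * x\<bar> \<le> 2 * real M * (pi / (2 * real M))"
      unfolding abs_mult using k x by (intro mult_mono) auto
    also have "\<dots> = pi" using M0 by simp
    finally have "(k * x)\<^sup>2 / 12 \<le> 1 - cos (k * x)" by (rule cos_le_quadratic)
    then have "2 / 3 * ((k * x)\<^sup>2 / 12) / (k * t)\<^sup>2 \<le> 2 / 3 * (1 - cos (k * x)) / (k * t)\<^sup>2"
      by (intro divide_right_mono mult_left_mono) auto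
    moreover have "2 / 3 * ((k * x)\<^sup>2 / 12) / (k * t)\<^sup>2 = b"
      using k t by (simp add: b_def power_mult_distrib power_divide field_simps)
    ultimately show "1 / (1 + 2 / 3 * (1 - cos ((2 * real j + 1) * x)) / ((2 * real j + 1) * t)\<^sup>2) \<le> 1 / (1 + b)"
      using b unfolding k_def by (intro divide_left_mono) (auto intro!: mult_pos_pos add_pos_nonneg)
  qed auto
  also have "\<dots> = 1 / (1 + b) ^ M" by (simp add: power_one_over)
  also have "\<dots> \<le> 1 / (1 + real M * b)"
    using Bernoulli_inequality[of b M] b by (intro divide_left_mono) (auto intro!: mult_pos_pos add_pos_nonneg)
  also have "\<dots> \<le> 1 / (1 + x\<^sup>2 / (72 * t ^ 3))"
  proof -
    have "x\<^sup>2 / (72 * t ^ 3) = 1 / (4 * t) * b"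
      using t by (simp add: b_def power_divide power3_eq_cube power2_eq_square)
    also have "\<dots> \<le> real M * b" using M(2) t b by (intro mult_right_mono) (auto simp: field_simps)
    finally show ?thesis using t
      by (intro divide_left_mono) (auto intro!: mult_pos_pos add_pos_nonneg mult_nonneg_nonneg b)
  qed
  finally show ?thesis .
qed

lemma one_plus_ge_exp_half: "0 \<le> w \<Longrightarrow> w \<le> 2 \<Longrightarrow> exp (w / 2) \<le> 1 + (w::real)"
proof -
  assume w: "0 \<le> w" "w \<le> 2"
  then have "exp (w / 2) \<le> 1 + w / 2 + (w / 2)\<^sup>2" by (intro exp_bound) auto
  also have "(w / 2)\<^sup>2 \<le> w / 2"
    using w mult_right_mono[of w 2 w] by (simp add: power2_eq_square)
  finally show ?thesis by simp
qed

text \<open>By the cosine sum, 1 - cos is at least 1/3 on average. Each factor is at most exp (- w /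
  2), and (1/2)(2/3)(M / 3) = M / 9.\<close>

lemma norm_parts_cf_sq_le_minor:
  assumes t: "t > 0" and M: "2 * real M * t \<le> 1" "1 \<le> 4 * real M * t"
    and x: "pi / (2 * real M) \<le> \<bar>x\<bar>" "\<bar>x\<bar> \<le> pi"
  shows "(norm (parts_cf t M x))\<^sup>2 \<le> exp (- (real M / 9))"
proof -
  have M0: "M > 0" using M(2) by (cases M) auto
  define w where "w j = 2 / 3 * (1 - cos ((2 * real j + 1) * x))" for j
  have w: "0 \<le> w j" "w j \<le> 2" for j
  proof -
    have "2 / 3 * (1 - c) \<le> 2" if "-1 \<le> c" for c :: real using that by (simp add: field_simps)
    from this[OF cos_ge_minus_one] show "w j \<le> 2" unfolding w_def .
  qed (simp add: w_def)
  have "(norm (parts_cf t M x))\<^sup>2 \<le> (\<Prod>j<M. 1 / (1 + w j / ((2 * real j + 1) * t)\<^sup>2))"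
    using norm_parts_cf_sq_le_prod[OF t M(1)] by (simp add: w_def)
  also have "\<dots> \<le> (\<Prod>j<M. exp (- (w j / 2)))"
  proof (intro prod_mono conjI)
    fix j assume j: "j \<in> {..<M}"
    have "(2 * real j + 1) * t \<le> 2 * real M * t" using j t by (intro mult_right_mono) auto
    also have "\<dots> \<le> 1" by (rule M(1))
    finally have "((2 * real j + 1) * t)\<^sup>2 \<le> 1" using t by (intro power_le_one) auto
    then have "w j \<le> w j / ((2 * real j + 1) * t)\<^sup>2"
      using w(1)[of j] t by (simp add: pos_le_divide_eq mult_left_le)
    then have "exp (w j / 2) \<le> 1 + w j / ((2 * real j + 1) * t)\<^sup>2"
      using one_plus_ge_exp_half[OF w[of j]] by linarith
    then show "1 / (1 + w j / ((2 * real j + 1) * t)\<^sup>2) \<le> exp (- (w j / 2))"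
      unfolding exp_minus inverse_eq_divide using w(1)[of j] t
      by (intro divide_left_mono) (auto intro!: mult_pos_pos add_pos_nonneg)
  qed (use w in auto)
  also have "\<dots> = exp (- (\<Sum>j<M. w j) / 2)"
    by (simp add: exp_sum[symmetric] sum_negf sum_divide_distrib)
  also have "\<dots> \<le> exp (- (real M / 9))"
  proof -
    have "(\<Sum>j<M. w j) = 2 / 3 * (real M - (\<Sum>j<M. cos ((2 * real j + 1) * x)))"
      unfolding w_def sum_distrib_left[symmetric] by (simp add: sum_subtractf)
    then show ?thesis using sum_cos_odd_le[OF M0 x] by simp
  qed
  finally show ?thesis .
qed

text \<open>Only the first M = floor (1 / (2 t)) part sizes are used, those with k t <= 1; t <= 1/4
  ensures M >= 1 / (4 t). The major arc already gives a Cauchy profile of width t^(3/2), and on the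
  minor arc exp (- M / 9) is smaller than t^3.\<close>

lemma norm_parts_cf_sq_le:
  assumes t: "0 < t" "t \<le> 1 / 4" and x: "\<bar>x\<bar> \<le> pi" and s: "1 \<le> 2 * t * real s"
  shows "(norm (parts_cf t s x))\<^sup>2 \<le> 40000 / (1 + x\<^sup>2 / (72 * t ^ 3))"
proof -
  define M where "M = nat \<lfloor>1 / (2 * t)\<rfloor>"
  have Mr: "real M = of_int \<lfloor>1 / (2 * t)\<rfloor>" using t by (simp add: M_def)
  have M1: "real M \<le> 1 / (2 * t)" unfolding Mr by simp
  have "1 / (2 * t) - 1 \<le> real M" unfolding Mr by linarith
  moreover have "1 \<le> 1 / (4 * t)" using t by (simp add: field_simps)
  moreover have "1 / (2 * t) = 1 / (4 * t) + 1 / (4 * t)" by simp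
  ultimately have M2: "1 / (4 * t) \<le> real M" by linarith
  have M: "2 * real M * t \<le> 1" "1 \<le> 4 * real M * t" using M1 M2 t by (auto simp: field_simps)
  have "real M \<le> real s" using M1 s t by (intro order_trans[OF M1]) (simp add: field_simps)
  then have "(norm (parts_cf t s x))\<^sup>2 \<le> (norm (parts_cf t M x))\<^sup>2"
    using t by (intro power_mono norm_parts_cf_le) auto
  also have "\<dots> \<le> 40000 / (1 + x\<^sup>2 / (72 * t ^ 3))"
  proof (cases "\<bar>x\<bar> \<le> pi / (2 * real M)")
    case True
    have "1 / (1 + x\<^sup>2 / (72 * t ^ 3)) \<le> 40000 / (1 + x\<^sup>2 / (72 * t ^ 3))"
      using t by (intro divide_right_mono) auto
    then show ?thesis using norm_parts_cf_sq_le_major[OF t(1) M True] by linarith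
  next
    case False
    define y where "y = 1 / (36 * t)"
    have y: "y > 0" using t by (simp add: y_def)
    have "(norm (parts_cf t M x))\<^sup>2 \<le> exp (- (real M / 9))"
      using False x by (intro norm_parts_cf_sq_le_minor t M) auto
    also have "\<dots> \<le> exp (- y)"
      using M2 by (simp add: y_def field_simps)
    also have "\<dots> \<le> 40000 / (1 + x\<^sup>2 / (72 * t ^ 3))"
    proof -
      have "\<bar>x\<bar>\<^sup>2 \<le> 3.15\<^sup>2" using x pi_approx by (intro power_mono) auto
      then have x2: "x\<^sup>2 \<le> 10" by (simp add: power2_eq_square)
      \<comment> \<open>The cubic term of the exponential series suffices: with t = 1 / (36 y), the
        quantity t^-3 is a multiple of y^3.\<close>
      have "y ^ 3 / 6 \<le> exp y"
      proof -
        have "(\<Sum>n\<in>{3}. inverse (fact n) *\<^sub>R y ^ n) \<le> (\<Sum>n. inverse (fact n) *\<^sub>R y ^ n)"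
          using y by (intro sum_le_suminf summable_exp_generic) auto
        then show ?thesis by (simp add: exp_def fact_numeral field_simps)
      qed
      have "x\<^sup>2 / (72 * t ^ 3) \<le> 10 / (72 * t ^ 3)" using x2 t by (intro divide_right_mono) auto
      also have "\<dots> = 6480 * y ^ 3" using t by (simp add: y_def field_simps power3_eq_cube)
      also have "\<dots> \<le> 38880 * exp y" using \<open>y ^ 3 / 6 \<le> exp y\<close> by simp
      finally have "1 + x\<^sup>2 / (72 * t ^ 3) \<le> 40000 * exp y"
        using y one_le_exp_iff[of y] by linarith
      moreover have "1 + x\<^sup>2 / (72 * t ^ 3) > 0" using t by (intro add_pos_nonneg) auto
      ultimately show ?thesis by (simp add: exp_minus field_simps)
    qed
    finally show ?thesis .
  qed
  finally show ?thesis .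
qed

section \<open>Mean and variance of the size of the flanks\<close>

text \<open>Mean of the combined size of both random flanks, whence the factor 2;
  \<open>flank_var\<close> is the corresponding variance.\<close>

definition flank_mean :: "real \<Rightarrow> nat \<Rightarrow> real" where
  "flank_mean t s = (\<Sum>j<s. 2 * (2 * real j + 1) *
     exp (- ((2 * real j + 1) * t)) / (1 - exp (- ((2 * real j + 1) * t))))"

definition flank_var :: "real \<Rightarrow> nat \<Rightarrow> real" where
  "flank_var t s = (\<Sum>j<s. 2 * (2 * real j + 1)\<^sup>2 *
     exp (- ((2 * real j + 1) * t)) / (1 - exp (- ((2 * real j + 1) * t)))\<^sup>2)"

lemma bose_le: "x > 0 \<Longrightarrow> x / (1 - exp (- x)) \<le> 1 + (x::real)"
proof -
  assume x: "x > 0"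
  have "exp (- x) * (1 + x) \<le> exp (- x) * exp x"
    by (intro mult_left_mono) auto
  then have "exp (- x) * (1 + x) \<le> 1" by (simp flip: exp_add)
  then have "x \<le> (1 + x) * (1 - exp (- x))" by (simp add: algebra_simps)
  then show ?thesis using x by (simp add: pos_divide_le_eq)
qed

text \<open>One bound for the first, second and third moment sums: (1 + x)^3 is at most (12 exp (x /
  12))^3, which costs a quarter of the decay exp (- x).\<close>

lemma bose_power_le:
  fixes x :: real
  assumes x: "x > 0" and p: "p \<le> 3"
  shows "x ^ p * exp (- x) / (1 - exp (- x)) ^ p \<le> 1728 * exp (- (3 / 4 * x))"
proof -
  have "(x / (1 - exp (- x))) ^ p \<le> (1 + x) ^ p"
    using x by (intro power_mono bose_le) auto
  also have "\<dots> \<le> (1 + x) ^ 3" using x p by (intro power_increasing) auto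
  also have "\<dots> \<le> (12 * exp (x / 12)) ^ 3"
  proof (rule power_mono)
    show "1 + x \<le> 12 * exp (x / 12)" using exp_ge_add_one_self[of "x / 12"] by linarith
  qed (use x in auto)
  also have "\<dots> = 1728 * exp (x / 4)"
    by (simp add: power_mult_distrib exp_of_nat_mult[symmetric])
  finally have "(x / (1 - exp (- x))) ^ p * exp (- x) \<le> 1728 * exp (x / 4) * exp (- x)"
    by (intro mult_right_mono) auto
  also have "1728 * exp (x / 4) * exp (- x) = 1728 * exp (- (3 / 4 * x))"
    by (simp add: mult.assoc flip: exp_add)
  finally show ?thesis by (simp add: power_divide)
qed

lemma sum_power_atLeastLessThan:
  fixes r :: real
  assumes "r \<noteq> 1" "s \<le> n"
  shows "(\<Sum>j\<in>{s..<n}. r ^ j) = (r ^ s - r ^ n) / (1 - r)"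
proof -
  from assms(2) have "(1 - r) * (\<Sum>j\<in>{s..<n}. r ^ j) = r ^ s - r ^ n"
  proof (induction n rule: dec_induct)
    case (step m)
    then show ?case by (simp only: sum.atLeastLessThan_Suc distrib_left) (simp add: left_diff_distrib)
  qed simp
  then show ?thesis using assms(1) by (simp add: field_simps)
qed

text \<open>A geometric series of mesh 2 t. The factor exp (- 3/4 (2 s + 1) t) is kept because it is
  of order t^(3/4) at a typical peak, which makes the parts above the peak negligible.\<close>

lemma bose_sum_le:
  assumes t: "0 < t" "t \<le> 1 / 4" and p: "p \<le> 3"
  shows "(\<Sum>j\<in>{s..<n}. (2 * real j + 1) ^ p * exp (- ((2 * real j + 1) * t)) / (1 - exp (- ((2 * real j + 1) * t))) ^ p)
    \<le> 1728 / t ^ (p + 1) * exp (- (3 / 4 * ((2 * real s + 1) * t)))"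
proof -
  define r where "r = exp (- (3 / 2 * t))"
  have r: "0 < r" "r < 1" using t by (auto simp: r_def)
  have geo: "(\<Sum>j\<in>{s..<n}. r ^ j) \<le> r ^ s / (1 - r)"
  proof (cases "s \<le> n")
    case True
    then have "(\<Sum>j\<in>{s..<n}. r ^ j) = (r ^ s - r ^ n) / (1 - r)"
      using r by (intro sum_power_atLeastLessThan) auto
    then show ?thesis using r by (simp add: divide_right_mono)
  qed (use r in auto)
  have "(\<Sum>j\<in>{s..<n}. (2 * real j + 1) ^ p * exp (- ((2 * real j + 1) * t)) / (1 - exp (- ((2 * real j + 1) * t))) ^ p)
    \<le> (\<Sum>j\<in>{s..<n}. 1728 / t ^ p * exp (- (3 / 4 * t)) * r ^ j)"
  proof (rule sum_mono)
    fix j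
    define k where "k = 2 * real j + 1"
    have k: "k > 0" by (simp add: k_def)
    have "k ^ p * exp (- (k * t)) / (1 - exp (- (k * t))) ^ p =
        ((k * t) ^ p * exp (- (k * t)) / (1 - exp (- (k * t))) ^ p) / t ^ p"
      using t by (simp add: power_mult_distrib)
    also have "\<dots> \<le> 1728 * exp (- (3 / 4 * (k * t))) / t ^ p"
      using k t p by (intro divide_right_mono bose_power_le) auto
    also have "exp (- (3 / 4 * (k * t))) = exp (- (3 / 4 * t)) * r ^ j"
      by (simp add: r_def k_def exp_of_nat_mult[symmetric] algebra_simps flip: exp_add)
    finally show "(2 * real j + 1) ^ p * exp (- ((2 * real j + 1) * t)) / (1 - exp (- ((2 * real j + 1) * t))) ^ p
       \<le> 1728 / t ^ p * exp (- (3 / 4 * t)) * r ^ j"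
      by (simp add: k_def)
  qed
  also have "\<dots> = 1728 / t ^ p * exp (- (3 / 4 * t)) * (\<Sum>j\<in>{s..<n}. r ^ j)"
    by (simp add: sum_distrib_left)
  also have "\<dots> \<le> 1728 / t ^ p * exp (- (3 / 4 * t)) * (r ^ s * (1 / t))"
  proof -
    \<comment> \<open>\<open>bose_le\<close> at 3 t / 2 gives 1 / (1 - r) <= 1 / t, as 1 + 3 t / 2
      <= 3/2.\<close>
    have "3 / 2 * t / (1 - r) \<le> 1 + 3 / 2 * t" unfolding r_def using t by (intro bose_le) auto
    also have "\<dots> \<le> 3 / 2" using t by simp
    finally have "1 / (1 - r) \<le> 1 / t" using t r by (simp add: field_simps)
    then have "r ^ s * (1 / (1 - r)) \<le> r ^ s * (1 / t)" using r by (intro mult_left_mono) auto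
    with geo have "(\<Sum>j\<in>{s..<n}. r ^ j) \<le> r ^ s * (1 / t)" by simp
    then show ?thesis using t by (intro mult_left_mono) auto
  qed
  also have "\<dots> = 1728 / t ^ (p + 1) * (exp (- (3 / 4 * t)) * r ^ s)"
    by (simp add: mult.commute mult.left_commute)
  also have "exp (- (3 / 4 * t)) * r ^ s = exp (- (3 / 4 * ((2 * real s + 1) * t)))"
    by (simp add: r_def exp_of_nat_mult[symmetric] algebra_simps flip: exp_add)
  finally show ?thesis .
qed

lemma bose_cube_sum_le:
  assumes t: "0 < t" "t \<le> 1 / 4"
  shows "(\<Sum>j<s. (2 * real j + 1) ^ 3 * exp (- ((2 * real j + 1) * t)) / (1 - exp (- ((2 * real j + 1) * t))) ^ 3)
    \<le> 1728 / t ^ 4"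
proof -
  have "(\<Sum>j<s. (2 * real j + 1) ^ 3 * exp (- ((2 * real j + 1) * t)) / (1 - exp (- ((2 * real j + 1) * t))) ^ 3)
    \<le> 1728 / t ^ 4 * exp (- (3 / 4 * t))"
    using bose_sum_le[OF t, of 3 0 s] by (simp add: lessThan_atLeast0)
  also have "\<dots> \<le> 1728 / t ^ 4 * 1" using t by (intro mult_left_mono) auto
  finally show ?thesis by simp
qed

lemma flank_mean_diff:
  assumes t: "0 < t" "t \<le> 1 / 4" and s: "s \<le> n"
  shows "flank_mean t s \<le> flank_mean t n"
    "flank_mean t n - flank_mean t s \<le> 3456 / t\<^sup>2 * exp (- (3 / 4 * ((2 * real s + 1) * t)))"
proof -
  have "flank_mean t n = flank_mean t s + (\<Sum>j\<in>{s..<n}. 2 * (2 * real j + 1) *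
     exp (- ((2 * real j + 1) * t)) / (1 - exp (- ((2 * real j + 1) * t))))"
    unfolding flank_mean_def lessThan_atLeast0 using s by (simp add: sum.atLeastLessThan_concat)
  moreover have "0 \<le> (\<Sum>j\<in>{s..<n}. 2 * (2 * real j + 1) *
     exp (- ((2 * real j + 1) * t)) / (1 - exp (- ((2 * real j + 1) * t))))"
    using t by (intro sum_nonneg divide_nonneg_nonneg) auto
  moreover have "(\<Sum>j\<in>{s..<n}. 2 * (2 * real j + 1) *
     exp (- ((2 * real j + 1) * t)) / (1 - exp (- ((2 * real j + 1) * t)))) =
     2 * (\<Sum>j\<in>{s..<n}. (2 * real j + 1) ^ 1 * exp (- ((2 * real j + 1) * t)) / (1 - exp (- ((2 * real j + 1) * t))) ^ 1)"
    unfolding sum_distrib_left by (intro sum.cong) simp_all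
  ultimately show "flank_mean t s \<le> flank_mean t n"
    "flank_mean t n - flank_mean t s \<le> 3456 / t\<^sup>2 * exp (- (3 / 4 * ((2 * real s + 1) * t)))"
    using bose_sum_le[OF t, of 1 s n] by (simp_all add: numeral_2_eq_2)
qed

lemma flank_var_diff:
  assumes t: "0 < t" "t \<le> 1 / 4" and s: "s \<le> n"
  shows "flank_var t s \<le> flank_var t n"
    "flank_var t n - flank_var t s \<le> 3456 / t ^ 3 * exp (- (3 / 4 * ((2 * real s + 1) * t)))"
proof -
  have "flank_var t n = flank_var t s + (\<Sum>j\<in>{s..<n}. 2 * (2 * real j + 1)\<^sup>2 *
     exp (- ((2 * real j + 1) * t)) / (1 - exp (- ((2 * real j + 1) * t)))\<^sup>2)"
    unfolding flank_var_def lessThan_atLeast0 using s by (simp add: sum.atLeastLessThan_concat)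
  moreover have "0 \<le> (\<Sum>j\<in>{s..<n}. 2 * (2 * real j + 1)\<^sup>2 *
     exp (- ((2 * real j + 1) * t)) / (1 - exp (- ((2 * real j + 1) * t)))\<^sup>2)"
    using t by (intro sum_nonneg divide_nonneg_nonneg) auto
  moreover have "(\<Sum>j\<in>{s..<n}. 2 * (2 * real j + 1)\<^sup>2 *
     exp (- ((2 * real j + 1) * t)) / (1 - exp (- ((2 * real j + 1) * t)))\<^sup>2) =
     2 * (\<Sum>j\<in>{s..<n}. (2 * real j + 1)\<^sup>2 * exp (- ((2 * real j + 1) * t)) / (1 - exp (- ((2 * real j + 1) * t)))\<^sup>2)"
    unfolding sum_distrib_left by (intro sum.cong) simp_all
  ultimately show "flank_var t s \<le> flank_var t n"
    "flank_var t n - flank_var t s \<le> 3456 / t ^ 3 * exp (- (3 / 4 * ((2 * real s + 1) * t)))"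
    using bose_sum_le[OF t, of 2 s n] by (simp_all add: numeral_3_eq_3)
qed

lemma flank_var_upper:
  assumes t: "0 < t" "t \<le> 1 / 4"
  shows "flank_var t s \<le> 3456 / t ^ 3"
proof -
  have "flank_var t s - flank_var t 0 \<le> 3456 / t ^ 3 * exp (- (3 / 4 * ((2 * real 0 + 1) * t)))"
    by (rule flank_var_diff(2)[OF t]) simp
  also have "\<dots> \<le> 3456 / t ^ 3 * 1" using t by (intro mult_left_mono) auto
  finally show ?thesis by (simp add: flank_var_def)
qed

text \<open>The part sizes up to about 1 / t suffice: at least 1 / (4 t) of them, each contributing
  2 / (3 t^2). The order t^-3 matches the upper bound.\<close>

lemma flank_var_lower:
  assumes t: "0 < t" "t \<le> 1 / 4" and s: "1 \<le> 2 * t * real s"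
  shows "1 / (6 * t ^ 3) \<le> flank_var t s"
proof -
  define M where "M = nat \<lfloor>1 / (2 * t)\<rfloor>"
  have Mr: "real M = of_int \<lfloor>1 / (2 * t)\<rfloor>" using t by (simp add: M_def)
  have M1: "real M \<le> 1 / (2 * t)" unfolding Mr by simp
  have "1 / (2 * t) - 1 \<le> real M" unfolding Mr by linarith
  moreover have "1 \<le> 1 / (4 * t)" using t by (simp add: field_simps)
  moreover have "1 / (2 * t) = 1 / (4 * t) + 1 / (4 * t)" by simp
  ultimately have M2: "1 / (4 * t) \<le> real M" by linarith
  have "real M \<le> real s" using M1 s t by (intro order_trans[OF M1]) (simp add: field_simps)
  then have Ms: "M \<le> s" by simp
  have "(\<Sum>j<M. 2 / (3 * t\<^sup>2)) \<le> flank_var t M"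
    unfolding flank_var_def
  proof (rule sum_mono)
    fix j assume j: "j \<in> {..<M}"
    define k where "k = (2 * real j + 1)"
    have k: "k > 0" "k \<le> 2 * real M" using j by (auto simp: k_def)
    have "k * t \<le> 2 * real M * t" using k t by (intro mult_right_mono) auto
    also have "\<dots> \<le> 1" using M1 t by (simp add: field_simps)
    finally have kt: "k * t \<le> 1" .
    then have "exp (-1) \<le> exp (- (k * t))" by simp
    moreover have "(1/3::real) \<le> exp (-1)" using exp_le by (simp add: exp_minus field_simps)
    ultimately have r3: "1 / 3 \<le> exp (- (k * t))" by (rule order_trans[rotated])
    have rk: "1 - exp (- (k * t)) \<le> k * t" using exp_ge_add_one_self[of "- (k * t)"] by simp
    have "2 / (3 * t\<^sup>2) = 2 * k\<^sup>2 * (1 / 3) / (k * t)\<^sup>2"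
      using k t by (simp add: power_mult_distrib)
    also have "\<dots> \<le> 2 * k\<^sup>2 * exp (- (k * t)) / (1 - exp (- (k * t)))\<^sup>2"
      using k t r3 rk by (intro frac_le mult_left_mono power_mono) auto
    finally show "2 / (3 * t\<^sup>2) \<le> 2 * (2 * real j + 1)\<^sup>2 *
     exp (- ((2 * real j + 1) * t)) / (1 - exp (- ((2 * real j + 1) * t)))\<^sup>2"
      by (simp add: k_def)
  qed
  also have "\<dots> \<le> flank_var t s" by (rule flank_var_diff(1)[OF t Ms])
  finally have "real M * (2 / (3 * t\<^sup>2)) \<le> flank_var t s" by simp
  moreover have "1 / (4 * t) * (2 / (3 * t\<^sup>2)) \<le> real M * (2 / (3 * t\<^sup>2))"
    using M2 t by (intro mult_right_mono) auto
  moreover have "1 / (4 * t) * (2 / (3 * t\<^sup>2)) = 1 / (6 * t ^ 3)"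
    using t by (simp add: power3_eq_cube power2_eq_square)
  ultimately show ?thesis by simp
qed

section \<open>The Bose-Einstein integral and the saddle point equation\<close>

definition bose :: "real \<Rightarrow> real" where
  "bose x = x * exp (- x) / (1 - exp (- x))"

lemma bose_nonneg: "0 \<le> x \<Longrightarrow> 0 \<le> bose x"
  by (simp add: bose_def divide_nonneg_nonneg)

text \<open>Convexity of exp makes (exp x - 1) / x increasing. Division by zero gives
  \<open>bose 0 = 0\<close> instead of the limit 1, so the claim concerns positive
  arguments.\<close>

lemma bose_antimono: "0 < x \<Longrightarrow> x \<le> y \<Longrightarrow> bose y \<le> bose x"
proof -
  assume xy: "0 < x" "x \<le> y"
  have b: "bose z = z / (exp z - 1)" if "z > 0" for z
    using that by (simp add: bose_def exp_minus field_simps)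
  have "exp ((1 - x / y) *\<^sub>R 0 + (x / y) *\<^sub>R y) \<le> (1 - x / y) * exp 0 + (x / y) * exp y"
    using xy by (intro convex_onD[OF exp_convex]) auto
  then have "exp x - 1 \<le> x / y * (exp y - 1)" using xy by (simp add: algebra_simps)
  also have "\<dots> = x * (exp y - 1) / y" by simp
  finally have "y * (exp x - 1) \<le> x * (exp y - 1)" using xy by (simp add: pos_le_divide_eq mult.commute)
  moreover have "exp x - 1 > 0" "exp y - 1 > 0" using xy by auto
  ultimately show ?thesis using xy by (simp add: b frac_le_eq pos_divide_le_eq pos_le_divide_eq mult.commute)
qed

lemma bose_le_1: "0 < x \<Longrightarrow> bose x \<le> 1"
proof -
  assume x: "0 < x"
  have "x * exp (- x) \<le> (exp x - 1) * exp (- x)"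
    using exp_ge_add_one_self[of x] by (intro mult_right_mono) (linarith, simp)
  also have "\<dots> = 1 - exp (- x)" by (simp add: left_diff_distrib flip: exp_add)
  finally show ?thesis using x by (simp add: bose_def divide_le_eq)
qed

lemma nn_integral_x_exp:
  assumes a: "a > 0"
  shows "(\<integral>\<^sup>+x. ennreal (x * exp (- (a * x))) * indicator {0..} x \<partial>lborel) = ennreal (1 / a\<^sup>2)"
proof -
  let ?F = "\<lambda>x. - ((x / a + 1 / a\<^sup>2) * exp (- (a * x)))"
  have "(\<integral>\<^sup>+x. ennreal (x * exp (- (a * x))) * indicator {0..} x \<partial>lborel) = ennreal (0 - ?F 0)"
  proof (rule nn_integral_FTC_atLeast)
    show "(?F has_real_derivative x * exp (- (a * x))) (at x)" for x
      using a by (auto intro!: derivative_eq_intros simp: field_simps power2_eq_square)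
    show "(?F \<longlongrightarrow> 0) at_top" using a by real_asymp
  qed auto
  then show ?thesis by simp
qed

text \<open>Expanding 1 / (exp x - 1) as a geometric series turns the integral into the sum of 1 /
  k^2; this is the source of sqrt 6 / pi.\<close>

lemma nn_integral_bose: "(\<integral>\<^sup>+x. ennreal (bose x) * indicator {0..} x \<partial>lborel) = ennreal (pi\<^sup>2 / 6)"
proof -
  have ser: "(\<Sum>i. ennreal (x * exp (- (real (Suc i) * x)))) = ennreal (bose x)" if x: "x \<ge> 0" for x
  proof (cases "x = 0")
    case False
    have "(\<lambda>i. x * exp (- x) * exp (- x) ^ i) sums (x * exp (- x) * (1 / (1 - exp (- x))))"
      using x False by (intro sums_mult geometric_sums) auto
    also have "(\<lambda>i. x * exp (- x) * exp (- x) ^ i) = (\<lambda>i. x * exp (- (real (Suc i) * x)))"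
    proof
      fix i
      have "exp (- x) * exp (- x) ^ i = exp (- (real (Suc i) * x))"
        using exp_of_nat_mult[of "Suc i" "- x"] by simp
      then show "x * exp (- x) * exp (- x) ^ i = x * exp (- (real (Suc i) * x))"
        by (simp only: mult.assoc)
    qed
    finally show ?thesis using x by (intro suminf_ennreal_eq) (auto simp: bose_def)
  qed (simp add: bose_def)
  have eq: "ennreal (bose x) * indicator {0..} x =
      (\<Sum>i. ennreal (x * exp (- (real (Suc i) * x))) * indicator {0..} x)" for x
  proof (cases "x \<ge> 0")
    case True
    then show ?thesis by (simp only: indicator_simps atLeast_iff mult_1_right ser)
  qed simp
  have meas: "(\<lambda>x. ennreal (x * exp (- (a * x))) * indicator {0..} x) \<in> borel_measurable lborel" for a
    by measurable
  have "(\<integral>\<^sup>+x. ennreal (bose x) * indicator {0..} x \<partial>lborel) =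
      (\<Sum>i. \<integral>\<^sup>+x. ennreal (x * exp (- (real (Suc i) * x))) * indicator {0..} x \<partial>lborel)"
    unfolding eq by (rule nn_integral_suminf) (rule meas)
  also have "\<dots> = (\<Sum>i. ennreal (1 / (real (Suc i))\<^sup>2))"
    by (simp only: nn_integral_x_exp of_nat_0_less_iff zero_less_Suc)
  also have "\<dots> = ennreal (pi\<^sup>2 / 6)"
    using inverse_squares_sums by (intro suminf_ennreal_eq) (simp_all add: add.commute)
  finally show ?thesis .
qed

lemma has_integral_bose: "(bose has_integral pi\<^sup>2 / 6) {0..}"
proof -
  have "((\<lambda>x. bose x * indicator {0..} x) has_integral pi\<^sup>2 / 6) UNIV"
  proof (rule nn_integral_has_integral)
    show "(\<lambda>x. bose x * indicator {0..} x) \<in> borel_measurable borel"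
      unfolding bose_def by measurable
    show "(\<integral>\<^sup>+ x. ennreal (bose x * indicator {0..} x) \<partial>lborel) = ennreal (pi\<^sup>2 / 6)"
      unfolding nn_integral_bose[symmetric] by (intro nn_integral_cong) (auto simp: indicator_def)
  qed (auto simp: indicator_def bose_nonneg)
  then show ?thesis
    by (subst has_integral_restrict_UNIV[symmetric])
       (simp add: indicator_def of_bool_def if_distrib cong: if_cong)
qed

text \<open>Monotone comparison on the cells between consecutive odd multiples of t. The first
  sample costs at most 2 t, the interval from 0 to t costs at most t, and 2304 = 1728 * 4/3 comes
  from integrating the exponential bound beyond the last sample.\<close>

lemma bose_riemann_sum:
  assumes t: "t > 0"
  shows "(\<Sum>j<n. 2 * t * bose ((2 * real j + 1) * t)) \<le> pi\<^sup>2 / 6 + 2 * t"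
    "pi\<^sup>2 / 6 - t - 2304 * exp (- (3 / 4 * ((2 * real n + 1) * t))) \<le> (\<Sum>j<n. 2 * t * bose ((2 * real j + 1) * t))"
proof -
  define x where "x j = (2 * real j + 1) * t" for j
  have x: "0 < x j" "x (Suc j) = x j + 2 * t" for j
    using t by (simp add: x_def, simp add: x_def algebra_simps)
  have tx: "t \<le> x j" for j using t by (simp add: x_def algebra_simps)
  have int0: "bose integrable_on {0..}" using has_integral_bose by blast
  have int: "bose integrable_on {a..b}" if "0 \<le> a" for a b
    using that by (intro integrable_on_subinterval[OF int0]) auto
  have cell: "2 * t * bose (x (Suc j)) \<le> integral {x j..x (Suc j)} bose"
      "integral {x j..x (Suc j)} bose \<le> 2 * t * bose (x j)" for j
  proof -
    have "integral {x j..x (Suc j)} (\<lambda>_. bose (x (Suc j))) \<le> integral {x j..x (Suc j)} bose"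
      using x[of j] t by (intro integral_le int) (auto intro!: bose_antimono)
    then show "2 * t * bose (x (Suc j)) \<le> integral {x j..x (Suc j)} bose" using x[of j] t by simp
    have "integral {x j..x (Suc j)} bose \<le> integral {x j..x (Suc j)} (\<lambda>_. bose (x j))"
      using x[of j] t by (intro integral_le int) (auto intro!: bose_antimono)
    then show "integral {x j..x (Suc j)} bose \<le> 2 * t * bose (x j)" using x[of j] t by simp
  qed
  have comb: "integral {t..x (Suc m)} bose = integral {t..x m} bose + integral {x m..x (Suc m)} bose" for m
    using Henstock_Kurzweil_Integration.integral_combine[where a = t and c = "x m" and b = "x (Suc m)" and f = bose] x[of m] t tx[of m] by (simp add: int)
  have up: "(\<Sum>j<m. 2 * t * bose (x (Suc j))) \<le> integral {t..x m} bose" for m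
  proof (induction m)
    case (Suc m)
    then show ?case using comb[of m] cell(1)[of m] by simp
  qed (simp add: x_def)
  have lo: "integral {t..x m} bose \<le> (\<Sum>j<m. 2 * t * bose (x j))" for m
  proof (induction m)
    case (Suc m)
    then show ?case using comb[of m] cell(2)[of m] by simp
  qed (simp add: x_def)
  have le: "integral {t..b} bose \<le> pi\<^sup>2 / 6" for b
    using integral_subset_le[OF _ int[of t b] int0] t integral_unique[OF has_integral_bose]
    by (auto simp: bose_nonneg)
  show "(\<Sum>j<n. 2 * t * bose ((2 * real j + 1) * t)) \<le> pi\<^sup>2 / 6 + 2 * t"
  proof (cases n)
    case (Suc m)
    have "2 * t * bose (x 0) \<le> 2 * t * 1" using t x[of 0] by (intro mult_left_mono bose_le_1) auto
    then have "(\<Sum>j<Suc m. 2 * t * bose (x j)) \<le> pi\<^sup>2 / 6 + 2 * t"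
      using up[of m] le[of "x m"] by (subst sum.lessThan_Suc_shift) simp
    then show ?thesis by (simp add: Suc x_def)
  qed (use t in simp)
  have tail_int: "bose integrable_on {x n..}"
  proof (rule set_lebesgue_integral_eq_integral(1))
    have "bose absolutely_integrable_on {0..}"
      by (intro nonnegative_absolutely_integrable_1 int0) (auto simp: bose_nonneg)
    then show "bose absolutely_integrable_on {x n..}"
      by (rule set_integrable_subset) (use x(1)[of n] in auto)
  qed
  have exp_int: "((\<lambda>y. 1728 * exp (- (3 / 4) * y)) has_integral 1728 * (exp (- (3 / 4) * x n) / (3 / 4))) {x n..}"
    by (intro has_integral_mult_right has_integral_exp_minus_to_infinity) auto
  have "integral {x n..} bose \<le> 1728 * (exp (- (3 / 4) * x n) / (3 / 4))"
  proof (rule has_integral_le[OF integrable_integral[OF tail_int] exp_int])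
    show "bose y \<le> 1728 * exp (- (3 / 4) * y)" if "y \<in> {x n..}" for y
      using bose_power_le[of y 1] x(1)[of n] that by (simp add: bose_def)
  qed
  then have tail: "integral {x n..} bose \<le> 2304 * exp (- (3 / 4 * x n))" by simp
  have "integral {0..t} bose \<le> integral {0..t} (\<lambda>_. 1)"
    using t bose_le_1 by (intro integral_le int) (force simp: bose_def le_less)+
  then have head: "integral {0..t} bose \<le> t" using t by simp
  have "integral {0..x n} bose = integral {0..t} bose + integral {t..x n} bose"
    using Henstock_Kurzweil_Integration.integral_combine[where a = 0 and c = t and b = "x n" and f = bose] t tx[of n] by (simp add: int)
  moreover have "integral ({0..x n} \<union> {x n..}) bose = integral {0..x n} bose + integral {x n..} bose"
  proof (rule integral_Un)
    have "{0..x n} \<inter> {x n..} = {x n}" using x(1)[of n] by auto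
    then show "negligible ({0..x n} \<inter> {x n..})" by simp
  qed (auto intro: int tail_int)
  moreover have "{0..x n} \<union> {x n..} = {0..}" using x(1)[of n] by auto
  ultimately have "pi\<^sup>2 / 6 = integral {0..t} bose + integral {t..x n} bose + integral {x n..} bose"
    using integral_unique[OF has_integral_bose] by simp
  then show "pi\<^sup>2 / 6 - t - 2304 * exp (- (3 / 4 * ((2 * real n + 1) * t))) \<le> (\<Sum>j<n. 2 * t * bose ((2 * real j + 1) * t))"
    using head tail lo[of n] unfolding x_def by linarith
qed

text \<open>The saddle point equation, with an error of lower order than the standard deviation
  t^(-3/2).\<close>

lemma flank_mean_close:
  assumes t: "0 < t" and n: "real n * t\<^sup>2 = pi\<^sup>2 / 6"
  shows "\<bar>flank_mean t n - real n\<bar> \<le> 2000 / t"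
proof -
  have n0: "n > 0" using n pi_gt_zero by (cases n) auto
  have eq: "t\<^sup>2 * flank_mean t n = (\<Sum>j<n. 2 * t * bose ((2 * real j + 1) * t))"
    unfolding flank_mean_def sum_distrib_left
    by (intro sum.cong) (simp_all add: bose_def power2_eq_square)
  define X where "X = 3 / 4 * ((2 * real n + 1) * t)"
  \<comment> \<open>From exp (- X) <= 1 / X and X t >= 9/4 the left side is at most 1024 t. The
    constant 1998 leaves room for the 2 t of the Riemann sum.\<close>
  have "2304 * exp (- X) \<le> 1998 * t"
  proof -
    have "pi\<^sup>2 \<ge> 3\<^sup>2" using pi_gt3 by (intro power_mono) auto
    then have "3 / 2 \<le> real n * t\<^sup>2" using n by simp
    then have "9 / 4 \<le> 3 / 2 * (real n * t\<^sup>2)" by simp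
    also have "\<dots> \<le> X * t" using t by (simp add: X_def power2_eq_square algebra_simps)
    finally have Xt: "9 / 4 \<le> X * t" .
    have X0: "X > 0" using t by (simp add: X_def)
    have "X * exp (- X) \<le> exp X * exp (- X)"
      using exp_ge_add_one_self[of X] by (intro mult_right_mono) (linarith, simp)
    then have "X * exp (- X) \<le> 1" by (simp flip: exp_add)
    then have "exp (- X) \<le> 1 / X" using X0 by (simp add: field_simps)
    also have "\<dots> \<le> t / (9 / 4)" using Xt X0 by (simp add: field_simps)
    finally show ?thesis using t by simp
  qed
  with bose_riemann_sum[OF t, of n] have "\<bar>t\<^sup>2 * flank_mean t n - pi\<^sup>2 / 6\<bar> \<le> 2000 * t"
    unfolding eq X_def using t by linarith
  then have "\<bar>t\<^sup>2 * (flank_mean t n - real n)\<bar> \<le> 2000 * t" using n by (simp add: algebra_simps)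
  then have "t\<^sup>2 * \<bar>flank_mean t n - real n\<bar> \<le> t\<^sup>2 * (2000 / t)"
    using t by (simp add: abs_mult power2_eq_square)
  then show ?thesis using t by (simp only: mult_le_cancel_left_pos zero_less_power)
qed

section \<open>Local limit theorem\<close>

lemma prod_cis: "(\<Prod>j\<in>A. cis (f j)) = cis (\<Sum>j\<in>A. f j)"
  by (induction A rule: infinite_finite_induct) (auto simp: cis_mult)

text \<open>All factors lie in the unit disc, so the difference of products is at most the sum of
  the differences, a third moment of order t^-4. At x of order t^(3/2) the error is of order
  t^(1/2).\<close>

lemma parts_cf_gaussian:
  assumes t: "0 < t" "t \<le> 1 / 4"
  shows "norm (parts_cf t s x * parts_cf t s x * cis (- (flank_mean t s * x))
      - of_real (exp (- (flank_var t s * x\<^sup>2 / 2)))) \<le> 3456 * \<bar>x\<bar> ^ 3 / t ^ 4"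
proof -
  define k where "k j = 2 * real j + 1" for j
  define r where "r j = exp (- (k j * t))" for j
  define z where "z j = geom_cf (r j) (k j * x) * cis (- (r j / (1 - r j) * (k j * x)))" for j
  define w where "w j = complex_of_real (exp (- (r j / (1 - r j)\<^sup>2 * (k j * x)\<^sup>2 / 2)))" for j
  have k: "k j > 0" for j by (simp add: k_def)
  have r: "0 \<le> r j" "r j < 1" for j using k[of j] t by (auto simp: r_def)
  have zw: "norm (z j) \<le> 1" "norm (w j) \<le> 1" for j
    using norm_geom_cf_le_1[OF r, of j] r[of j] by (auto simp: z_def w_def norm_mult)
  have "norm ((\<Prod>j<s. z j) - (\<Prod>j<s. w j)) \<le> (\<Sum>j<s. norm (z j - w j))"
    by (rule norm_prod_diff) (auto intro: zw)
  also have "\<dots> \<le> (\<Sum>j<s. \<bar>x\<bar> ^ 3 * (k j ^ 3 * r j / (1 - r j) ^ 3))"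
  proof (rule sum_mono)
    fix j
    have "norm (z j - w j) \<le> r j / (1 - r j) ^ 3 * \<bar>k j * x\<bar> ^ 3"
      unfolding z_def w_def by (rule geom_cf_gaussian[OF r])
    then show "norm (z j - w j) \<le> \<bar>x\<bar> ^ 3 * (k j ^ 3 * r j / (1 - r j) ^ 3)"
      using k[of j] by (simp add: abs_mult power_mult_distrib mult_ac)
  qed
  also have "\<dots> = \<bar>x\<bar> ^ 3 * (\<Sum>j<s. k j ^ 3 * r j / (1 - r j) ^ 3)" by (simp add: sum_distrib_left)
  also have "\<dots> \<le> \<bar>x\<bar> ^ 3 * (1728 / t ^ 4)"
    using bose_cube_sum_le[OF t, of s] by (intro mult_left_mono) (auto simp: k_def r_def)
  finally have diff: "norm ((\<Prod>j<s. z j) - (\<Prod>j<s. w j)) \<le> \<bar>x\<bar> ^ 3 * (1728 / t ^ 4)" .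
  have z2: "parts_cf t s x * parts_cf t s x * cis (- (flank_mean t s * x)) = (\<Prod>j<s. z j)\<^sup>2"
  proof -
    have "flank_mean t s * x = (\<Sum>j<s. r j / (1 - r j) * (k j * x)) + (\<Sum>j<s. r j / (1 - r j) * (k j * x))"
      unfolding flank_mean_def sum.distrib[symmetric] sum_distrib_right
      by (intro sum.cong) (simp_all add: k_def[symmetric] r_def[symmetric])
    then have "cis (- (flank_mean t s * x)) = (\<Prod>j<s. cis (- (r j / (1 - r j) * (k j * x))))\<^sup>2"
      unfolding prod_cis sum_negf power2_eq_square cis_mult by simp
    then show ?thesis
      by (simp add: z_def prod.distrib power_mult_distrib parts_cf_def k_def r_def power2_eq_square)
  qed
  have w2: "of_real (exp (- (flank_var t s * x\<^sup>2 / 2))) = (\<Prod>j<s. w j)\<^sup>2"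
  proof -
    have "flank_var t s * x\<^sup>2 / 2 = (\<Sum>j<s. r j / (1 - r j)\<^sup>2 * (k j * x)\<^sup>2 / 2) + (\<Sum>j<s. r j / (1 - r j)\<^sup>2 * (k j * x)\<^sup>2 / 2)"
      unfolding flank_var_def sum.distrib[symmetric] sum_distrib_right sum_divide_distrib
      by (intro sum.cong) (simp_all add: k_def[symmetric] r_def[symmetric] power_mult_distrib)
    then have "exp (- (flank_var t s * x\<^sup>2 / 2)) = (\<Prod>j<s. exp (- (r j / (1 - r j)\<^sup>2 * (k j * x)\<^sup>2 / 2)))\<^sup>2"
      by (simp add: exp_sum[symmetric] sum_negf power2_eq_square flip: exp_add)
    then show ?thesis by (simp add: w_def)
  qed
  \<comment> \<open>Two equal flanks give squares, and |z^2 - w^2| <= 2 |z - w|.\<close>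
  have "norm ((\<Prod>j<s. z j) + (\<Prod>j<s. w j)) \<le> 1 + 1"
    by (intro norm_triangle_mono) (auto simp: prod_norm[symmetric] intro!: prod_le_1 zw)
  then have "norm ((\<Prod>j<s. z j) - (\<Prod>j<s. w j)) * norm ((\<Prod>j<s. z j) + (\<Prod>j<s. w j)) \<le> \<bar>x\<bar> ^ 3 * (1728 / t ^ 4) * 2"
    using diff t by (intro mult_mono) auto
  then show ?thesis
    unfolding z2 w2 by (simp add: norm_mult[symmetric] power2_eq_square algebra_simps)
qed

section \<open>Integrability on the line and dominated convergence\<close>

lemma einterval_UNIV: "einterval (-\<infinity>) \<infinity> = UNIV"
  by (auto simp: einterval_def)

lemma integrable_lborel_FTC:
  fixes f F :: "real \<Rightarrow> real"
  assumes "\<And>x. (F has_real_derivative f x) (at x)" "\<And>x. isCont f x" "\<And>x. 0 \<le> f x"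
    and "(F \<longlongrightarrow> A) at_bot" "(F \<longlongrightarrow> B) at_top"
  shows "integrable lborel f" "integral\<^sup>L lborel f = B - A"
proof -
  have lim: "((F \<circ> real_of_ereal) \<longlongrightarrow> A) (at_right (-\<infinity>))" "((F \<circ> real_of_ereal) \<longlongrightarrow> B) (at_left \<infinity>)"
    using assms(4,5) by (simp_all add: ereal_tendsto_simps)
  have "set_integrable lborel (einterval (-\<infinity>) \<infinity>) f"
    by (rule interval_integral_FTC_nonneg(1)[of "-\<infinity>" \<infinity> F f A B]) (use assms lim in auto)
  then show "integrable lborel f" by (simp add: einterval_UNIV set_integrable_def)
  have "(LBINT x=-\<infinity>..\<infinity>. f x) = B - A"
    by (rule interval_integral_FTC_nonneg(2)[of "-\<infinity>" \<infinity> F f A B]) (use assms lim in auto)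
  then show "integral\<^sup>L lborel f = B - A"
    by (simp add: interval_lebesgue_integral_def einterval_UNIV set_lebesgue_integral_def)
qed

lemma integrable_cauchy: "integrable lborel (\<lambda>y::real. 1 / (1 + y\<^sup>2))"
proof (rule integrable_lborel_FTC(1))
  show "(arctan has_real_derivative 1 / (1 + y\<^sup>2)) (at y)" for y
    by (auto intro!: derivative_eq_intros simp: inverse_eq_divide)
  show "isCont (\<lambda>y::real. 1 / (1 + y\<^sup>2)) y" for y
    using sum_power2_eq_zero_iff[of 1 y] by (intro continuous_intros) auto
qed (auto intro: tendsto_arctan_at_bot tendsto_arctan_at_top)

text \<open>The majorant is 1 / cosh (c u), whose antiderivative (2 / c) arctan (exp (c u)) is
  smooth on the whole line.\<close>

lemma integrable_exp_abs:
  assumes c: "c > 0"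
  shows "integrable lborel (\<lambda>u::real. exp (- (c * \<bar>u\<bar>)))"
proof (rule Bochner_Integration.integrable_bound)
  show "integrable lborel (\<lambda>u. 2 * exp (c * u) / (1 + (exp (c * u))\<^sup>2))"
  proof (rule integrable_lborel_FTC(1))
    show "((\<lambda>u. 2 / c * arctan (exp (c * u))) has_real_derivative 2 * exp (c * u) / (1 + (exp (c * u))\<^sup>2)) (at u)" for u
      using c by (auto intro!: derivative_eq_intros simp: inverse_eq_divide)
    show "isCont (\<lambda>u. 2 * exp (c * u) / (1 + (exp (c * u))\<^sup>2)) u" for u
      using sum_power2_eq_zero_iff[of 1 "exp (c * u)"] by (intro continuous_intros) auto
    have "((\<lambda>u. exp (c * u)) \<longlongrightarrow> 0) at_bot" using c by real_asymp
    then show "((\<lambda>u. 2 / c * arctan (exp (c * u))) \<longlongrightarrow> 2 / c * arctan 0) at_bot"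
      by (intro tendsto_intros)
    have "filterlim (\<lambda>u. exp (c * u)) at_top at_top" using c by real_asymp
    then show "((\<lambda>u. 2 / c * arctan (exp (c * u))) \<longlongrightarrow> 2 / c * (pi / 2)) at_top"
      by (intro tendsto_intros filterlim_compose[OF tendsto_arctan_at_top])
  qed auto
  show "AE u in lborel. norm (exp (- (c * \<bar>u\<bar>))) \<le> norm (2 * exp (c * u) / (1 + (exp (c * u))\<^sup>2))"
  proof (intro AE_I2)
    fix u
    define E where "E = exp (c * u)"
    have E: "E > 0" by (simp add: E_def)
    have "exp (- (c * \<bar>u\<bar>)) \<le> 2 * E / (1 + E\<^sup>2)"
    proof (cases "u \<ge> 0")
      case True
      then have "E\<^sup>2 \<ge> 1\<^sup>2" using c by (intro power_mono) (auto simp: E_def)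
      then have "1 / E \<le> 2 * E / (1 + E\<^sup>2)"
        using E by (simp add: divide_le_eq pos_le_divide_eq power2_eq_square add_pos_pos)
      moreover have "exp (- (c * \<bar>u\<bar>)) = 1 / E" using True by (simp add: E_def exp_minus inverse_eq_divide)
      ultimately show ?thesis by simp
    next
      case False
      then have "E\<^sup>2 \<le> 1" using c E by (intro power_le_one) (auto simp: E_def mult_le_0_iff)
      moreover have "exp (- (c * \<bar>u\<bar>)) = E" using False by (simp add: E_def)
      moreover have "E \<le> 2 * E / (1 + E\<^sup>2)"
      proof -
        have "E * E\<^sup>2 \<le> E * 1" using calculation(1) E by (intro mult_left_mono) auto
        moreover have "1 + E\<^sup>2 > 0" by (simp add: add_pos_nonneg)
        ultimately show ?thesis by (simp add: pos_le_divide_eq distrib_left)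
      qed
      ultimately show ?thesis by simp
    qed
    then show "norm (exp (- (c * \<bar>u\<bar>))) \<le> norm (2 * exp (c * u) / (1 + (exp (c * u))\<^sup>2))"
      by (simp add: E_def)
  qed
qed auto

lemma integral_dominated_convergence_eventually:
  fixes f :: "'a \<Rightarrow> 'b :: {banach, second_countable_topology}" and w :: "'a \<Rightarrow> real"
  assumes "f \<in> borel_measurable M" "\<And>i. s i \<in> borel_measurable M" "integrable M w"
    and lim: "AE x in M. (\<lambda>i. s i x) \<longlonglongrightarrow> f x"
    and bound: "eventually (\<lambda>i::nat. AE x in M. norm (s i x) \<le> w x) sequentially"
  shows "integrable M f" "(\<lambda>i. integral\<^sup>L M (s i)) \<longlonglongrightarrow> integral\<^sup>L M f"
proof -
  obtain N where N: "\<And>i. i \<ge> N \<Longrightarrow> AE x in M. norm (s i x) \<le> w x"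
    using bound by (auto simp: eventually_sequentially)
  have lim': "AE x in M. (\<lambda>i. s (i + N) x) \<longlonglongrightarrow> f x"
    using lim by eventually_elim (rule LIMSEQ_ignore_initial_segment)
  show "integrable M f"
    by (rule integrable_dominated_convergence[OF assms(1) _ assms(3) lim']) (auto intro: assms(2) N)
  have "(\<lambda>i. integral\<^sup>L M (s (i + N))) \<longlonglongrightarrow> integral\<^sup>L M f"
    by (rule integral_dominated_convergence[OF assms(1) _ assms(3) lim']) (auto intro: assms(2) N)
  then show "(\<lambda>i. integral\<^sup>L M (s i)) \<longlonglongrightarrow> integral\<^sup>L M f" by (rule LIMSEQ_offset)
qed

section \<open>The saddle point and the scale of the peak\<close>

definition saddle :: "nat \<Rightarrow> real" where
  "saddle n = pi / sqrt (6 * real n)"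

text \<open>Taken at index \<open>n\<close> rather than at the peak, so that one scale serves all
  peaks; at typical peaks the ratio of the variances tends to 1.\<close>

definition flank_sd :: "nat \<Rightarrow> real" where
  "flank_sd n = sqrt (flank_var (saddle n) n)"

text \<open>The index \<open>s\<close> stands for the peak \<open>2 * s - 1\<close>; positions left of every peak get index \<open>0\<close> by
  truncation.\<close>

definition peak_pos :: "nat \<Rightarrow> nat \<Rightarrow> real" where
  "peak_pos n s = saddle n * (2 * real s - 1) - ln (2 / saddle n)"

definition peak_idx :: "nat \<Rightarrow> real \<Rightarrow> nat" where
  "peak_idx n u = nat (\<lfloor>(u + ln (2 / saddle n)) / (2 * saddle n)\<rfloor> + 1)"

lemma saddle_pos: "n > 0 \<Longrightarrow> saddle n > 0"
  by (simp add: saddle_def)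

lemma saddle_sq: "n > 0 \<Longrightarrow> real n * (saddle n)\<^sup>2 = pi\<^sup>2 / 6"
  by (simp add: saddle_def power_divide)

lemma filterlim_saddle: "filterlim saddle (at_right 0) sequentially"
  unfolding saddle_def using pi_gt_zero by real_asymp

lemma saddle_tendsto: "saddle \<longlonglongrightarrow> 0"
  using filterlim_saddle by (simp add: filterlim_at)

lemma eventually_saddle: "eventually (\<lambda>n. n > 0 \<and> 0 < saddle n \<and> saddle n \<le> 1 / 4) sequentially"
proof -
  have "eventually (\<lambda>n. saddle n < 1 / 4) sequentially"
    using saddle_tendsto by (rule order_tendstoD) simp
  with eventually_gt_at_top[of 0] show ?thesis
    by eventually_elim (simp add: saddle_pos)
qed

lemma flank_sd_bounds:
  assumes n: "n > 0" and t: "saddle n \<le> 1 / 4"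
  shows "1 / (3 * saddle n powr (3 / 2)) \<le> flank_sd n" "(flank_sd n)\<^sup>2 \<le> 3456 / (saddle n) ^ 3"
    "(flank_sd n)\<^sup>2 = flank_var (saddle n) n" "1 / (6 * saddle n ^ 3) \<le> (flank_sd n)\<^sup>2" "flank_sd n > 0"
proof -
  define t where "t = saddle n"
  have t0: "t > 0" "t \<le> 1 / 4" using saddle_pos[OF n] t by (auto simp: t_def)
  have "pi\<^sup>2 \<ge> 3\<^sup>2" using pi_gt3 by (intro power_mono) auto
  then have "1 / 2 \<le> real n * t * t" using saddle_sq[OF n] by (simp add: t_def power2_eq_square mult.assoc)
  also have "\<dots> \<le> real n * t * 1" using t0 by (intro mult_left_mono) auto
  finally have tn: "1 \<le> 2 * t * real n" by (simp add: mult_ac)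
  have low: "1 / (6 * t ^ 3) \<le> flank_var t n" by (rule flank_var_lower[OF t0 tn])
  have "0 < 1 / (6 * t ^ 3)" using t0 by simp
  with low have pos: "0 < flank_var t n" by linarith
  then show sq: "(flank_sd n)\<^sup>2 = flank_var (saddle n) n"
    by (simp add: flank_sd_def t_def)
  show low': "1 / (6 * saddle n ^ 3) \<le> (flank_sd n)\<^sup>2" using low by (simp add: sq t_def)
  show sd0: "flank_sd n > 0" using pos by (simp add: flank_sd_def t_def)
  show "(flank_sd n)\<^sup>2 \<le> 3456 / (saddle n) ^ 3"
    unfolding sq using flank_var_upper[OF t0] by (simp add: t_def)
  have "(1 / (3 * t powr (3 / 2)))\<^sup>2 = 1 / (9 * t ^ 3)"
    using t0 by (simp add: power_divide power_mult_distrib powr_power)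
  also have "\<dots> \<le> 1 / (6 * t ^ 3)" using t0 by (intro divide_left_mono) auto
  finally have "(1 / (3 * t powr (3 / 2)))\<^sup>2 \<le> (flank_sd n)\<^sup>2" using low' by (simp add: t_def)
  then show "1 / (3 * saddle n powr (3 / 2)) \<le> flank_sd n"
    unfolding t_def[symmetric] by (rule power2_le_imp_le) (use sd0 in simp)
qed

text \<open>The positions \<open>u\<close> of index \<open>s\<close> fill a cell of length 2 t, and
  the peak 2 s - 1 lies at its centre.\<close>

lemma peak_pos_idx:
  assumes "saddle n > 0" "peak_idx n u \<ge> 1"
  shows "u - saddle n < peak_pos n (peak_idx n u)" "peak_pos n (peak_idx n u) \<le> u + saddle n"
proof -
  define t where "t = saddle n"
  define x where "x = (u + ln (2 / t)) / (2 * t)"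
  have t: "t > 0" using assms by (simp add: t_def)
  have "real (peak_idx n u) = of_int (\<lfloor>x\<rfloor> + 1)"
    using assms(2) by (simp add: peak_idx_def x_def t_def)
  then have "real (peak_idx n u) \<le> x + 1" "x < real (peak_idx n u)" by linarith+
  then have "2 * t * real (peak_idx n u) \<le> 2 * t * (x + 1)" "2 * t * x < 2 * t * real (peak_idx n u)"
    using t by auto
  moreover have "2 * t * x = u + ln (2 / t)" using t by (simp add: x_def)
  ultimately show "u - saddle n < peak_pos n (peak_idx n u)" "peak_pos n (peak_idx n u) \<le> u + saddle n"
    unfolding peak_pos_def t_def[symmetric] by (simp_all add: algebra_simps)
qed

text \<open>For fixed \<open>u\<close> the peak is about log (2 / t) / t. It passes 1 / t, where the
  decay estimates start to apply, and stays far below n, which is of order t^-2.\<close>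

lemma eventually_peak_idx:
  "eventually (\<lambda>n. 1 \<le> 2 * saddle n * real (peak_idx n u) \<and> 1 \<le> peak_idx n u \<and> peak_idx n u \<le> n) sequentially"
proof -
  have "eventually (\<lambda>t::real. u + ln (2 / t) > 1) (at_right 0)" by real_asymp
  then have 1: "eventually (\<lambda>n. u + ln (2 / saddle n) > 1) sequentially"
    using filterlim_saddle by (rule eventually_compose_filterlim)
  have "eventually (\<lambda>t::real. t * (u + ln (2 / t) + 2 * t) < 3) (at_right 0)" by real_asymp
  then have 2: "eventually (\<lambda>n. saddle n * (u + ln (2 / saddle n) + 2 * saddle n) < 3) sequentially"
    using filterlim_saddle by (rule eventually_compose_filterlim)
  show ?thesis using 1 2 eventually_saddle
  proof eventually_elim
    case (elim n)
    define t where "t = saddle n"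
    define s where "s = peak_idx n u"
    have t: "t > 0" using elim by (simp add: t_def)
    have "(u + ln (2 / t)) / (2 * t) > 0" using elim t by (auto simp: t_def)
    then have s1: "s \<ge> 1" unfolding s_def peak_idx_def t_def by linarith
    have pp: "u - t < peak_pos n s" "peak_pos n s \<le> u + t"
      using peak_pos_idx[of n u] t s1 by (auto simp: t_def s_def)
    then have "2 * t * real s > 1" using elim(1) t by (simp add: peak_pos_def t_def[symmetric] algebra_simps)
    have "2 * t * real s \<le> u + ln (2 / t) + 2 * t"
      using pp by (simp add: peak_pos_def t_def[symmetric] algebra_simps)
    then have "t * (2 * t * real s) \<le> t * (u + ln (2 / t) + 2 * t)" using t by (intro mult_left_mono) auto
    also have "\<dots> \<le> 3" using elim by (simp add: t_def)
    also have "3\<^sup>2 \<le> pi\<^sup>2" using pi_gt3 by (intro power_mono) auto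
    then have "3 \<le> 2 * (real n * t\<^sup>2)" using saddle_sq[of n] elim by (simp add: t_def)
    finally have "t\<^sup>2 * (2 * real s) \<le> t\<^sup>2 * (2 * real n)" by (simp add: power2_eq_square mult_ac)
    then have "real s \<le> real n" using t by simp
    then show ?case using \<open>2 * t * real s > 1\<close> s1 by (simp add: s_def t_def)
  qed
qed

lemma peak_pos_tendsto: "(\<lambda>n. peak_pos n (peak_idx n u)) \<longlonglongrightarrow> u"
proof (rule tendsto_sandwich)
  show "eventually (\<lambda>n. u - saddle n \<le> peak_pos n (peak_idx n u)) sequentially"
    using eventually_peak_idx[of u] eventually_saddle by eventually_elim (simp add: peak_pos_idx less_imp_le)
  show "eventually (\<lambda>n. peak_pos n (peak_idx n u) \<le> u + saddle n) sequentially"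
    using eventually_peak_idx[of u] eventually_saddle by eventually_elim (simp add: peak_pos_idx)
  show "(\<lambda>n. u - saddle n) \<longlonglongrightarrow> u" "(\<lambda>n. u + saddle n) \<longlonglongrightarrow> u"
    using saddle_tendsto by (auto intro!: tendsto_eq_intros)
qed

definition flank_fourier :: "nat \<Rightarrow> nat \<Rightarrow> complex" where
  "flank_fourier n s =
     fourier_coeff (\<lambda>x. parts_cf (saddle n) s x * parts_cf (saddle n) s x) (int n - (2 * int s - 1))"

text \<open>The integrand of \<open>flank_fourier\<close> after the substitution x = y /
  \<open>flank_sd n\<close>, extended by zero.\<close>

definition flank_integrand :: "nat \<Rightarrow> nat \<Rightarrow> real \<Rightarrow> complex" where
  "flank_integrand n s y = indicator {-pi..pi} (y / flank_sd n) *\<^sub>R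
     (parts_cf (saddle n) s (y / flank_sd n) * parts_cf (saddle n) s (y / flank_sd n) *
      cis (- ((real n - (2 * real s - 1)) * (y / flank_sd n))))"

lemma borel_measurable_flank_integrand:
  assumes "saddle n > 0"
  shows "flank_integrand n s \<in> borel_measurable borel"
proof -
  have [measurable]: "parts_cf (saddle n) s \<in> borel_measurable borel"
    using continuous_parts_cf[OF assms] by (rule borel_measurable_continuous_onI)
  have [measurable]: "cis \<in> borel_measurable borel"
    by (intro borel_measurable_continuous_onI continuous_intros)
  show ?thesis unfolding flank_integrand_def[abs_def] by measurable
qed

lemma flank_fourier_eq:
  assumes "flank_sd n > 0"
  shows "of_real (flank_sd n) * flank_fourier n s = integral\<^sup>L lborel (flank_integrand n s)"
proof -
  define F where "F x = indicator {-pi..pi} x *\<^sub>R (parts_cf (saddle n) s x * parts_cf (saddle n) s x *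
      cis (- (of_int (int n - (2 * int s - 1)) * x)))" for x
  have eq: "flank_integrand n s = (\<lambda>y. F (0 + inverse (flank_sd n) * y))"
    by (rule ext) (simp add: flank_integrand_def F_def divide_inverse mult.commute[of "inverse _"])
  have "flank_fourier n s = integral\<^sup>L lborel F"
    by (simp add: flank_fourier_def fourier_coeff_def set_lebesgue_integral_def F_def[abs_def])
  also have "\<dots> = \<bar>inverse (flank_sd n)\<bar> *\<^sub>R integral\<^sup>L lborel (flank_integrand n s)"
    unfolding eq using assms by (intro lborel_integral_real_affine) auto
  finally show ?thesis using assms by (simp add: scaleR_conv_of_real)
qed

text \<open>An integrable majorant independent of n and s: the variance is at most 3456 / t^3, and
  40000 * 72 * 3456 < 10^10.\<close>

lemma norm_flank_integrand_le:
  assumes n: "n > 0" and t: "saddle n \<le> 1 / 4" and s: "1 \<le> 2 * saddle n * real s"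
  shows "norm (flank_integrand n s y) \<le> 10 ^ 10 * (1 / (1 + y\<^sup>2))"
proof (cases "\<bar>y / flank_sd n\<bar> \<le> pi")
  case True
  define t where "t = saddle n"
  define x where "x = y / flank_sd n"
  note sd = flank_sd_bounds[OF n t]
  have t0: "t > 0" using saddle_pos[OF n] by (simp add: t_def)
  have "norm (flank_integrand n s y) \<le> (norm (parts_cf t s x))\<^sup>2"
    by (simp add: flank_integrand_def norm_mult x_def t_def power2_eq_square indicator_def)
  also have "\<dots> \<le> 40000 / (1 + x\<^sup>2 / (72 * t ^ 3))"
    using norm_parts_cf_sq_le[of t x s] True t0 t s by (simp add: x_def t_def)
  also have "\<dots> \<le> 40000 / (1 / 248832 * (1 + y\<^sup>2))"
  proof (intro divide_left_mono)
    have "y\<^sup>2 = x\<^sup>2 * (flank_sd n)\<^sup>2" using sd(5) by (simp add: x_def power_divide)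
    also have "\<dots> \<le> x\<^sup>2 * (3456 / t ^ 3)" using sd(2) by (intro mult_left_mono) (auto simp: t_def)
    also have "\<dots> = 248832 * (x\<^sup>2 / (72 * t ^ 3))" using t0 by (simp add: field_simps)
    finally have "y\<^sup>2 \<le> 248832 * (x\<^sup>2 / (72 * t ^ 3))" .
    then have "1 + y\<^sup>2 \<le> 248832 * (1 + x\<^sup>2 / (72 * t ^ 3))" by (subst distrib_left) linarith
    then show "1 / 248832 * (1 + y\<^sup>2) \<le> 1 + x\<^sup>2 / (72 * t ^ 3)" by simp
    have "1 + y\<^sup>2 > 0" "1 + x\<^sup>2 / (72 * t ^ 3) > 0" using t0 by (auto intro!: add_pos_nonneg)
    then show "0 < (1 + x\<^sup>2 / (72 * t ^ 3)) * (1 / 248832 * (1 + y\<^sup>2))" by simp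
  qed auto
  also have "\<dots> \<le> 10 ^ 10 * (1 / (1 + y\<^sup>2))"
    by (simp add: divide_right_mono)
  finally show ?thesis .
next
  case False
  then have "y / flank_sd n \<notin> {-pi..pi}" by (simp only: abs_le_iff atLeastAtMost_iff) linarith
  then show ?thesis by (simp add: flank_integrand_def)
qed

text \<open>The normalised variance \<open>v\<close> tends to 1 and the normalised centring error
  \<open>d\<close> to 0, so the Gaussian approximation converges to the standard one for every
  \<open>u\<close>.\<close>

lemma flank_integrand_tendsto:
  "(\<lambda>n. flank_integrand n (peak_idx n u) y) \<longlonglongrightarrow> of_real (exp (- (y\<^sup>2 / 2)))"
proof -
  define s where "s n = peak_idx n u" for n
  define e where "e n = exp (- (3 / 4 * ((2 * real (s n) + 1) * saddle n)))" for n
  define v where "v n = flank_var (saddle n) (s n) / (flank_sd n)\<^sup>2" for n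
  define d where "d n = (flank_mean (saddle n) (s n) - (real n - (2 * real (s n) - 1))) / flank_sd n" for n
  define C where "C = exp (- (3 / 4 * u))"
  have C: "C > 0" by (simp add: C_def)
  note ev = eventually_conj[OF eventually_peak_idx[of u] eventually_saddle]
  \<comment> \<open>Since the peak is at least (u + log (2 / t)) / t up to a bounded error, the
    decay rate 3/4 yields t^(3/4).\<close>
  have e: "eventually (\<lambda>n. e n \<le> C * saddle n powr (3 / 4)) sequentially"
    using ev
  proof eventually_elim
    case (elim n)
    define t where "t = saddle n"
    have t: "t > 0" using elim by (simp add: t_def)
    have "u - t < peak_pos n (s n)" using peak_pos_idx[of n u] elim by (simp add: t_def s_def)
    then have "u + ln (2 / t) \<le> (2 * real (s n) + 1) * t"
      using t by (simp add: peak_pos_def t_def[symmetric] algebra_simps)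
    moreover have "ln (2 / t) \<ge> - ln t" using t by (simp add: ln_div)
    ultimately have "u - ln t \<le> (2 * real (s n) + 1) * t" by simp
    then have "e n \<le> exp (- (3 / 4 * (u - ln t)))" by (simp add: e_def t_def)
    also have "\<dots> = C * t powr (3 / 4)"
      using t by (simp add: C_def powr_def field_simps flip: exp_add)
    finally show ?case by (simp add: t_def)
  qed
  have v: "v \<longlonglongrightarrow> 1"
  proof (rule tendsto_sandwich)
    show "eventually (\<lambda>n. v n \<le> 1) sequentially"
      using ev
    proof eventually_elim
      case (elim n)
      then have "flank_var (saddle n) (s n) \<le> flank_var (saddle n) n"
        by (intro flank_var_diff) (auto simp: s_def)
      then have "flank_var (saddle n) (s n) \<le> (flank_sd n)\<^sup>2"
        using flank_sd_bounds(3)[of n] elim by simp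
      then show ?case using flank_sd_bounds(5)[of n] elim by (simp add: v_def divide_le_eq_1)
    qed
    show "eventually (\<lambda>n. 1 - 20736 * C * saddle n powr (3 / 4) \<le> v n) sequentially"
      using ev e
    proof eventually_elim
      case (elim n)
      define t where "t = saddle n"
      have t: "0 < t" "t \<le> 1 / 4" "n > 0" using elim by (auto simp: t_def)
      note sd = flank_sd_bounds[of n, folded t_def, OF t(3,2)]
      have "flank_var t n - flank_var t (s n) \<le> 3456 / t ^ 3 * e n"
        using elim t flank_var_diff(2)[of t "s n" n] by (simp add: e_def t_def s_def)
      also have "\<dots> \<le> 3456 / t ^ 3 * (C * t powr (3 / 4))"
        using elim t by (intro mult_left_mono) (auto simp: t_def)
      also have "\<dots> = 20736 * C * t powr (3 / 4) * (1 / (6 * t ^ 3))" using t by simp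
      also have "\<dots> \<le> 20736 * C * t powr (3 / 4) * (flank_sd n)\<^sup>2"
        using sd(4) C by (intro mult_left_mono) auto
      finally have "(flank_sd n)\<^sup>2 * (1 - 20736 * C * t powr (3 / 4)) \<le> flank_var t (s n)"
        by (simp add: sd(3) algebra_simps)
      then show ?case using sd(5) by (simp add: v_def t_def[symmetric] pos_le_divide_eq mult.commute)
    qed
    have "((\<lambda>t. 1 - 20736 * C * t powr (3 / 4)) \<longlongrightarrow> 1) (at_right 0)" by real_asymp
    then show "(\<lambda>n. 1 - 20736 * C * saddle n powr (3 / 4)) \<longlonglongrightarrow> 1"
      by (rule filterlim_compose[OF _ filterlim_saddle])
  qed auto
  have d: "d \<longlonglongrightarrow> 0"
  proof (rule Lim_null_comparison)
    \<comment> \<open>The three summands are the saddle point error t^-1, the mean contributed by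
      parts above the peak, t^(-5/4), and the peak itself, log (1/t) / t. The prefactor bounds 1 /
      \<open>flank_sd n\<close> and outweighs all of them.\<close>
    let ?B = "\<lambda>t::real. 3 * t powr (3 / 2) * (2000 / t + 3456 / t\<^sup>2 * (C * t powr (3 / 4)) + (\<bar>u\<bar> + t + ln (2 / t)) / t)"
    show "eventually (\<lambda>n. norm (d n) \<le> ?B (saddle n)) sequentially"
      using ev e
    proof eventually_elim
      case (elim n)
      define t where "t = saddle n"
      have t: "0 < t" "t \<le> 1 / 4" "n > 0" using elim by (auto simp: t_def)
      note sd = flank_sd_bounds[of n, folded t_def, OF t(3,2)]
      have m1: "\<bar>flank_mean t n - real n\<bar> \<le> 2000 / t"
        using t saddle_sq[of n] by (intro flank_mean_close) (auto simp: t_def)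
      have "flank_mean t n - flank_mean t (s n) \<le> 3456 / t\<^sup>2 * e n"
        using elim t flank_mean_diff(2)[of t "s n" n] by (simp add: e_def t_def s_def)
      also have "\<dots> \<le> 3456 / t\<^sup>2 * (C * t powr (3 / 4))"
        using elim t by (intro mult_left_mono) (auto simp: t_def)
      finally have m2: "\<bar>flank_mean t n - flank_mean t (s n)\<bar> \<le> 3456 / t\<^sup>2 * (C * t powr (3 / 4))"
        using flank_mean_diff(1)[of t "s n" n] elim t by (simp add: s_def)
      have "peak_pos n (s n) \<le> u + t" using peak_pos_idx[of n u] elim by (simp add: t_def s_def)
      then have "t * (2 * real (s n) - 1) \<le> \<bar>u\<bar> + t + ln (2 / t)"
        by (simp add: peak_pos_def t_def[symmetric])
      then have "2 * real (s n) - 1 \<le> (\<bar>u\<bar> + t + ln (2 / t)) / t"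
        using t by (simp add: pos_le_divide_eq mult.commute)
      moreover have "0 \<le> 2 * real (s n) - 1" using elim by (simp add: s_def)
      ultimately have m3: "\<bar>2 * real (s n) - 1\<bar> \<le> (\<bar>u\<bar> + t + ln (2 / t)) / t" by simp
      define A where "A = 2000 / t + 3456 / t\<^sup>2 * (C * t powr (3 / 4)) + (\<bar>u\<bar> + t + ln (2 / t)) / t"
      have "\<bar>flank_mean t (s n) - (real n - (2 * real (s n) - 1))\<bar> \<le> A"
        using m1 m2 m3 unfolding A_def by linarith
      then have "norm (d n) \<le> A / flank_sd n"
        using sd(5) by (simp add: d_def t_def[symmetric] divide_right_mono)
      also have "\<dots> \<le> A / (1 / (3 * t powr (3 / 2)))"
        using sd(1,5) t m1 m2 m3 unfolding A_def by (intro divide_left_mono) auto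
      finally show ?case by (simp add: A_def t_def mult.commute)
    qed
    have "(?B \<longlongrightarrow> 0) (at_right 0)" by real_asymp
    then show "(\<lambda>n. ?B (saddle n)) \<longlonglongrightarrow> 0" by (rule filterlim_compose[OF _ filterlim_saddle])
  qed
  define g where "g n = complex_of_real (exp (- (v n * y\<^sup>2 / 2))) * cis (d n * y)" for n
  have "g \<longlonglongrightarrow> of_real (exp (- (1 * y\<^sup>2 / 2))) * cis (0 * y)"
    unfolding g_def by (intro tendsto_intros v d) auto
  then have g: "g \<longlonglongrightarrow> of_real (exp (- (y\<^sup>2 / 2)))" by simp
  moreover have "(\<lambda>n. flank_integrand n (s n) y - g n) \<longlonglongrightarrow> 0"
  proof (rule Lim_null_comparison)
    \<comment> \<open>93312 = 3456 * 3^3, and the power is 9/2 - 4.\<close>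
    let ?B = "\<lambda>t::real. 93312 * \<bar>y\<bar> ^ 3 * t powr (1 / 2)"
    have "eventually (\<lambda>t::real. \<bar>y\<bar> * (3 * t powr (3 / 2)) < pi) (at_right 0)" by real_asymp
    then have "eventually (\<lambda>n. \<bar>y\<bar> * (3 * saddle n powr (3 / 2)) < pi) sequentially"
      using filterlim_saddle by (rule eventually_compose_filterlim)
    then show "eventually (\<lambda>n. norm (flank_integrand n (s n) y - g n) \<le> ?B (saddle n)) sequentially"
      using ev
    proof eventually_elim
      case (elim n)
      define t where "t = saddle n"
      have t: "0 < t" "t \<le> 1 / 4" "n > 0" using elim by (auto simp: t_def)
      note sd = flank_sd_bounds[of n, folded t_def, OF t(3,2)]
      define x where "x = y / flank_sd n"
      have "\<bar>x\<bar> = \<bar>y\<bar> / flank_sd n" using sd(5) by (simp add: x_def)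
      also have "\<dots> \<le> \<bar>y\<bar> / (1 / (3 * t powr (3 / 2)))"
        using sd(1,5) t by (intro divide_left_mono) auto
      finally have x: "\<bar>x\<bar> \<le> \<bar>y\<bar> * (3 * t powr (3 / 2))" by simp
      then have "x \<in> {-pi..pi}" using elim by (auto simp: t_def)
      define P where "P = parts_cf t (s n) x * parts_cf t (s n) x"
      define \<mu> where "\<mu> = flank_mean t (s n)"
      have dy: "d n * y = (\<mu> - (real n - (2 * real (s n) - 1))) * x"
        by (simp add: d_def x_def \<mu>_def t_def)
      have "flank_integrand n (s n) y = P * cis (- ((real n - (2 * real (s n) - 1)) * x))"
        using \<open>x \<in> {-pi..pi}\<close> by (simp add: flank_integrand_def x_def[symmetric] t_def[symmetric] P_def)
      also have "\<dots> = P * cis (- (\<mu> * x)) * cis (d n * y)"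
        unfolding dy by (simp add: mult.assoc cis_mult algebra_simps)
      finally have I: "flank_integrand n (s n) y = P * cis (- (\<mu> * x)) * cis (d n * y)" .
      have vy: "v n * y\<^sup>2 = flank_var t (s n) * x\<^sup>2"
        by (simp add: v_def x_def t_def power_divide)
      have "norm (flank_integrand n (s n) y - g n) =
          norm ((P * cis (- (\<mu> * x)) - of_real (exp (- (v n * y\<^sup>2 / 2)))) * cis (d n * y))"
        by (simp add: I g_def algebra_simps)
      also have "\<dots> = norm (P * cis (- (\<mu> * x)) - of_real (exp (- (flank_var t (s n) * x\<^sup>2 / 2))))"
        by (simp add: norm_mult vy)
      also have "\<dots> \<le> 3456 * \<bar>x\<bar> ^ 3 / t ^ 4"
        unfolding P_def \<mu>_def by (rule parts_cf_gaussian[OF t(1,2)])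
      also have "\<dots> \<le> 3456 * (\<bar>y\<bar> * (3 * t powr (3 / 2))) ^ 3 / t ^ 4"
        using x t by (intro divide_right_mono mult_left_mono power_mono) auto
      also have "\<dots> = 93312 * \<bar>y\<bar> ^ 3 * (t powr (9 / 2) / t powr 4)"
        using t by (simp add: power_mult_distrib powr_powr flip: powr_numeral)
      also have "t powr (9 / 2) / t powr 4 = t powr (1 / 2)" using powr_diff[of t "9/2" 4] by simp
      finally show ?case by (simp add: t_def)
    qed
    have "(?B \<longlongrightarrow> 0) (at_right 0)" by real_asymp
    then show "(\<lambda>n. ?B (saddle n)) \<longlonglongrightarrow> 0" by (rule filterlim_compose[OF _ filterlim_saddle])
  qed
  ultimately show ?thesis unfolding s_def using tendsto_add by fastforce
qed

text \<open>A common factor of numerator and denominator, which cancels in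
  \<open>expectation_PK_tendsto\<close>.\<close>

definition gauss_mass :: real where
  "gauss_mass = (\<integral>y. exp (- (y\<^sup>2 / 2)) \<partial>lborel)"

lemma flank_fourier_tendsto:
  "(\<lambda>n. flank_sd n * norm (flank_fourier n (peak_idx n u))) \<longlonglongrightarrow> \<bar>gauss_mass\<bar>"
proof -
  define f where "f n = (if n > 0 then flank_integrand n (peak_idx n u) else (\<lambda>_. 0))" for n
  have "(\<lambda>n. integral\<^sup>L lborel (f n)) \<longlonglongrightarrow> (\<integral>y. complex_of_real (exp (- (y\<^sup>2 / 2))) \<partial>lborel)"
  proof (rule integral_dominated_convergence_eventually(2))
    show "f n \<in> borel_measurable lborel" for n
      using borel_measurable_flank_integrand[of n] saddle_pos[of n] by (simp add: f_def)
    show "integrable lborel (\<lambda>y::real. 10 ^ 10 * (1 / (1 + y\<^sup>2)))"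
      by (intro integrable_mult_right integrable_cauchy)
    show "AE y in lborel. (\<lambda>n. f n y) \<longlonglongrightarrow> complex_of_real (exp (- (y\<^sup>2 / 2)))"
    proof (intro AE_I2)
      fix y
      have "eventually (\<lambda>n. flank_integrand n (peak_idx n u) y = f n y) sequentially"
        using eventually_gt_at_top[of 0] by eventually_elim (simp add: f_def)
      then show "(\<lambda>n. f n y) \<longlonglongrightarrow> complex_of_real (exp (- (y\<^sup>2 / 2)))"
        using flank_integrand_tendsto[of u y] by (rule Lim_transform_eventually[rotated])
    qed
    show "eventually (\<lambda>n. AE y in lborel. norm (f n y) \<le> 10 ^ 10 * (1 / (1 + y\<^sup>2))) sequentially"
      using eventually_conj[OF eventually_peak_idx[of u] eventually_saddle]
    proof eventually_elim
      case (elim n)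
      then have "norm (flank_integrand n (peak_idx n u) y) \<le> 10 ^ 10 * (1 / (1 + y\<^sup>2))" for y
        by (intro norm_flank_integrand_le) auto
      then show ?case using elim by (simp add: f_def)
    qed
  qed auto
  also have "(\<integral>y. complex_of_real (exp (- (y\<^sup>2 / 2))) \<partial>lborel) = of_real gauss_mass"
    unfolding gauss_mass_def by (rule integral_complex_of_real)
  finally have "(\<lambda>n. norm (integral\<^sup>L lborel (f n))) \<longlonglongrightarrow> norm (complex_of_real gauss_mass)"
    by (rule tendsto_norm)
  moreover have "eventually (\<lambda>n. norm (integral\<^sup>L lborel (f n)) = flank_sd n * norm (flank_fourier n (peak_idx n u))) sequentially"
    using eventually_saddle
  proof eventually_elim
    case (elim n)
    then have sd: "flank_sd n > 0" using flank_sd_bounds(5)[of n] by simp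
    then show ?case using elim flank_fourier_eq[OF sd, of "peak_idx n u"]
      by (simp add: f_def norm_mult flip: flank_fourier_eq)
  qed
  ultimately show ?thesis by (simp add: tendsto_cong)
qed

lemma gauss_mass_pos: "gauss_mass > 0"
proof -
  have "integrable lborel (\<lambda>y::real. exp (- (y\<^sup>2 / 2)))"
  proof (rule Bochner_Integration.integrable_bound)
    show "integrable lborel (\<lambda>y::real. 2 * (1 / (1 + y\<^sup>2)))" by (intro integrable_mult_right integrable_cauchy)
    show "AE y::real in lborel. norm (exp (- (y\<^sup>2 / 2))) \<le> norm (2 * (1 / (1 + y\<^sup>2)))"
    proof (intro AE_I2)
      fix y :: real
      have "1 + y\<^sup>2 \<le> 2 * exp (y\<^sup>2 / 2)" using exp_ge_add_one_self[of "y\<^sup>2 / 2"] by linarith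
      then show "norm (exp (- (y\<^sup>2 / 2))) \<le> norm (2 * (1 / (1 + y\<^sup>2)))"
        by (simp add: exp_minus field_simps add_pos_nonneg)
    qed
  qed auto
  then have "gauss_mass = 0 \<longleftrightarrow> (AE y in lborel. exp (- (y\<^sup>2 / 2)) = (0::real))"
    unfolding gauss_mass_def by (rule integral_nonneg_eq_0_iff_AE) simp
  then have "gauss_mass \<noteq> 0" by (simp add: eventually_False ae_filter_eq_bot_iff)
  moreover have "gauss_mass \<ge> 0" unfolding gauss_mass_def by (rule integral_nonneg_AE) simp
  ultimately show ?thesis by simp
qed

lemma flank_fourier_le:
  assumes n: "n > 0" and t: "saddle n \<le> 1 / 4" and s: "1 \<le> 2 * saddle n * real s"
  shows "flank_sd n * norm (flank_fourier n s) \<le> 10 ^ 10 * (\<integral>y. 1 / (1 + y\<^sup>2) \<partial>lborel)"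
proof -
  have int: "integrable lborel (\<lambda>y::real. 10 ^ 10 * (1 / (1 + y\<^sup>2)))"
    by (intro integrable_mult_right integrable_cauchy)
  have "flank_sd n * norm (flank_fourier n s) = norm (of_real (flank_sd n) * flank_fourier n s)"
    using flank_sd_bounds(5)[OF n t] by (simp add: norm_mult)
  also have "\<dots> = norm (integral\<^sup>L lborel (flank_integrand n s))"
    using flank_fourier_eq flank_sd_bounds(5)[OF n t] by simp
  also have "\<dots> \<le> (\<integral>y. 10 ^ 10 * (1 / (1 + y\<^sup>2)) \<partial>lborel)"
    by (rule Bochner_Integration.integral_norm_bound_integral[OF
          Bochner_Integration.integrable_bound[OF int] int])
       (use norm_flank_integrand_le[OF n t s] borel_measurable_flank_integrand saddle_pos n in
         \<open>auto intro!: AE_I2 order_trans[OF _ abs_ge_self] simp del: power_numeral\<close>)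
  also have "\<dots> = 10 ^ 10 * (\<integral>y. 1 / (1 + y\<^sup>2) \<partial>lborel)" by (rule integral_mult_right_zero)
  finally show ?thesis .
qed

text \<open>A bound for every \<open>s\<close>, from |\<open>parts_cf\<close>| <= 1 alone, so the
  coefficient is at most 2 pi.\<close>

lemma flank_fourier_le_crude:
  assumes n: "n > 0" and t: "saddle n \<le> 1 / 4"
  shows "flank_sd n * norm (flank_fourier n s) \<le> 400 / (saddle n)\<^sup>2"
proof -
  define t where "t = saddle n"
  have t0: "0 < t" "t \<le> 1 / 4" using assms saddle_pos[of n] by (auto simp: t_def)
  note sd = flank_sd_bounds[OF n t]
  define g where "g x = parts_cf t s x * parts_cf t s x * cis (- (of_int (int n - (2 * int s - 1)) * x))" for x
  have g: "set_integrable lborel {-pi..pi} g"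
    unfolding g_def by (intro set_integrable_fourier continuous_intros continuous_parts_cf t0)
  have g1: "norm (g x) \<le> 1" for x
  proof -
    have "norm (parts_cf t s x) \<le> 1"
      using norm_parts_cf_le[of t 0 s x] t0 by (simp add: parts_cf_def)
    then show ?thesis by (simp add: g_def norm_mult mult_le_one)
  qed
  have "norm (flank_fourier n s) \<le> (LINT x:{-pi..pi}|lborel. norm (g x))"
    unfolding flank_fourier_def fourier_coeff_def t_def[symmetric] g_def[symmetric]
    by (rule set_integral_norm_bound[OF g])
  also have "\<dots> \<le> (LINT x:{-pi..pi}|lborel. (1::real))"
    by (rule set_integral_mono[OF set_integrable_norm[OF g]]) (auto simp: set_integrable_def g1)
  also have "\<dots> = 2 * pi" by (simp add: set_lebesgue_integral_def)
  also have "\<dots> \<le> 6.5" using pi_approx by simp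
  finally have J: "norm (flank_fourier n s) \<le> 6.5" .
  have "(flank_sd n)\<^sup>2 \<le> 3456 / t ^ 3" using sd(2) by (simp add: t_def)
  also have "\<dots> = 3456 * t / t ^ 4" using t0 by (simp add: power4_eq_xxxx power3_eq_cube)
  \<comment> \<open>One factor t is given away to reach a perfect square: the integral power t^-2
    replaces t^(-3/2).\<close>
  also have "\<dots> \<le> 3600 / t ^ 4" using t0 by (intro divide_right_mono) auto
  also have "\<dots> = (60 / t\<^sup>2)\<^sup>2" by (simp add: power_divide flip: power_mult)
  finally have "flank_sd n \<le> 60 / t\<^sup>2" by (rule power2_le_imp_le) (use t0 in simp)
  then have "flank_sd n * norm (flank_fourier n s) \<le> 60 / t\<^sup>2 * 6.5"
    using J sd(5) t0 by (intro mult_mono) auto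
  also have "\<dots> \<le> 400 / t\<^sup>2" using t0 by (simp add: divide_right_mono)
  finally show ?thesis by (simp add: t_def)
qed

section \<open>The Gumbel density\<close>

text \<open>Twice the density of the Gumbel law with location - ln 2; the total mass is 2.\<close>

definition gumbel :: "real \<Rightarrow> real" where
  "gumbel u = exp (- u) * exp (- (1/2) * exp (- u))"

lemma gumbel_nonneg: "0 \<le> gumbel u"
  by (simp add: gumbel_def)

lemma continuous_gumbel: "continuous_on A gumbel"
  unfolding gumbel_def by (intro continuous_intros)

lemma isCont_gumbel: "isCont gumbel u"
  using continuous_gumbel[of UNIV] by (simp add: continuous_on_eq_continuous_at)

lemma borel_measurable_gumbel [measurable]: "gumbel \<in> borel_measurable borel"
  by (rule borel_measurable_continuous_onI[OF continuous_gumbel])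

lemma gumbel_DERIV: "((\<lambda>u. 2 * exp (- (1/2) * exp (- u))) has_real_derivative gumbel u) (at u)"
  unfolding gumbel_def by (auto intro!: derivative_eq_intros)

lemma gumbel_at_bot: "((\<lambda>u::real. 2 * exp (- (1/2) * exp (- u))) \<longlongrightarrow> 0) at_bot"
  by real_asymp

lemma integral_gumbel: "integral\<^sup>L lborel gumbel = 2"
proof -
  have "((\<lambda>u::real. 2 * exp (- (1/2) * exp (- u))) \<longlongrightarrow> 2) at_top" by real_asymp
  note * = gumbel_DERIV _ _ gumbel_at_bot this
  show ?thesis
    using integrable_lborel_FTC(2)[OF *] isCont_gumbel gumbel_nonneg by auto
qed

lemma integral_gumbel_atMost: "(\<integral>u. indicator {..v} u * gumbel u \<partial>lborel) = 2 * exp (- (1/2) * exp (- v))"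
proof -
  let ?F = "\<lambda>u. 2 * exp (- (1/2) * exp (- u))"
  have "(LBINT u=-\<infinity>..ereal v. gumbel u) = ?F v - 0"
  proof (rule interval_integral_FTC_nonneg(2))
    show "((?F \<circ> real_of_ereal) \<longlongrightarrow> 0) (at_right (-\<infinity>))"
      using gumbel_at_bot by (simp add: ereal_tendsto_simps)
    have "isCont ?F v" by (intro continuous_intros)
    then have "(?F \<longlongrightarrow> ?F v) (at_left v)"
      by (simp add: isCont_def filterlim_at_split)
    then show "((?F \<circ> real_of_ereal) \<longlongrightarrow> ?F v) (at_left (ereal v))"
      by (simp add: ereal_tendsto_simps)
    show "isCont gumbel u" for u by (rule isCont_gumbel)
    show "DERIV ?F u :> gumbel u" for u by (rule gumbel_DERIV)
  qed (auto simp: gumbel_nonneg)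
  also have "(LBINT u=-\<infinity>..ereal v. gumbel u) = (\<integral>u. indicator {..<v} u * gumbel u \<partial>lborel)"
    by (simp add: interval_lebesgue_integral_def set_lebesgue_integral_def einterval_def lessThan_def)
  also have "\<dots> = (\<integral>u. indicator {..v} u * gumbel u \<partial>lborel)"
  proof (rule integral_cong_AE)
    have "AE u in lborel. u \<noteq> v" by (rule AE_lborel_singleton)
    then show "AE u in lborel. indicator {..<v} u * gumbel u = indicator {..v} u * gumbel u"
      by eventually_elim (auto simp: indicator_def)
  qed auto
  finally show ?thesis by simp
qed

lemma gumbel_le: "gumbel u \<le> 8 * exp (- \<bar>u\<bar>)"
proof (cases "u \<ge> 0")
  case True
  have "gumbel u \<le> exp (- u) * 1" unfolding gumbel_def by (intro mult_left_mono) auto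
  also have "\<dots> \<le> 8 * exp (- \<bar>u\<bar>)" using True by simp
  finally show ?thesis .
next
  case False
  define x where "x = exp (- u)"
  have x: "x > 0" by (simp add: x_def)
  \<comment> \<open>The quadratic Taylor term of exp (x / 2) beats the growth x = exp (- u) on the
    left.\<close>
  have "x\<^sup>2 / 8 \<le> exp (x / 2)"
    using exp_lower_Taylor_quadratic[of "x / 2"] x by (simp add: power_divide)
  then have "x * exp (- (1/2) * x) \<le> 8 / x"
    using x by (simp add: exp_minus field_simps power2_eq_square)
  also have "8 / x = 8 * exp (- \<bar>u\<bar>)" using False by (simp add: x_def exp_minus field_simps)
  finally show ?thesis by (simp add: gumbel_def x_def)
qed

text \<open>The substitution y = exp (- u) / 2 in Euler's integral for Gamma (1 + h).\<close>

lemma integral_exp_gumbel: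
  assumes h: "h \<ge> 0"
  shows "has_bochner_integral lborel (\<lambda>u. exp (- (h * u)) * gumbel u) (2 powr (1 + h) * Gamma (1 + h))"
proof -
  define f where "f y = y powr h / exp y" for y :: real
  define g where "g u = 1/2 * exp (- u)" for u :: real
  have "(f has_integral Gamma (1 + h)) {0..}"
    using Gamma_integral_real[of "1 + h"] h by (simp add: f_def[abs_def])
  then have f: "(f has_integral Gamma (1 + h)) {0<..}"
    by (subst has_integral_spike_set_eq[of _ "{0..}"]) (auto intro: negligible_subset[of "{0}"])
  have range: "g ` UNIV = {0<..}"
  proof (intro equalityI subsetI)
    fix y :: real assume "y \<in> {0<..}"
    then have "y = g (- ln (2 * y))" by (simp add: g_def)
    then show "y \<in> g ` UNIV" by blast
  qed (auto simp: g_def)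
  have "f absolutely_integrable_on g ` UNIV"
    unfolding range using f by (intro nonnegative_absolutely_integrable_1) (auto simp: f_def has_integral_integrable)
  then have "f absolutely_integrable_on g ` UNIV \<and> integral (g ` UNIV) f = Gamma (1 + h)"
    using f integral_unique[OF f] by (simp add: range)
  then have *: "(\<lambda>u. \<bar>- (1/2) * exp (- u)\<bar> * f (g u)) absolutely_integrable_on UNIV \<and>
      integral UNIV (\<lambda>u. \<bar>- (1/2) * exp (- u)\<bar> * f (g u)) = Gamma (1 + h)"
    by (subst has_absolute_integral_change_of_variables_1'[where S = UNIV and g = g and g' = "\<lambda>u. - (1/2) * exp (- u)"])
       (auto simp: g_def[abs_def] inj_on_def intro!: derivative_eq_intros)
  have eq: "\<bar>- (1/2) * exp (- u)\<bar> * f (g u) = 1 / 2 powr (1 + h) * (exp (- (h * u)) * gumbel u)" for u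
    by (simp add: f_def g_def gumbel_def powr_mult exp_powr_real powr_add powr_divide exp_minus field_simps)
  let ?k = "\<lambda>u. 1 / 2 powr (1 + h) * (exp (- (h * u)) * gumbel u)"
  have "(?k has_integral Gamma (1 + h)) UNIV"
    using * unfolding eq by (auto simp: absolutely_integrable_on_def has_integral_integrable_integral)
  then have "integral\<^sup>N lborel (\<lambda>u. ennreal (?k u)) = Gamma (1 + h)"
    by (intro nn_integral_has_integral_lborel) (auto simp: gumbel_nonneg)
  then have "has_bochner_integral lborel ?k (Gamma (1 + h))"
    using h by (intro has_bochner_integral_nn_integral) (auto simp: gumbel_nonneg Gamma_real_pos less_imp_le)
  from has_bochner_integral_mult_right[OF this, of "2 powr (1 + h)"] show ?thesis
    by simp
qed

lemma abs_exp_minus_one_le: "\<bar>exp x - 1\<bar> \<le> \<bar>x\<bar> * exp \<bar>x\<bar>" for x :: real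
proof (cases "x \<ge> 0")
  case True
  have "(1 - exp (- x)) * exp x \<le> x * exp x"
    using exp_ge_add_one_self[of "- x"] by (intro mult_right_mono) (linarith, simp)
  then have "exp x - 1 \<le> x * exp x" by (simp add: left_diff_distrib flip: exp_add)
  then show ?thesis using True by simp
next
  case False
  have "1 - exp x \<le> - x" using exp_ge_add_one_self[of x] by linarith
  also have "\<dots> \<le> - x * exp \<bar>x\<bar>" using False mult_left_mono[of 1 "exp \<bar>x\<bar>" "- x"] by simp
  finally show ?thesis using False by simp
qed

text \<open>Differentiating \<open>\<integral> exp (- h u) gumbel u du = 2 powr (1 + h) * Gamma (1 + h)\<close> at \<open>h = 0\<close>.\<close>

lemma integral_gumbel_mean:
  "(\<integral>u. u * gumbel u \<partial>lborel) = 2 * (euler_mascheroni - ln 2)"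
proof -
  \<comment> \<open>A null sequence in (0, 1/2]. The difference quotient is then at most |u| exp
    (|u| / 2) <= 4 exp (3/4 |u|), which leaves exp (- |u| / 4) of the decay of
    \<open>gumbel\<close>.\<close>
  define h where "h m = 1 / (real m + 2)" for m
  have h: "0 < h m" "h m \<le> 1 / 2" for m by (auto simp: h_def field_simps)
  define k where "k m u = (exp (- (h m * u)) - 1) / h m * gumbel u" for m u
  have h0: "h \<longlonglongrightarrow> 0" unfolding h_def by real_asymp
  have lim: "(\<lambda>m. integral\<^sup>L lborel (k m)) \<longlonglongrightarrow> (\<integral>u. - u * gumbel u \<partial>lborel)"
  proof (rule integral_dominated_convergence)
    show "integrable lborel (\<lambda>u::real. 32 * exp (- (1/4 * \<bar>u\<bar>)))"
      by (intro integrable_mult_right integrable_exp_abs) auto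
    show "AE u in lborel. (\<lambda>m. k m u) \<longlonglongrightarrow> - u * gumbel u"
    proof (intro AE_I2)
      fix u
      have "((\<lambda>x. exp (- (x * u))) has_real_derivative - u) (at 0)"
        by (auto intro!: derivative_eq_intros)
      then have "((\<lambda>x. (exp (- (x * u)) - 1) / x) \<longlongrightarrow> - u) (at 0)"
        by (simp add: DERIV_def)
      moreover have "filterlim h (at 0) sequentially"
        using h0 h(1) by (auto simp: filterlim_at less_imp_neq[THEN not_sym])
      ultimately have "(\<lambda>m. (exp (- (h m * u)) - 1) / h m) \<longlonglongrightarrow> - u"
        by (rule filterlim_compose)
      then show "(\<lambda>m. k m u) \<longlonglongrightarrow> - u * gumbel u" unfolding k_def by (intro tendsto_intros)
    qed
    show "AE u in lborel. norm (k m u) \<le> 32 * exp (- (1/4 * \<bar>u\<bar>))" for m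
    proof (intro AE_I2)
      fix u
      have "\<bar>exp (- (h m * u)) - 1\<bar> \<le> (h m * \<bar>u\<bar>) * exp (h m * \<bar>u\<bar>)"
        using abs_exp_minus_one_le[of "- (h m * u)"] h(1)[of m] by (simp add: abs_mult)
      also have "\<dots> \<le> (h m * \<bar>u\<bar>) * exp (1/2 * \<bar>u\<bar>)"
        using h[of m] mult_right_mono[of "h m" "1/2" "\<bar>u\<bar>"] by (intro mult_left_mono) auto
      finally have 1: "\<bar>exp (- (h m * u)) - 1\<bar> / h m \<le> \<bar>u\<bar> * exp (1/2 * \<bar>u\<bar>)"
        using h(1)[of m] by (simp add: pos_divide_le_eq mult_ac)
      have "\<bar>u\<bar> \<le> 4 * exp (1/4 * \<bar>u\<bar>)" using exp_ge_add_one_self[of "1/4 * \<bar>u\<bar>"] by linarith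
      then have "\<bar>u\<bar> * exp (1/2 * \<bar>u\<bar>) \<le> 4 * exp (1/4 * \<bar>u\<bar>) * exp (1/2 * \<bar>u\<bar>)"
        by (intro mult_right_mono) auto
      also have "\<dots> = 4 * exp (3/4 * \<bar>u\<bar>)" by (simp add: mult.assoc flip: exp_add)
      finally have "\<bar>exp (- (h m * u)) - 1\<bar> / h m \<le> 4 * exp (3/4 * \<bar>u\<bar>)" using 1 by linarith
      then have "norm (k m u) \<le> 4 * exp (3/4 * \<bar>u\<bar>) * (8 * exp (- \<bar>u\<bar>))"
        unfolding k_def norm_mult using h(1)[of m] gumbel_le[of u] gumbel_nonneg[of u]
        by (intro mult_mono) auto
      also have "\<dots> = 32 * exp (- (1/4 * \<bar>u\<bar>))" by (simp flip: exp_add)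
      finally show "norm (k m u) \<le> 32 * exp (- (1/4 * \<bar>u\<bar>))" .
    qed
  qed (auto simp: k_def[abs_def])
  have eq: "integral\<^sup>L lborel (k m) = (2 powr (1 + h m) * Gamma (1 + h m) - 2 powr 1 * Gamma 1) / h m" for m
  proof -
    have "has_bochner_integral lborel (\<lambda>u. (exp (- (h m * u)) * gumbel u - exp (- (0 * u)) * gumbel u) / h m)
       ((2 powr (1 + h m) * Gamma (1 + h m) - 2 powr (1 + 0) * Gamma (1 + 0)) / h m)"
      using h(1)[of m]
      by (intro has_bochner_integral_divide_zero has_bochner_integral_diff integral_exp_gumbel) auto
    then show ?thesis
      by (simp add: has_bochner_integral_iff k_def[abs_def] left_diff_distrib diff_divide_distrib)
  qed
  have "(\<lambda>m. (2 powr (1 + h m) * Gamma (1 + h m) - 2 powr 1 * Gamma 1) / h m) \<longlonglongrightarrow>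
      2 * ln 2 - 2 * euler_mascheroni"
  proof -
    have "((\<lambda>x::real. 2 powr x * Gamma x) has_real_derivative 2 * ln 2 - 2 * euler_mascheroni) (at 1)"
      by (auto intro!: derivative_eq_intros)
    then have "((\<lambda>x. (2 powr (1 + x) * Gamma (1 + x) - 2 powr 1 * Gamma 1) / x) \<longlongrightarrow> 2 * ln 2 - 2 * euler_mascheroni) (at (0::real))"
      by (simp add: DERIV_def)
    moreover have "filterlim h (at 0) sequentially"
      using h0 h(1) by (auto simp: filterlim_at less_imp_neq[THEN not_sym])
    ultimately show ?thesis by (rule filterlim_compose)
  qed
  from LIMSEQ_unique[OF lim[unfolded eq] this]
  have "(\<integral>u. - u * gumbel u \<partial>lborel) = 2 * ln 2 - 2 * euler_mascheroni" .
  then show ?thesis by simp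
qed

section \<open>Distribution of the peak\<close>

lemma parts_gf_pos: "t > 0 \<Longrightarrow> parts_gf t s > 0"
  unfolding parts_gf_def by (intro prod_pos) simp

text \<open>\<open>S\<close> is the geometric sum of q^k over the odd k between 2 s and 2 n. The
  bounds come from exp (- r / (1 - r)) <= 1 - r <= exp (- r), with 1 - r replaced in the exponent by
  its smallest value, at j = s.\<close>

lemma parts_gf_ratio:
  assumes t: "t > 0" and s: "s \<le> n"
  defines "S \<equiv> (exp (- ((2 * real s + 1) * t)) - exp (- ((2 * real n + 1) * t))) / (1 - exp (- (2 * t)))"
  shows "parts_gf t n / parts_gf t s \<le> exp (- S)"
    "exp (- (S / (1 - exp (- ((2 * real s + 1) * t))))) \<le> parts_gf t n / parts_gf t s"
proof -
  define r where "r j = exp (- ((2 * real j + 1) * t))" for j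
  have r: "0 < r j" "r j < 1" for j using t by (auto simp: r_def)
  have S: "(\<Sum>j\<in>{s..<n}. r j) = S"
  proof -
    have pw: "exp (- (2 * t)) ^ j * exp (- t) = r j" for j
      by (simp add: r_def exp_of_nat_mult[symmetric] algebra_simps flip: exp_add)
    have "(\<Sum>j\<in>{s..<n}. r j) = (\<Sum>j\<in>{s..<n}. exp (- (2 * t)) ^ j) * exp (- t)"
      by (simp add: sum_distrib_right pw)
    also have "(\<Sum>j\<in>{s..<n}. exp (- (2 * t)) ^ j) = (exp (- (2 * t)) ^ s - exp (- (2 * t)) ^ n) / (1 - exp (- (2 * t)))"
      using t s by (intro sum_power_atLeastLessThan) auto
    also have "\<dots> * exp (- t) = S"
      by (simp add: left_diff_distrib pw S_def) (simp add: r_def)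
    finally show ?thesis .
  qed
  have ratio: "parts_gf t n / parts_gf t s = (\<Prod>j\<in>{s..<n}. 1 - r j)"
  proof -
    have "parts_gf t n = parts_gf t s * (\<Prod>j\<in>{s..<n}. 1 - r j)"
      unfolding parts_gf_def r_def lessThan_atLeast0 using s by (simp add: prod.atLeastLessThan_concat)
    then show ?thesis using parts_gf_pos[OF t, of s] by simp
  qed
  have "(\<Prod>j\<in>{s..<n}. 1 - r j) \<le> (\<Prod>j\<in>{s..<n}. exp (- r j))"
  proof (rule prod_mono)
    fix j show "0 \<le> 1 - r j \<and> 1 - r j \<le> exp (- r j)"
      using exp_ge_add_one_self[of "- r j"] r[of j] by auto
  qed
  also have "\<dots> = exp (- S)" by (simp add: exp_sum[symmetric] sum_negf S)
  finally show "parts_gf t n / parts_gf t s \<le> exp (- S)" by (simp add: ratio)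
  have "exp (- (S / (1 - r s))) = (\<Prod>j\<in>{s..<n}. exp (- (r j / (1 - r s))))"
    by (simp add: exp_sum[symmetric] sum_negf sum_divide_distrib[symmetric] S)
  also have "\<dots> \<le> (\<Prod>j\<in>{s..<n}. 1 - r j)"
  proof (rule prod_mono)
    fix j assume j: "j \<in> {s..<n}"
    have "r j \<le> r s" using j t by (simp add: r_def)
    then have "r j / (1 - r j) \<le> r j / (1 - r s)" using r[of j] r[of s]
      by (intro divide_left_mono mult_pos_pos) auto
    then have "exp (- (r j / (1 - r s))) \<le> exp (- (r j / (1 - r j)))" by simp
    also have "\<dots> \<le> 1 - r j"
    proof -
      have "1 / (1 - r j) = 1 + r j / (1 - r j)" using r[of j] by (simp add: field_simps)
      also have "\<dots> \<le> exp (r j / (1 - r j))" by (rule exp_ge_add_one_self)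
      finally show ?thesis using r[of j] by (simp add: exp_minus field_simps)
    qed
    finally show "0 \<le> exp (- (r j / (1 - r s))) \<and> exp (- (r j / (1 - r s))) \<le> 1 - r j" by simp
  qed
  finally show "exp (- (S / (1 - exp (- ((2 * real s + 1) * t))))) \<le> parts_gf t n / parts_gf t s"
    by (simp add: ratio r_def)
qed

text \<open>The first part size above the peak 2 s - 1 is 2 s + 1, which accounts for the extra exp
  (- 2 t).\<close>

lemma exp_peak_pos:
  assumes "n > 0"
  shows "exp (- ((2 * real s + 1) * saddle n)) = saddle n / 2 * exp (- peak_pos n s) * exp (- (2 * saddle n))"
proof -
  have "saddle n / 2 = exp (- ln (2 / saddle n))"
    using saddle_pos[OF assms] by (simp add: exp_minus)
  then show ?thesis
    by (simp only: peak_pos_def exp_add[symmetric]) (simp add: algebra_simps)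
qed

text \<open>The sum of q^k over all odd k > 2 n, the error of cutting the infinite product at index
  \<open>n\<close>.\<close>

definition top_tail :: "nat \<Rightarrow> real" where
  "top_tail n = exp (- ((2 * real n + 1) * saddle n)) / (1 - exp (- (2 * saddle n)))"

lemma top_tail_tendsto: "top_tail \<longlonglongrightarrow> 0"
proof (rule tendsto_sandwich)
  show "eventually (\<lambda>n. 0 \<le> top_tail n) sequentially"
    using eventually_saddle by eventually_elim (simp add: top_tail_def)
  show "eventually (\<lambda>n. top_tail n \<le> exp (- (3 / saddle n)) / (1 - exp (- (2 * saddle n)))) sequentially"
    using eventually_saddle
  proof eventually_elim
    case (elim n)
    define t where "t = saddle n"
    have t: "t > 0" using elim by (simp add: t_def)
    have "pi\<^sup>2 \<ge> 3\<^sup>2" using pi_gt3 by (intro power_mono) auto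
    then have "3 \<le> 2 * (real n * t\<^sup>2)" using saddle_sq[of n] elim by (simp add: t_def)
    also have "\<dots> \<le> (2 * real n + 1) * t * t" using t by (simp add: power2_eq_square algebra_simps)
    finally have "3 / t \<le> (2 * real n + 1) * t" using t by (simp add: pos_divide_le_eq)
    then show ?case using t unfolding top_tail_def t_def[symmetric] by (intro divide_right_mono) auto
  qed
  have "((\<lambda>t::real. exp (- (3 / t)) / (1 - exp (- (2 * t)))) \<longlongrightarrow> 0) (at_right 0)" by real_asymp
  then show "(\<lambda>n. exp (- (3 / saddle n)) / (1 - exp (- (2 * saddle n)))) \<longlonglongrightarrow> 0"
    by (rule filterlim_compose[OF _ filterlim_saddle])
qed auto

text \<open>The sum over parts above the peak is about (t / 2) exp (- u) / (2 t) = exp (- u) / 4;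
  the square doubles the exponent.\<close>

lemma parts_gf_ratio_tendsto:
  "(\<lambda>n. (parts_gf (saddle n) n / parts_gf (saddle n) (peak_idx n u))\<^sup>2) \<longlonglongrightarrow> exp (- (1/2) * exp (- u))"
proof -
  define s where "s n = peak_idx n u" for n
  define a where "a n = exp (- ((2 * real (s n) + 1) * saddle n))" for n
  define S where "S n = a n / (1 - exp (- (2 * saddle n))) - top_tail n" for n
  have ev: "eventually (\<lambda>n. 0 < saddle n \<and> n > 0 \<and> s n \<le> n) sequentially"
    using eventually_peak_idx[of u] eventually_saddle by eventually_elim (simp add: s_def)
  have V: "(\<lambda>n. exp (- peak_pos n (s n))) \<longlonglongrightarrow> exp (- u)"
    unfolding s_def by (intro tendsto_intros peak_pos_tendsto)
  have a_eq: "eventually (\<lambda>n. saddle n / 2 * exp (- peak_pos n (s n)) * exp (- (2 * saddle n)) = a n) sequentially"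
    using ev by eventually_elim (simp add: a_def exp_peak_pos)
  have "(\<lambda>n. saddle n / 2 * exp (- peak_pos n (s n)) * exp (- (2 * saddle n))) \<longlonglongrightarrow> 0 / 2 * exp (- u) * exp (- (2 * 0))"
    by (intro tendsto_intros saddle_tendsto V) auto
  with a_eq have a0: "a \<longlonglongrightarrow> 0" using Lim_transform_eventually by fastforce
  have "((\<lambda>t::real. t / 2 / (1 - exp (- (2 * t))) * exp (- (2 * t))) \<longlongrightarrow> 1 / 4) (at_right 0)" by real_asymp
  then have c: "(\<lambda>n. saddle n / 2 / (1 - exp (- (2 * saddle n))) * exp (- (2 * saddle n))) \<longlonglongrightarrow> 1 / 4"
    by (rule filterlim_compose[OF _ filterlim_saddle])
  have "(\<lambda>n. saddle n / 2 / (1 - exp (- (2 * saddle n))) * exp (- (2 * saddle n)) * exp (- peak_pos n (s n)) - top_tail n)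
     \<longlonglongrightarrow> 1 / 4 * exp (- u) - 0"
    by (intro tendsto_intros c V top_tail_tendsto)
  moreover have "eventually (\<lambda>n. saddle n / 2 / (1 - exp (- (2 * saddle n))) * exp (- (2 * saddle n)) * exp (- peak_pos n (s n)) - top_tail n = S n) sequentially"
    using a_eq
  proof eventually_elim
    case (elim n)
    then show ?case unfolding S_def elim[symmetric] by simp
  qed
  ultimately have S: "S \<longlonglongrightarrow> 1 / 4 * exp (- u)" using Lim_transform_eventually by fastforce
  have "(\<lambda>n. parts_gf (saddle n) n / parts_gf (saddle n) (s n)) \<longlonglongrightarrow> exp (- (1 / 4 * exp (- u)))"
  proof (rule tendsto_sandwich)
    show "eventually (\<lambda>n. parts_gf (saddle n) n / parts_gf (saddle n) (s n) \<le> exp (- S n)) sequentially"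
      using ev
    proof eventually_elim
      case (elim n)
      then show ?case using parts_gf_ratio(1)[of "saddle n" "s n" n]
        by (simp add: S_def a_def top_tail_def diff_divide_distrib)
    qed
    show "eventually (\<lambda>n. exp (- (S n / (1 - a n))) \<le> parts_gf (saddle n) n / parts_gf (saddle n) (s n)) sequentially"
      using ev
    proof eventually_elim
      case (elim n)
      then show ?case using parts_gf_ratio(2)[of "saddle n" "s n" n]
        by (simp add: S_def a_def top_tail_def diff_divide_distrib)
    qed
    show "(\<lambda>n. exp (- S n)) \<longlonglongrightarrow> exp (- (1 / 4 * exp (- u)))"
      by (intro tendsto_intros S)
    have "(\<lambda>n. exp (- (S n / (1 - a n)))) \<longlonglongrightarrow> exp (- (1 / 4 * exp (- u) / (1 - 0)))"
      by (intro tendsto_intros S a0) auto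
    then show "(\<lambda>n. exp (- (S n / (1 - a n)))) \<longlonglongrightarrow> exp (- (1 / 4 * exp (- u)))" by simp
  qed
  then have "(\<lambda>n. (parts_gf (saddle n) n / parts_gf (saddle n) (s n))\<^sup>2) \<longlonglongrightarrow> (exp (- (1 / 4 * exp (- u))))\<^sup>2"
    by (intro tendsto_intros)
  also have "(exp (- (1 / 4 * exp (- u))))\<^sup>2 = exp (- (1/2) * exp (- u))"
    by (simp add: power2_eq_square flip: exp_add)
  finally show ?thesis by (simp add: s_def)
qed

text \<open>Uniform in \<open>s\<close>: the geometric sum is at least E / 8 with E = exp (-
  \<open>peak_pos n s\<close>), and the cut-off costs less than 1/2. After squaring this is exp 1 <=
  3 times exp (- E / 4).\<close>

lemma parts_gf_ratio_le:
  "eventually (\<lambda>n. \<forall>s\<le>n. (parts_gf (saddle n) n / parts_gf (saddle n) s)\<^sup>2 \<le> 3 * exp (- (1 / 4 * exp (- peak_pos n s)))) sequentially"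
proof -
  have "eventually (\<lambda>n. top_tail n < 1 / 2) sequentially"
    using top_tail_tendsto by (rule order_tendstoD) simp
  then show ?thesis using eventually_saddle
  proof eventually_elim
    case (elim n)
    define t where "t = saddle n"
    have t: "t > 0" "t \<le> 1 / 4" using elim by (auto simp: t_def)
    show ?case
    proof (intro allI impI)
      fix s assume s: "s \<le> n"
      define E where "E = exp (- peak_pos n s)"
      have E: "E > 0" by (simp add: E_def)
      define D where "D = 1 - exp (- (2 * t))"
      have D: "D > 0" "D \<le> 2 * t" using exp_ge_add_one_self[of "- (2 * t)"] t by (auto simp: D_def)
      have e2: "1 / 2 \<le> exp (- (2 * t))" using exp_ge_add_one_self[of "- (2 * t)"] t by linarith
      define a where "a = exp (- ((2 * real s + 1) * t))"
      have "a = t / 2 * E * exp (- (2 * t))"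
        unfolding a_def t_def E_def using elim by (intro exp_peak_pos) simp
      then have "a / D = t / 2 * E * exp (- (2 * t)) / D" by (simp only:)
      also have "\<dots> \<ge> t / 2 * E * (1 / 2) / (2 * t)"
        using t E D e2 by (intro frac_le mult_left_mono) auto
      finally have aD: "E / 8 \<le> a / D" using t by simp
      have "parts_gf t n / parts_gf t s \<le> exp (- (a / D - top_tail n))"
        using parts_gf_ratio(1)[OF t(1) s]
        by (simp add: a_def D_def top_tail_def t_def diff_divide_distrib)
      also have "\<dots> \<le> exp (1 / 2 - E / 8)" using aD elim by simp
      finally have "(parts_gf t n / parts_gf t s)\<^sup>2 \<le> (exp (1 / 2 - E / 8))\<^sup>2"
        using parts_gf_pos[OF t(1)] by (intro power_mono) (auto simp: less_imp_le)
      also have "\<dots> = exp 1 * exp (- (1 / 4 * E))" by (simp add: power2_eq_square flip: exp_add)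
      also have "\<dots> \<le> 3 * exp (- (1 / 4 * E))" using exp_le by (intro mult_right_mono) auto
      finally show "(parts_gf (saddle n) n / parts_gf (saddle n) s)\<^sup>2 \<le> 3 * exp (- (1 / 4 * exp (- peak_pos n s)))"
        by (simp add: t_def E_def)
    qed
  qed
qed

text \<open>The count of sequences with peak 2 s - 1, up to a factor depending on \<open>n\<close>
  only, split into the factors q^c, product ratio and Fourier integral.\<close>

definition peak_weight :: "nat \<Rightarrow> nat \<Rightarrow> real" where
  "peak_weight n s = exp (- peak_pos n s) * (parts_gf (saddle n) n / parts_gf (saddle n) s)\<^sup>2 *
     (flank_sd n * norm (flank_fourier n s))"

lemma peak_weight_tendsto: "(\<lambda>n. peak_weight n (peak_idx n u)) \<longlonglongrightarrow> gauss_mass * gumbel u"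
proof -
  have "(\<lambda>n. peak_weight n (peak_idx n u)) \<longlonglongrightarrow> exp (- u) * exp (- (1/2) * exp (- u)) * \<bar>gauss_mass\<bar>"
    unfolding peak_weight_def
    by (intro tendsto_mult parts_gf_ratio_tendsto flank_fourier_tendsto tendsto_exp tendsto_minus peak_pos_tendsto)
  then show ?thesis using gauss_mass_pos by (simp add: gumbel_def mult.commute)
qed

text \<open>Applied to x = exp (- position), for which min x (1 / x) = exp (- |position|). For x >=
  1 the quartic term of exp (x / 4) is x^4 / 6144, and 12288 = 2 * 6144.\<close>

lemma cubic_exp_le: "x * (1 + x\<^sup>2) * exp (- (1 / 4 * x)) \<le> 12288 * min x (1 / x)" if x: "x > 0" for x :: real
proof -
  have 1: "x * (1 + x\<^sup>2) * exp (- (1 / 4 * x)) \<le> 12288 * x" if "x \<le> 1"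
  proof -
    have "x * (1 + x\<^sup>2) * exp (- (1 / 4 * x)) \<le> x * (1 + 1) * 1"
      using x that by (intro mult_mono) (auto intro!: power_le_one)
    then show ?thesis using x by simp
  qed
  have 2: "x * (1 + x\<^sup>2) * exp (- (1 / 4 * x)) \<le> 12288 * (1 / x)" if x1: "x \<ge> 1"
  proof -
    have "(\<Sum>n\<in>{4}. inverse (fact n) *\<^sub>R (x / 4) ^ n) \<le> (\<Sum>n. inverse (fact n) *\<^sub>R (x / 4) ^ n)"
      using x by (intro sum_le_suminf summable_exp_generic) auto
    then have "x ^ 4 / 6144 \<le> exp (x / 4)" by (simp add: exp_def fact_numeral field_simps)
    moreover have "1\<^sup>2 \<le> x\<^sup>2" using x1 by (intro power_mono) auto
    then have "x * (1 + x\<^sup>2) * x \<le> x * (2 * x\<^sup>2) * x" using x by (intro mult_right_mono mult_left_mono) auto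
    then have "x * (1 + x\<^sup>2) * x \<le> 2 * x ^ 4" by (simp add: power4_eq_xxxx power2_eq_square)
    ultimately have "x * (1 + x\<^sup>2) * x \<le> 12288 * exp (x / 4)" by linarith
    then show ?thesis using x by (simp add: exp_minus field_simps)
  qed
  show ?thesis
  proof (cases "x \<le> 1")
    case True
    then have "x \<le> 1 / x" using x mult_mono[of x 1 x 1] by (simp add: pos_le_divide_eq)
    then have "min x (1 / x) = x" by (rule min_absorb1)
    then show ?thesis using 1[OF True] by (simp only:)
  next
    case False
    then have "1 / x \<le> x" using x mult_mono[of 1 x 1 x] by (simp add: pos_divide_le_eq)
    then have "min x (1 / x) = 1 / x" by (rule min_absorb2)
    then show ?thesis using 2 False by (simp only: not_le less_imp_le)
  qed
qed

text \<open>For peaks below \<open>1 / saddle n\<close> only the crude bound on the Fourier coefficient is available; its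
  loss of a power of \<open>saddle n\<close> is absorbed by the double exponential decay of the product ratio.\<close>

lemma peak_weight_le:
  obtains C where "eventually (\<lambda>n. \<forall>s\<in>{1..n}. norm (peak_weight n s) \<le> C * exp (- \<bar>peak_pos n s\<bar>)) sequentially"
proof -
  define Q where "Q = 10 ^ 10 * (\<integral>y. 1 / (1 + y\<^sup>2) \<partial>lborel) + (1600 :: real)"
  have I: "(\<integral>y. 1 / (1 + y\<^sup>2) \<partial>lborel) \<ge> (0::real)" by (rule integral_nonneg_AE) auto
  then have Q: "Q \<ge> 0" by (simp add: Q_def)
  have "eventually (\<lambda>n. \<forall>s\<in>{1..n}. norm (peak_weight n s) \<le> (3 * Q * 12288) * exp (- \<bar>peak_pos n s\<bar>)) sequentially"
    using parts_gf_ratio_le eventually_saddle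
  proof eventually_elim
    case (elim n)
    define t where "t = saddle n"
    have t: "t > 0" "t \<le> 1 / 4" using elim by (auto simp: t_def)
    have sd: "flank_sd n > 0" using flank_sd_bounds(5)[of n] elim by simp
    show ?case
    proof
      fix s assume s: "s \<in> {1..n}"
      define E where "E = exp (- peak_pos n s)"
      have E: "E > 0" by (simp add: E_def)
      have J: "flank_sd n * norm (flank_fourier n s) \<le> Q * (1 + E\<^sup>2)"
      proof (cases "1 \<le> 2 * t * real s")
        case True
        then have "flank_sd n * norm (flank_fourier n s) \<le> Q * 1"
          using flank_fourier_le[of n s] elim by (simp add: t_def Q_def)
        also have "\<dots> \<le> Q * (1 + E\<^sup>2)" using Q by (intro mult_left_mono) auto
        finally show ?thesis .
      next
        case False
        \<comment> \<open>A peak this small lies so far to the left that E >= 2 / (e t) >= 1 / (2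
          t); hence 400 / t^2 is at most 1600 E^2.\<close>
        then have "peak_pos n s \<le> 1 - ln (2 / t)"
          using t by (simp add: peak_pos_def t_def[symmetric] algebra_simps)
        then have "exp (ln (2 / t) - 1) \<le> E" unfolding E_def by simp
        moreover have "exp (ln (2 / t) - 1) = 2 / t * exp (-1)"
          using t by (simp add: exp_diff exp_minus field_simps)
        moreover have "1 / 4 \<le> exp (-1 :: real)" using exp_le by (simp add: exp_minus field_simps)
        then have "2 / t * (1 / 4) \<le> 2 / t * exp (-1)" using t by (intro mult_left_mono) auto
        ultimately have "1 / (2 * t) \<le> E" by simp
        then have "(1 / (2 * t))\<^sup>2 \<le> E\<^sup>2" using t by (intro power_mono) auto
        then have "400 / t\<^sup>2 \<le> 1600 * E\<^sup>2" by (simp add: power_divide power_mult_distrib)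
        also have "\<dots> \<le> Q * (1 + E\<^sup>2)" using I by (intro mult_mono) (auto simp: Q_def)
        finally show ?thesis using flank_fourier_le_crude[of n s] elim by (simp add: t_def)
      qed
      have "norm (peak_weight n s) = E * (parts_gf t n / parts_gf t s)\<^sup>2 * (flank_sd n * norm (flank_fourier n s))"
        using sd by (simp add: peak_weight_def E_def t_def abs_mult)
      also have "\<dots> \<le> E * (3 * exp (- (1 / 4 * E))) * (Q * (1 + E\<^sup>2))"
      proof (rule mult_mono[OF mult_left_mono J])
        show "(parts_gf t n / parts_gf t s)\<^sup>2 \<le> 3 * exp (- (1 / 4 * E))"
          using elim(1) s by (simp add: E_def t_def)
      qed (use E sd in auto)
      also have "\<dots> = 3 * Q * (E * (1 + E\<^sup>2) * exp (- (1 / 4 * E)))" by simp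
      also have "\<dots> \<le> 3 * Q * (12288 * min E (1 / E))" using Q E by (intro mult_left_mono cubic_exp_le) auto
      also have "min E (1 / E) = exp (- \<bar>peak_pos n s\<bar>)"
      proof -
        have "1 / E = exp (peak_pos n s)" by (simp add: E_def exp_minus inverse_eq_divide)
        then show ?thesis by (simp add: E_def min_def)
      qed
      finally show "norm (peak_weight n s) \<le> (3 * Q * 12288) * exp (- \<bar>peak_pos n s\<bar>)" by simp
    qed
  qed
  then show ?thesis by (rule that)
qed

section \<open>From weights to expectations\<close>

definition peak_count :: "nat \<Rightarrow> nat \<Rightarrow> nat" where
  "peak_count n s = card (flank_pairs s s (int n - (2 * int s - 1)))"

text \<open>In exp (- \<open>peak_pos\<close>) times exp (- (n - c) t) the peak c cancels exactly,
  and so does the product up to \<open>s\<close>. The remaining factor does not depend on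
  \<open>s\<close>.\<close>

lemma peak_weight_eq_count:
  assumes n: "n > 0"
  shows "peak_weight n s = 2 * pi * flank_sd n * (parts_gf (saddle n) n)\<^sup>2 *
    exp (ln (2 / saddle n) - real n * saddle n) * real (peak_count n s)"
proof -
  define t where "t = saddle n"
  have t: "t > 0" using saddle_pos[OF n] by (simp add: t_def)
  have J: "norm (flank_fourier n s) =
     2 * pi * real (peak_count n s) * exp (- ((real n - (2 * real s - 1)) * t)) * (parts_gf t s)\<^sup>2"
    unfolding flank_fourier_def fourier_coeff_parts_cf[OF t[unfolded t_def]] norm_of_real
    using parts_gf_pos[OF t, of s] by (simp add: peak_count_def t_def abs_mult power2_eq_square)
  have E: "exp (- peak_pos n s) * exp (- ((real n - (2 * real s - 1)) * t)) = exp (ln (2 / t) - real n * t)"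
    by (simp add: peak_pos_def t_def algebra_simps flip: exp_add)
  have "peak_weight n s = (exp (- peak_pos n s) * exp (- ((real n - (2 * real s - 1)) * t))) *
      (parts_gf t n)\<^sup>2 * flank_sd n * 2 * pi * real (peak_count n s) * ((parts_gf t s)\<^sup>2 / (parts_gf t s)\<^sup>2)"
    unfolding peak_weight_def J t_def[symmetric] by (simp add: power_divide)
  then show ?thesis using parts_gf_pos[OF t, of s] unfolding E by (simp add: t_def)
qed

lemma sum_OU_PK: "(\<Sum>l\<in>OU n. f (PK l)) = (\<Sum>s\<in>{1..n}. real (peak_count n s) * f (2 * s - 1))" for f :: "nat \<Rightarrow> real"
proof -
  have idx: "(PK l - 1) div 2 < n \<and> ((PK l - 1) div 2 = s \<longleftrightarrow> PK l = 2 * s + 1)" if "l \<in> OU n" for l s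
  proof -
    obtain s' where "PK l = 2 * s' + 1" "s' < n" using \<open>l \<in> OU n\<close> by (rule PK_OU)
    then show ?thesis by simp
  qed
  have "(\<Sum>l\<in>OU n. f (PK l)) = (\<Sum>s\<in>{..<n}. \<Sum>l\<in>{l \<in> OU n. (PK l - 1) div 2 = s}. f (PK l))"
    by (rule sum.group[symmetric]) (use idx finite_OU in auto)
  also have "\<dots> = (\<Sum>s\<in>{..<n}. real (peak_count n (Suc s)) * f (2 * Suc s - 1))"
  proof (rule sum.cong)
    fix s
    have "{l \<in> OU n. (PK l - 1) div 2 = s} = {l \<in> OU n. PK l = 2 * s + 1}"
      using idx by blast
    then have "(\<Sum>l\<in>{l \<in> OU n. (PK l - 1) div 2 = s}. f (PK l)) = real (card {l \<in> OU n. PK l = 2 * s + 1}) * f (2 * s + 1)"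
      by simp
    then show "(\<Sum>l\<in>{l \<in> OU n. (PK l - 1) div 2 = s}. f (PK l)) = real (peak_count n (Suc s)) * f (2 * Suc s - 1)"
      unfolding card_PK_fibre peak_count_def by (simp add: add.commute)
  qed simp
  also have "\<dots> = (\<Sum>s\<in>{1..n}. real (peak_count n s) * f (2 * s - 1))"
    by (rule sum.reindex_bij_witness[where i = "\<lambda>s. s - 1" and j = Suc]) auto
  finally show ?thesis .
qed

lemma expectation_PK:
  assumes n: "n > 0"
  shows "measure_pmf.expectation (OU_pmf n) (\<lambda>l. f (PK l)) =
    (\<Sum>s\<in>{1..n}. real (peak_count n s) * f (2 * s - 1)) / (\<Sum>s\<in>{1..n}. real (peak_count n s))"
    "(\<Sum>s\<in>{1..n}. real (peak_count n s)) > 0"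
proof -
  have card: "real (card (OU n)) = (\<Sum>s\<in>{1..n}. real (peak_count n s))"
    using sum_OU_PK[of "\<lambda>_. 1" n] by simp
  show "measure_pmf.expectation (OU_pmf n) (\<lambda>l. f (PK l)) =
    (\<Sum>s\<in>{1..n}. real (peak_count n s) * f (2 * s - 1)) / (\<Sum>s\<in>{1..n}. real (peak_count n s))"
    unfolding OU_pmf_def card[symmetric] sum_OU_PK[symmetric]
    by (rule integral_pmf_of_set) (auto simp: OU_nonempty n finite_OU)
  have "card (OU n) > 0" using OU_nonempty[OF n] finite_OU[of n] by (simp add: card_gt_0_iff)
  then show "(\<Sum>s\<in>{1..n}. real (peak_count n s)) > 0" by (simp only: card[symmetric] of_nat_0_less_iff)
qed

lemma peak_idx_eq_iff:
  assumes "saddle n > 0" "s \<ge> 1"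
  shows "peak_idx n u = s \<longleftrightarrow>
    u \<in> {2 * saddle n * (real s - 1) - ln (2 / saddle n)..<2 * saddle n * real s - ln (2 / saddle n)}"
proof -
  define x where "x = (u + ln (2 / saddle n)) / (2 * saddle n)"
  have "peak_idx n u = s \<longleftrightarrow> \<lfloor>x\<rfloor> = int s - 1"
    using assms by (auto simp: peak_idx_def x_def)
  also have "\<dots> \<longleftrightarrow> real s - 1 \<le> x \<and> x < real s"
    by (simp add: floor_eq_iff)
  also have "\<dots> \<longleftrightarrow> u \<in> {2 * saddle n * (real s - 1) - ln (2 / saddle n)..<2 * saddle n * real s - ln (2 / saddle n)}"
  proof -
    have t2: "0 < 2 * saddle n" using assms(1) by simp
    show ?thesis
      unfolding x_def pos_le_divide_eq[OF t2] pos_divide_less_eq[OF t2] by (simp add: algebra_simps)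
  qed
  finally show ?thesis .
qed

text \<open>A sum over peaks is the integral of a step function with cells of length 2 t, so
  convergence of Riemann sums becomes a matter of dominated convergence.\<close>

lemma has_bochner_integral_peak_idx:
  fixes g :: "nat \<Rightarrow> real"
  assumes t: "saddle n > 0"
  shows "has_bochner_integral lborel (\<lambda>u. if peak_idx n u \<in> {1..n} then g (peak_idx n u) else 0)
     (2 * saddle n * (\<Sum>s\<in>{1..n}. g s))"
proof -
  define I where "I s = {2 * saddle n * (real s - 1) - ln (2 / saddle n)..<2 * saddle n * real s - ln (2 / saddle n)}" for s
  have eq: "(if peak_idx n u \<in> {1..n} then g (peak_idx n u) else 0) = (\<Sum>s\<in>{1..n}. g s * indicator (I s) u)" for u
  proof -
    have "(\<Sum>s\<in>{1..n}. g s * indicator (I s) u) = (\<Sum>s\<in>{1..n}. if peak_idx n u = s then g s else 0)"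
      using peak_idx_eq_iff[OF t] by (intro sum.cong) (auto simp: I_def[symmetric] indicator_def)
    then show ?thesis by (simp add: sum.delta)
  qed
  have "has_bochner_integral lborel (\<lambda>u. g s * indicator (I s) u) (g s * (2 * saddle n))" for s
  proof -
    have le: "2 * saddle n * (real s - 1) - ln (2 / saddle n) \<le> 2 * saddle n * real s - ln (2 / saddle n)"
      using t by (simp add: algebra_simps)
    have "has_bochner_integral lborel (indicator (I s)) (measure lborel (I s))"
      by (rule has_bochner_integral_real_indicator) (auto simp: I_def emeasure_lborel_Ico[OF le])
    moreover have "measure lborel (I s) = 2 * saddle n"
      unfolding I_def measure_lborel_Ico[OF le] by (simp add: algebra_simps)
    ultimately show ?thesis by (intro has_bochner_integral_mult_right) simp
  qed
  then have "has_bochner_integral lborel (\<lambda>u. \<Sum>s\<in>{1..n}. g s * indicator (I s) u) (\<Sum>s\<in>{1..n}. g s * (2 * saddle n))"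
    by (rule has_bochner_integral_sum)
  then show ?thesis unfolding eq by (simp only: sum_distrib_right[symmetric] mult.commute)
qed

text \<open>The growth bound and almost everywhere continuity cover both the indicator of a
  half-line and the identity. Half of the decay exp (- |V|) pays for |h V| <= 2 exp (|V| / 2), and
  moving from V to u, at distance at most 1/4, costs exp (1/8).\<close>

lemma peak_weight_sum_tendsto:
  fixes h :: "real \<Rightarrow> real"
  assumes h[measurable]: "h \<in> borel_measurable borel" and bound: "\<And>x. \<bar>h x\<bar> \<le> 1 + \<bar>x\<bar>"
    and cont: "AE u in lborel. isCont h u"
  shows "(\<lambda>n. 2 * saddle n * (\<Sum>s\<in>{1..n}. h (peak_pos n s) * peak_weight n s)) \<longlonglongrightarrow>
    gauss_mass * (\<integral>u. h u * gumbel u \<partial>lborel)"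
proof -
  define F where "F n u = (if n > 0 \<and> peak_idx n u \<in> {1..n} then h (peak_pos n (peak_idx n u)) * peak_weight n (peak_idx n u) else 0)" for n u
  have F: "has_bochner_integral lborel (F n) (2 * saddle n * (\<Sum>s\<in>{1..n}. h (peak_pos n s) * peak_weight n s))" for n
  proof (cases "n > 0")
    case True
    then show ?thesis
      using has_bochner_integral_peak_idx[OF saddle_pos[OF True], of "\<lambda>s. h (peak_pos n s) * peak_weight n s"]
      by (simp add: F_def[abs_def])
  next
    case False
    then show ?thesis by (simp add: F_def[abs_def] has_bochner_integral_zero)
  qed
  obtain C where C: "eventually (\<lambda>n. \<forall>s\<in>{1..n}. norm (peak_weight n s) \<le> C * exp (- \<bar>peak_pos n s\<bar>)) sequentially"
    by (rule peak_weight_le)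
  have "(\<lambda>n. integral\<^sup>L lborel (F n)) \<longlonglongrightarrow> (\<integral>u. h u * (gauss_mass * gumbel u) \<partial>lborel)"
  proof (rule integral_dominated_convergence_eventually(2))
    show "F n \<in> borel_measurable lborel" for n using F[of n] by (rule borel_measurable_has_bochner_integral)
    show "integrable lborel (\<lambda>u::real. 4 * \<bar>C\<bar> * exp (- (1/2 * \<bar>u\<bar>)))"
      by (intro integrable_mult_right integrable_exp_abs) auto
    show "AE u in lborel. (\<lambda>n. F n u) \<longlonglongrightarrow> h u * (gauss_mass * gumbel u)"
      using cont
    proof eventually_elim
      case (elim u)
      have "(\<lambda>n. h (peak_pos n (peak_idx n u)) * peak_weight n (peak_idx n u)) \<longlonglongrightarrow> h u * (gauss_mass * gumbel u)"
        by (intro tendsto_mult peak_weight_tendsto isCont_tendsto_compose[OF elim] peak_pos_tendsto)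
      moreover have "eventually (\<lambda>n. h (peak_pos n (peak_idx n u)) * peak_weight n (peak_idx n u) = F n u) sequentially"
        using eventually_peak_idx[of u] eventually_saddle by eventually_elim (simp add: F_def)
      ultimately show ?case by (rule Lim_transform_eventually)
    qed
    show "eventually (\<lambda>n. AE u in lborel. norm (F n u) \<le> 4 * \<bar>C\<bar> * exp (- (1/2 * \<bar>u\<bar>))) sequentially"
      using C eventually_saddle
    proof eventually_elim
      case (elim n)
      have "norm (F n u) \<le> 4 * \<bar>C\<bar> * exp (- (1/2 * \<bar>u\<bar>))" for u
      proof (cases "peak_idx n u \<in> {1..n}")
        case True
        define V where "V = peak_pos n (peak_idx n u)"
        have V: "\<bar>u\<bar> - 1/4 \<le> \<bar>V\<bar>" using peak_pos_idx[of n u] True elim by (auto simp: V_def)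
        have "norm (peak_weight n (peak_idx n u)) \<le> C * exp (- \<bar>V\<bar>)" using elim True by (auto simp: V_def)
        also have "\<dots> \<le> \<bar>C\<bar> * exp (- \<bar>V\<bar>)" by (intro mult_right_mono) auto
        finally have w: "norm (peak_weight n (peak_idx n u)) \<le> \<bar>C\<bar> * exp (- \<bar>V\<bar>)" .
        have "\<bar>h V\<bar> \<le> 2 * exp (1/2 * \<bar>V\<bar>)"
          using bound[of V] exp_ge_add_one_self[of "1/2 * \<bar>V\<bar>"] by linarith
        then have "norm (F n u) \<le> 2 * exp (1/2 * \<bar>V\<bar>) * (\<bar>C\<bar> * exp (- \<bar>V\<bar>))"
          using w True elim mult_mono[of "\<bar>h V\<bar>" "2 * exp (1/2 * \<bar>V\<bar>)" "\<bar>peak_weight n (peak_idx n u)\<bar>"]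
          by (simp add: F_def V_def[symmetric] abs_mult)
        also have "\<dots> = 2 * \<bar>C\<bar> * exp (- (1/2 * \<bar>V\<bar>))" by (simp flip: exp_add)
        also have "\<dots> \<le> 2 * \<bar>C\<bar> * (2 * exp (- (1/2 * \<bar>u\<bar>)))"
        proof (intro mult_left_mono)
          have "exp (- (1/2 * \<bar>V\<bar>)) \<le> exp (1/8 + - (1/2 * \<bar>u\<bar>))" using V by simp
          also have "\<dots> = exp (1/8) * exp (- (1/2 * \<bar>u\<bar>))" by (rule exp_add)
          also have "exp (1/8) \<le> 1 + 1/8 + (1/8 :: real)\<^sup>2" by (rule exp_bound) auto
          then have "exp (1/8) * exp (- (1/2 * \<bar>u\<bar>)) \<le> 2 * exp (- (1/2 * \<bar>u\<bar>))"
            by (intro mult_right_mono) (auto simp: power2_eq_square)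
          finally show "exp (- (1/2 * \<bar>V\<bar>)) \<le> 2 * exp (- (1/2 * \<bar>u\<bar>))" .
        qed auto
        finally show ?thesis by simp
      qed (auto simp: F_def)
      then show ?case by simp
    qed
  qed auto
  moreover have "(\<integral>u. h u * (gauss_mass * gumbel u) \<partial>lborel) = gauss_mass * (\<integral>u. h u * gumbel u \<partial>lborel)"
    by (subst integral_mult_right_zero[symmetric]) (simp add: mult.left_commute)
  moreover have "integral\<^sup>L lborel (F n) = 2 * saddle n * (\<Sum>s\<in>{1..n}. h (peak_pos n s) * peak_weight n s)" for n
    using F[of n] by (rule has_bochner_integral_integral_eq)
  ultimately show ?thesis by simp
qed

text \<open>Quotient of the weighted sums for \<open>h\<close> and for the constant 1. The divisor 2
  is the total mass of \<open>gumbel\<close>.\<close>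

lemma expectation_PK_tendsto:
  fixes h :: "real \<Rightarrow> real"
  assumes "h \<in> borel_measurable borel" "\<And>x. \<bar>h x\<bar> \<le> 1 + \<bar>x\<bar>" "AE u in lborel. isCont h u"
  shows "(\<lambda>n. measure_pmf.expectation (OU_pmf n) (\<lambda>l. h (saddle n * real (PK l) - ln (2 / saddle n))))
    \<longlonglongrightarrow> (\<integral>u. h u * gumbel u \<partial>lborel) / 2"
proof -
  define W where "W h n = 2 * saddle n * (\<Sum>s\<in>{1..n}. h (peak_pos n s) * peak_weight n s)" for h :: "real \<Rightarrow> real" and n
  have "W h \<longlonglongrightarrow> gauss_mass * (\<integral>u. h u * gumbel u \<partial>lborel)"
    unfolding W_def[abs_def] by (intro peak_weight_sum_tendsto assms)
  moreover have "W (\<lambda>_. 1) \<longlonglongrightarrow> gauss_mass * (\<integral>u. 1 * gumbel u \<partial>lborel)"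
    unfolding W_def[abs_def] by (intro peak_weight_sum_tendsto) auto
  ultimately have "(\<lambda>n. W h n / W (\<lambda>_. 1) n) \<longlonglongrightarrow>
      gauss_mass * (\<integral>u. h u * gumbel u \<partial>lborel) / (gauss_mass * (\<integral>u. 1 * gumbel u \<partial>lborel))"
    using gauss_mass_pos by (intro tendsto_divide) (auto simp: integral_gumbel)
  then have "(\<lambda>n. W h n / W (\<lambda>_. 1) n) \<longlonglongrightarrow> (\<integral>u. h u * gumbel u \<partial>lborel) / 2"
    using gauss_mass_pos by (simp add: integral_gumbel)
  moreover have "eventually (\<lambda>n. W h n / W (\<lambda>_. 1) n =
     measure_pmf.expectation (OU_pmf n) (\<lambda>l. h (saddle n * real (PK l) - ln (2 / saddle n)))) sequentially"
    using eventually_saddle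
  proof eventually_elim
    case (elim n)
    define K where "K = 2 * pi * flank_sd n * (parts_gf (saddle n) n)\<^sup>2 * exp (ln (2 / saddle n) - real n * saddle n)"
    have K: "K \<noteq> 0" using flank_sd_bounds(5)[of n] parts_gf_pos[of "saddle n" n] elim by (simp add: K_def)
    have W: "W g n = (2 * saddle n * K) * (\<Sum>s\<in>{1..n}. real (peak_count n s) * g (peak_pos n s))" for g
      unfolding W_def using elim
      by (simp only: peak_weight_eq_count K_def[symmetric] sum_distrib_left) (simp add: mult_ac)
    have "W h n / W (\<lambda>_. 1) n =
       (\<Sum>s\<in>{1..n}. real (peak_count n s) * h (peak_pos n s)) / (\<Sum>s\<in>{1..n}. real (peak_count n s))"
      unfolding W using K elim by simp
    also have "(\<Sum>s\<in>{1..n}. real (peak_count n s) * h (peak_pos n s)) =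
       (\<Sum>s\<in>{1..n}. real (peak_count n s) * h (saddle n * real (2 * s - 1) - ln (2 / saddle n)))"
      by (intro sum.cong) (auto simp: peak_pos_def of_nat_diff)
    also have "\<dots> / (\<Sum>s\<in>{1..n}. real (peak_count n s)) =
       measure_pmf.expectation (OU_pmf n) (\<lambda>l. h (saddle n * real (PK l) - ln (2 / saddle n)))"
      using elim by (subst expectation_PK(1)[of n "\<lambda>c. h (saddle n * real c - ln (2 / saddle n))"]) auto
    finally show ?case .
  qed
  ultimately show ?thesis by (rule Lim_transform_eventually)
qed

theorem theorem1p5:
  fixes B :: real
  assumes B: "B = sqrt 6 / pi"
  shows "(\<forall>v::real.
            (\<lambda>n::nat. measure_pmf.prob (OU_pmf n)
               {l. (real (PK l) - B * sqrt (real n) * ln (2 * B * sqrt (real n)))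
                     / (B * sqrt (real n)) \<le> v})
              \<longlonglongrightarrow> exp (- (1/2) * exp (- v)))
       \<and> (\<exists>\<epsilon>::nat \<Rightarrow> real. \<epsilon> \<in> o(\<lambda>_. 1) \<and>
            (\<forall>\<^sub>F n in sequentially.
               measure_pmf.expectation (OU_pmf n) (\<lambda>l. real (PK l)) =
                 B * sqrt (real n) * ln (2 * B * sqrt (real n))
                 + B * sqrt (real n) * ((euler_mascheroni :: real) - ln 2) * (1 + \<epsilon> n)))"
proof -
  \<comment> \<open>Valid also at n = 0, where both sides are 0 by the convention on division by
    zero.\<close>
  have Bn: "B * sqrt (real n) = 1 / saddle n" for n
    by (simp add: B saddle_def real_sqrt_mult)
  have B2n: "2 * B * sqrt (real n) = 2 / saddle n" for n
    using Bn[of n] by (simp add: mult.assoc)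
  define L where "L n = ln (2 / saddle n)" for n
  have part1: "(\<lambda>n. measure_pmf.prob (OU_pmf n) {l. (real (PK l) - 1 / saddle n * L n) / (1 / saddle n) \<le> v})
      \<longlonglongrightarrow> exp (- (1/2) * exp (- v))" for v
  proof -
    have "(\<lambda>n. measure_pmf.expectation (OU_pmf n) (\<lambda>l. indicator {..v} (saddle n * real (PK l) - L n)))
        \<longlonglongrightarrow> (\<integral>u. indicator {..v} u * gumbel u \<partial>lborel) / 2"
      unfolding L_def
    proof (rule expectation_PK_tendsto)
      \<comment> \<open>The indicator is discontinuous only at \<open>v\<close>, a null set.\<close>
      have "AE u in lborel. u \<noteq> v" by (rule AE_lborel_singleton)
      then show "AE u in lborel. isCont (indicator {..v} :: real \<Rightarrow> real) u"
        by eventually_elim (simp add: isCont_indicator)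
    qed (auto simp: indicator_def)
    also have "(\<integral>u. indicator {..v} u * gumbel u \<partial>lborel) / 2 = exp (- (1/2) * exp (- v))"
      by (simp add: integral_gumbel_atMost)
    finally have "(\<lambda>n. measure_pmf.expectation (OU_pmf n) (\<lambda>l. indicator {..v} (saddle n * real (PK l) - L n)))
        \<longlonglongrightarrow> exp (- (1/2) * exp (- v))" .
    moreover have "eventually (\<lambda>n. measure_pmf.expectation (OU_pmf n) (\<lambda>l. indicator {..v} (saddle n * real (PK l) - L n)) =
       measure_pmf.prob (OU_pmf n) {l. (real (PK l) - 1 / saddle n * L n) / (1 / saddle n) \<le> v}) sequentially"
      using eventually_saddle
    proof eventually_elim
      case (elim n)
      have "indicator {..v} (saddle n * real (PK l) - L n) =
          (indicator {l. (real (PK l) - 1 / saddle n * L n) / (1 / saddle n) \<le> v} l :: real)" for l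
        using elim by (simp add: indicator_def algebra_simps)
      then show ?case by simp
    qed
    ultimately show ?thesis by (rule Lim_transform_eventually)
  qed
  define X where "X n = measure_pmf.expectation (OU_pmf n) (\<lambda>l. saddle n * real (PK l) - L n)" for n
  define c where "c = euler_mascheroni - ln (2::real)"
  \<comment> \<open>gamma < 13/22 < 2/3 <= ln 2. The sign is needed because the relative error is
    obtained by dividing by \<open>c\<close>.\<close>
  have c: "c \<noteq> 0" using euler_mascheroni_less_13_over_22 ln2_ge_two_thirds by (simp add: c_def)
  have "X \<longlonglongrightarrow> (\<integral>u. u * gumbel u \<partial>lborel) / 2"
    unfolding X_def[abs_def] L_def by (rule expectation_PK_tendsto[where h = "\<lambda>x. x"]) auto
  then have X: "X \<longlonglongrightarrow> c" by (simp add: integral_gumbel_mean c_def diff_divide_distrib)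
  \<comment> \<open>Chosen so that the asymptotic formula becomes an exact identity for large
    n.\<close>
  define \<epsilon> where "\<epsilon> n = X n / c - 1" for n
  have "(\<lambda>n. X n / c - 1) \<longlonglongrightarrow> c / c - 1" using c by (intro tendsto_intros X)
  then have "\<epsilon> \<longlonglongrightarrow> 0" using c by (simp add: \<epsilon>_def[abs_def])
  then have "\<epsilon> \<in> o(\<lambda>_. 1)" by (intro smalloI_tendsto) simp_all
  moreover have "eventually (\<lambda>n. measure_pmf.expectation (OU_pmf n) (\<lambda>l. real (PK l)) =
      1 / saddle n * L n + 1 / saddle n * c * (1 + \<epsilon> n)) sequentially"
    using eventually_saddle
  proof eventually_elim
    case (elim n)
    have "finite (set_pmf (OU_pmf n))"
      unfolding OU_pmf_def using elim by (subst set_pmf_of_set) (auto simp: OU_nonempty finite_OU)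
    then have int: "integrable (measure_pmf (OU_pmf n)) f" for f :: "peaked_seq \<Rightarrow> real"
      by (rule integrable_measure_pmf_finite)
    have "X n = saddle n * measure_pmf.expectation (OU_pmf n) (\<lambda>l. real (PK l)) - L n"
      unfolding X_def by (subst Bochner_Integration.integral_diff) (auto simp: int)
    moreover have "c * (1 + \<epsilon> n) = X n" using c by (simp add: \<epsilon>_def)
    ultimately show ?case using elim by (simp add: mult.assoc field_simps)
  qed
  ultimately show ?thesis
    unfolding B2n unfolding Bn using part1 by (auto simp: L_def c_def)
qed

end
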